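(* Let $A$ be a commutative ring with nonzero identity and with Jacobson radical $M$, let $E$ be an $A$-module, and let $R=A\propto E$ be the trivial ring extension of $A$ by $E$. (1) $R$ is an $OAF$-ring if and only if one of the following conditions is satisfied. (A) $A$ is a general $ZPI$-ring, $E$ is cyclic and the annihilator of $E$ is a (possibly empty) product of idempotent maximal ideals of $A$. (B) $A$ is local, $M^2$ is divided, $E=\{0\}$ and either $M$ is nilpotent or $A$ is a domain with $\bigcap_{n\in\mathbb{N}} M^n=\{0\}$. (C) $A$ is local, $M^2=\{0\}$, $ME=aE$ for each nonzero $a\in M$ and $ME=Mx$ for each $x\in E\setminus ME$. In particular, if $R$ is an $OAF$-ring, then $A$ is an $OAF$-ring. (2) Every proper ideal of $R$ is an $OA$-ideal if and only if $A$ is local, $M^2=\{0\}$ and $ME=\{0\}$.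
   Context: All rings are commutative with nonzero identity and all modules are unital; $\mathbb{N}$ is the set of positive integers. Local means having exactly one maximal ideal (no Noetherian assumption). The trivial ring extension (idealization) $A\propto E$ is the ring with additive group $A\oplus E$ and multiplication $(a,e)(b,f)=(ab,af+be)$. An ideal $I$ of a ring $R$ is proper if $I\neq R$. A proper ideal $I$ of $R$ is an $OA$-ideal ($1$-absorbing prime ideal) if whenever $a,b,c\in R$ are nonunits with $abc\in I$, then $ab\in I$ or $c\in I$. A ring is an $OAF$-ring if every proper ideal is a finite product (of at least one factor) of $OA$-ideals. A ring is a general $ZPI$-ring if every proper ideal is a finite product of prime ideals. An ideal of a ring is divided if it is comparable under inclusion to every ideal of the ring. The empty product of ideals of $A$ is $A$ itself. *)

theory Defs
  imports "HOL-Algebra.Ideal_Product" "HOL-Algebra.Module"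
begin

definition proper_ideal :: "'a set \<Rightarrow> ('a, 'm) ring_scheme \<Rightarrow> bool" where
  "proper_ideal I R \<longleftrightarrow> ideal I R \<and> I \<noteq> carrier R"

definition local_ring :: "('a, 'm) ring_scheme \<Rightarrow> bool" where
  "local_ring R \<longleftrightarrow> (\<exists>!P. maximalideal P R)"

definition jacobson_radical :: "('a, 'm) ring_scheme \<Rightarrow> 'a set" where
  "jacobson_radical R = {r \<in> carrier R. \<forall>P. maximalideal P R \<longrightarrow> r \<in> P}"

definition divided_ideal :: "'a set \<Rightarrow> ('a, 'm) ring_scheme \<Rightarrow> bool" where
  "divided_ideal I R \<longleftrightarrow> ideal I R \<and> (\<forall>J. ideal J R \<longrightarrow> I \<subseteq> J \<or> J \<subseteq> I)"

text \<open>The power is taken in the monoid of ideals, whose identity element is the whole ring.\<close>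

abbreviation ideal_pow :: "('a, 'm) ring_scheme \<Rightarrow> 'a set \<Rightarrow> nat \<Rightarrow> 'a set" where
  "ideal_pow R I n \<equiv> I [^]\<^bsub>ideals_set R\<^esub> n"

definition nilpotent_ideal :: "'a set \<Rightarrow> ('a, 'm) ring_scheme \<Rightarrow> bool" where
  "nilpotent_ideal I R \<longleftrightarrow> ideal I R \<and> (\<exists>n\<ge>1. ideal_pow R I n = {\<zero>\<^bsub>R\<^esub>})"

definition idempotent_ideal :: "'a set \<Rightarrow> ('a, 'm) ring_scheme \<Rightarrow> bool" where
  "idempotent_ideal I R \<longleftrightarrow> ideal I R \<and> I \<cdot>\<^bsub>R\<^esub> I = I"

definition ideal_list_prod :: "('a, 'm) ring_scheme \<Rightarrow> 'a set list \<Rightarrow> 'a set" where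
  "ideal_list_prod R Is = foldr (ideal_prod R) Is (carrier R)"

definition OA_ideal :: "'a set \<Rightarrow> ('a, 'm) ring_scheme \<Rightarrow> bool" where
  "OA_ideal I R \<longleftrightarrow> proper_ideal I R \<and>
     (\<forall>a \<in> carrier R - Units R. \<forall>b \<in> carrier R - Units R. \<forall>c \<in> carrier R - Units R.
        a \<otimes>\<^bsub>R\<^esub> b \<otimes>\<^bsub>R\<^esub> c \<in> I \<longrightarrow> a \<otimes>\<^bsub>R\<^esub> b \<in> I \<or> c \<in> I)"

definition OAF_ring :: "('a, 'm) ring_scheme \<Rightarrow> bool" where
  "OAF_ring R \<longleftrightarrow> (\<forall>I. proper_ideal I R \<longrightarrow>
     (\<exists>Js. Js \<noteq> [] \<and> (\<forall>J \<in> set Js. OA_ideal J R) \<and> I = ideal_list_prod R Js))"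

definition general_ZPI_ring :: "('a, 'm) ring_scheme \<Rightarrow> bool" where
  "general_ZPI_ring R \<longleftrightarrow> (\<forall>I. proper_ideal I R \<longrightarrow>
     (\<exists>Ps. Ps \<noteq> [] \<and> (\<forall>P \<in> set Ps. primeideal P R) \<and> I = ideal_list_prod R Ps))"

definition cyclic_module :: "('a, 'm) ring_scheme \<Rightarrow> ('a, 'b, 'n) module_scheme \<Rightarrow> bool" where
  "cyclic_module A E \<longleftrightarrow> (\<exists>x \<in> carrier E. carrier E = {a \<odot>\<^bsub>E\<^esub> x | a. a \<in> carrier A})"

definition annihilator :: "('a, 'm) ring_scheme \<Rightarrow> ('a, 'b, 'n) module_scheme \<Rightarrow> 'a set" where
  "annihilator A E = {a \<in> carrier A. \<forall>x \<in> carrier E. a \<odot>\<^bsub>E\<^esub> x = \<zero>\<^bsub>E\<^esub>}"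

text \<open>The submodule \<open>IE\<close> of finite sums of products, for an ideal \<open>I\<close>. As for
  \<^const>\<open>ideal_prod\<close>, the zero element needs no clause of its own, because \<open>I\<close> contains zero.\<close>

inductive_set ideal_smult :: "'a set \<Rightarrow> ('a, 'b, 'n) module_scheme \<Rightarrow> 'b set"
  for I and E (structure) where
    smult: "\<lbrakk> a \<in> I; x \<in> carrier E \<rbrakk> \<Longrightarrow> a \<odot> x \<in> ideal_smult I E"
  | sum: "\<lbrakk> x \<in> ideal_smult I E; y \<in> ideal_smult I E \<rbrakk> \<Longrightarrow> x \<oplus> y \<in> ideal_smult I E"

definition trivial_extension ::
    "('a, 'm) ring_scheme \<Rightarrow> ('a, 'b, 'n) module_scheme \<Rightarrow> ('a \<times> 'b) ring" (infixr \<open>\<propto>\<close> 75) where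
  "A \<propto> E = \<lparr> carrier = carrier A \<times> carrier E,
     mult = (\<lambda>(a, e) (b, f). (a \<otimes>\<^bsub>A\<^esub> b, a \<odot>\<^bsub>E\<^esub> f \<oplus>\<^bsub>E\<^esub> b \<odot>\<^bsub>E\<^esub> e)),
     one = (\<one>\<^bsub>A\<^esub>, \<zero>\<^bsub>E\<^esub>),
     zero = (\<zero>\<^bsub>A\<^esub>, \<zero>\<^bsub>E\<^esub>),
     add = (\<lambda>(a, e) (b, f). (a \<oplus>\<^bsub>A\<^esub> b, e \<oplus>\<^bsub>E\<^esub> f)) \<rparr>"

lemma trivial_extension_cring:
  assumes "module A E"
  shows "cring (A \<propto> E)"
proof -
  interpret module A E by fact
  have neg: "\<exists>q \<in> carrier A \<times> carrier E.
      (fst q \<oplus>\<^bsub>A\<^esub> fst p, snd q \<oplus>\<^bsub>E\<^esub> snd p) = (\<zero>\<^bsub>A\<^esub>, \<zero>\<^bsub>E\<^esub>)"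
    if "p \<in> carrier A \<times> carrier E" for p
    using that by (intro bexI[of _ "(\<ominus>\<^bsub>A\<^esub> fst p, \<ominus>\<^bsub>E\<^esub> snd p)"]) (auto simp: R.l_neg M.l_neg)
  show ?thesis
  proof (rule cringI)
    show "abelian_group (A \<propto> E)"
      by (rule abelian_groupI)
        (use neg in \<open>auto simp: trivial_extension_def R.a_ac M.a_ac split_beta\<close>)
    show "comm_monoid (A \<propto> E)"
      by (rule comm_monoidI)
        (auto simp: trivial_extension_def R.m_ac smult_r_distr smult_assoc1[symmetric] M.a_ac
          split_beta)
  qed (auto simp: trivial_extension_def R.l_distr smult_l_distr smult_r_distr M.a_ac split_beta)
qed

end

theory Submission
  imports Defs
begin

text \<open>
  An OA-ideal that is not prime contains all products of two nonunits, which forces the ring to be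
  local. Hence a nonlocal OAF-ring is a general ZPI-ring, and a local one is governed by its maximal
  ideal \<open>M\<close>: every nonmaximal prime \<open>P\<close> satisfies \<open>P = P M\<close>, so each \<open>p \<in> P\<close> satisfies \<open>(p) = M (p)\<close>
  and vanishes. This shows that a local ring is OAF if and only if \<open>M\<^sup>2\<close> is divided and either \<open>M\<close> is
  nilpotent or the ring is a domain with \<open>\<Inter>n. M\<^sup>n = 0\<close>; for \<open>R = A \<propto> E\<close> with \<open>E \<noteq> 0\<close> the square of
  the maximal ideal is \<open>M\<^sup>2 \<propto> ME\<close>, and comparing it with \<open>0 \<propto> E\<close> and with principal ideals yields (C).

  If \<open>R\<close> is a general ZPI-ring, factoring \<open>P\<^sup>2 \<propto> E\<close> and \<open>Q \<propto> (QE + Ax)\<close> shows that every prime \<open>Q\<close> of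
  \<open>A\<close> has \<open>QE = E\<close> unless it is maximal and idempotent, and that \<open>E/QE\<close> is simple in the latter case.
  Idempotent maximal ideals are generated by idempotents, which glue the generators of these
  quotients to a generator of \<open>E\<close>. Conversely, such idempotents split every ideal of \<open>R\<close> into a product
  of ideals that are directly seen to be products of primes.
\<close>

text \<open>Primes need not be finitely generated, so Nakayama is replaced by a computation with
  principal ideals: \<open>(p) = M (p)\<close> means \<open>p = m p\<close>, that is
  \<open>(1 - m) p = 0\<close> with \<open>1 - m\<close> outside \<open>M\<close>. Localization and
  residue fields are likewise replaced by elements outside a maximal ideal, which a relation
  \<open>1 = s r + m\<close> inverts modulo \<open>M\<close>. The product of ideals in (A) comes
  from factoring the zero ideal of A \<propto> E. Multiplying 0 \<propto> E by Q \<propto> E loses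
  nothing when QE = E, so the other factors, which are idempotent maximal ideals, must already kill
  E. Conversely, the idempotents generating these ideals are split off one by one until an ideal
  containing 0 \<propto> E remains; it is determined by its projection to A, and each prime factor P
  of that projection satisfies PE = E, so that the factorization lifts. In the local case a nonzero
  E excludes the domain alternative, because (0, x) squares to zero. Nilpotence of the maximal ideal
  then excludes ME = E, which is what forces the square of M to vanish.\<close>

abbreviation nonunits :: "('a, 'm) ring_scheme \<Rightarrow> 'a set" where
  "nonunits R \<equiv> carrier R - Units R"


no_notation Sum_Type.Plus (infixr \<open><+>\<close> 65)

section \<open>Ideals and their products\<close>

context cring
begin

lemma ideal_zero: "ideal I R \<Longrightarrow> \<zero> \<in> I"
  by (simp add: additive_subgroup.zero_closed ideal.axioms(1))

lemma ideal_add: "\<lbrakk>ideal I R; a \<in> I; b \<in> I\<rbrakk> \<Longrightarrow> a \<oplus> b \<in> I"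
  by (simp add: additive_subgroup.a_closed ideal.axioms(1))

lemma ideal_neg: "\<lbrakk>ideal I R; a \<in> I\<rbrakk> \<Longrightarrow> \<ominus> a \<in> I"
  by (simp add: additive_subgroup.a_inv_closed ideal.axioms(1))

lemma ideal_diff: "\<lbrakk>ideal I R; a \<in> I; b \<in> I\<rbrakk> \<Longrightarrow> a \<ominus> b \<in> I"
  by (simp add: a_minus_def ideal_add ideal_neg)

lemmas ideal_closed = ideal_zero ideal_add ideal_neg ideal_diff ideal.I_l_closed ideal.I_r_closed

lemma ideal_subset: "ideal I R \<Longrightarrow> I \<subseteq> carrier R"
  using ideal.Icarr by fast

text \<open>Negatives come from multiplication by \<open>\<ominus> \<one>\<close>, and absorption on
  the right from commutativity.\<close>

lemma idealI':
  assumes "I \<subseteq> carrier R" "\<zero> \<in> I"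
    and add: "\<And>a b. \<lbrakk>a \<in> I; b \<in> I\<rbrakk> \<Longrightarrow> a \<oplus> b \<in> I"
    and mult: "\<And>a x. \<lbrakk>a \<in> I; x \<in> carrier R\<rbrakk> \<Longrightarrow> x \<otimes> a \<in> I"
  shows "ideal I R"
proof (rule idealI)
  show "ring R" by (rule ring_axioms)
  have "\<ominus> a \<in> I" if "a \<in> I" for a
  proof -
    have "\<ominus> a = (\<ominus> \<one>) \<otimes> a" using that assms(1) by (simp add: subset_iff l_minus)
    then show ?thesis using mult[OF that, of "\<ominus> \<one>"] by simp
  qed
  then show "subgroup I (add_monoid R)"
    using assms by (intro add.subgroupI) (auto simp: a_inv_def[symmetric])
  show "a \<otimes> x \<in> I" if "a \<in> I" "x \<in> carrier R" for a x
    using mult[OF that] that assms(1) by (simp add: subset_iff m_comm)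
qed (use mult in auto)

lemma ideal_eq_carrier_iff: "ideal I R \<Longrightarrow> I = carrier R \<longleftrightarrow> \<one> \<in> I"
  using ideal.one_imp_carrier by auto

lemma unit_in_ideal: "\<lbrakk>ideal I R; u \<in> I; u \<in> Units R\<rbrakk> \<Longrightarrow> I = carrier R"
  by (metis Units_inv_closed Units_l_inv ideal.I_l_closed ideal.one_imp_carrier)

lemma proper_ideal_nonunits: "proper_ideal I R \<Longrightarrow> I \<subseteq> nonunits R"
  using unit_in_ideal ideal_subset unfolding proper_ideal_def by blast

lemma proper_ideal_one: "proper_ideal I R \<longleftrightarrow> ideal I R \<and> \<one> \<notin> I"
  using ideal_eq_carrier_iff unfolding proper_ideal_def by blast

lemma Units_factor:
  assumes "a \<in> carrier R" "b \<in> carrier R" "a \<otimes> b \<in> Units R"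
  shows "a \<in> Units R"
proof -
  have "a \<otimes> (b \<otimes> inv (a \<otimes> b)) = \<one>" using assms by (simp add: m_assoc[symmetric])
  moreover have "b \<otimes> inv (a \<otimes> b) \<in> carrier R" using assms by simp
  ultimately show ?thesis
    using assms(1) m_comm[of a "b \<otimes> inv (a \<otimes> b)"] unfolding Units_def by auto
qed

lemma mem_cgenideal: "x \<in> PIdl a \<longleftrightarrow> (\<exists>r \<in> carrier R. x = r \<otimes> a)"
  unfolding cgenideal_def by auto

lemma proper_cgenideal: "a \<in> nonunits R \<Longrightarrow> proper_ideal (PIdl a) R"
  unfolding proper_ideal_one
  using cgenideal_ideal by (auto simp: mem_cgenideal) (metis Units_one_closed m_comm Units_factor)

lemma mem_set_add: "x \<in> I <+> J \<longleftrightarrow> (\<exists>i \<in> I. \<exists>j \<in> J. x = i \<oplus> j)"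
  unfolding set_add_def' by auto

lemma set_add_ideal_upper:
  assumes "ideal I R" "ideal J R"
  shows "I \<subseteq> I <+> J" "J \<subseteq> I <+> J"
  using assms ideal_zero ideal.Icarr unfolding subset_iff mem_set_add
  by (metis r_zero, metis l_zero)

lemma primeideal_proper: "primeideal P R \<Longrightarrow> proper_ideal P R"
  unfolding proper_ideal_def using primeideal.I_notcarr primeideal.axioms(1) by blast

lemma maximalideal_proper: "maximalideal P R \<Longrightarrow> proper_ideal P R"
  unfolding proper_ideal_def using maximalideal.I_notcarr maximalideal.axioms(1) by blast

text \<open>Elementwise form of the invertibility of \<open>r\<close> in the residue field of
  \<open>M\<close>; it stands in for quotients and localizations in the later arguments at a maximal
  ideal.\<close>

lemma maximalideal_witness:
  assumes "maximalideal M R" "r \<in> carrier R" "r \<notin> M"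
  obtains s m where "s \<in> carrier R" "m \<in> M" "\<one> = s \<otimes> r \<oplus> m"
proof -
  have M: "ideal M R" using assms(1) maximalideal.axioms(1) by blast
  have r: "ideal (PIdl r) R" using assms by (simp add: cgenideal_ideal)
  have "M \<subseteq> PIdl r <+> M" "r \<in> PIdl r <+> M"
    using set_add_ideal_upper[OF r M] cgenideal_self assms(2) by auto
  then have "PIdl r <+> M = carrier R"
    using maximalideal.I_maximal[OF assms(1), of "PIdl r <+> M"] add_ideals[OF r M] assms(3)
      ideal_subset by blast
  then have "\<one> \<in> PIdl r <+> M" by simp
  then show thesis using that by (auto simp: mem_set_add mem_cgenideal)
qed

lemma maximalidealI_witness:
  assumes "proper_ideal M R"
    and "\<And>r. \<lbrakk>r \<in> carrier R; r \<notin> M\<rbrakk> \<Longrightarrow> \<exists>s \<in> carrier R. \<exists>m \<in> M. \<one> = s \<otimes> r \<oplus> m"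
  shows "maximalideal M R"
proof (rule maximalidealI)
  show "ideal M R" "carrier R \<noteq> M" using assms(1) by (auto simp: proper_ideal_def)
  fix J assume J: "ideal J R" "M \<subseteq> J" "J \<subseteq> carrier R"
  show "J = M \<or> J = carrier R"
  proof (cases "J \<subseteq> M")
    case False
    then obtain r where r: "r \<in> J" "r \<notin> M" by blast
    then obtain s m where "s \<in> carrier R" "m \<in> M" "\<one> = s \<otimes> r \<oplus> m"
      using assms(2) J(3) by blast
    then have "\<one> \<in> J" using J r by (auto intro: ideal_closed)
    then show ?thesis using ideal.one_imp_carrier[OF J(1)] by blast
  qed (use J in auto)
qed

text \<open>Zorn's lemma applies because the union of a nonempty chain of proper ideals still omits
  \<open>\<one>\<close>.\<close>

lemma exists_maximalideal:
  assumes "proper_ideal I R"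
  obtains M where "maximalideal M R" "I \<subseteq> M"
proof -
  let ?S = "{J. proper_ideal J R \<and> I \<subseteq> J}"
  have "\<exists>M \<in> ?S. \<forall>J \<in> ?S. M \<subseteq> J \<longrightarrow> J = M"
  proof (rule subset_Zorn_nonempty)
    show "?S \<noteq> {}" using assms by blast
    fix C assume C: "C \<noteq> {}" "subset.chain ?S C"
    then have id: "ideal J R" "\<one> \<notin> J" "I \<subseteq> J" if "J \<in> C" for J
      using that unfolding subset_chain_def by (auto simp: proper_ideal_one)
    have "ideal (\<Union> C) R"
    proof (rule idealI')
      fix a b assume "a \<in> \<Union> C" "b \<in> \<Union> C"
      then obtain J K where "J \<in> C" "a \<in> J" "K \<in> C" "b \<in> K" by blast
      moreover have "J \<subseteq> K \<or> K \<subseteq> J" using C(2) \<open>J \<in> C\<close> \<open>K \<in> C\<close> by (auto simp: subset_chain_def)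
      ultimately show "a \<oplus> b \<in> \<Union> C" using id(1) ideal_add by blast
    next
      show "\<Union> C \<subseteq> carrier R" using id(1) ideal_subset by blast
      show "\<zero> \<in> \<Union> C" using C(1) id(1) ideal_zero by blast
      show "x \<otimes> a \<in> \<Union> C" if "a \<in> \<Union> C" "x \<in> carrier R" for a x
        using that id(1) ideal.I_l_closed by fast
    qed
    moreover have "I \<subseteq> \<Union> C" using id(3) C(1) by blast
    ultimately show "\<Union> C \<in> ?S" using id(2) by (auto simp: proper_ideal_one)
  qed
  then obtain M where M0: "M \<in> ?S" and max0: "\<forall>J \<in> ?S. M \<subseteq> J \<longrightarrow> J = M" ..
  have M: "proper_ideal M R" "I \<subseteq> M" using M0 by simp_all
  have max: "J = M" if "proper_ideal J R" "I \<subseteq> J" "M \<subseteq> J" for J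
    using max0 that by simp
  have "maximalideal M R"
  proof (rule maximalidealI)
    show "ideal M R" "carrier R \<noteq> M" using M by (auto simp: proper_ideal_def)
    show "J = M \<or> J = carrier R" if "ideal J R" "M \<subseteq> J" for J
      using max[of J] M(2) that by (auto simp: proper_ideal_def)
  qed
  then show thesis using that M by blast
qed

lemma ideal_prod_subsetI:
  assumes "ideal K R" "\<And>i j. \<lbrakk>i \<in> I; j \<in> J\<rbrakk> \<Longrightarrow> i \<otimes> j \<in> K"
  shows "I \<cdot> J \<subseteq> K"
proof
  show "x \<in> K" if "x \<in> I \<cdot> J" for x
    using that by induct (use assms ideal_add in auto)
qed

lemma ideal_prod_mono: "\<lbrakk>I \<subseteq> I'; J \<subseteq> J'\<rbrakk> \<Longrightarrow> I \<cdot> J \<subseteq> I' \<cdot> J'"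
proof
  show "x \<in> I' \<cdot> J'" if "I \<subseteq> I'" "J \<subseteq> J'" "x \<in> I \<cdot> J" for x
    using that(3) by induct (use that in \<open>auto intro: ideal_prod.intros\<close>)
qed

text \<open>Finite sums of products collapse to one product, since the coefficients of
  \<open>z\<close> can be added up. This extracts an equation \<open>p = m \<otimes> p\<close> from
  an equality of ideals such as \<open>(p) = M (p)\<close>.\<close>

lemma ideal_prod_cgenideal:
  assumes "ideal I R" "z \<in> carrier R" "x \<in> I \<cdot> (PIdl z)"
  shows "\<exists>i \<in> I. x = i \<otimes> z"
  using assms(3)
proof induct
  case (prod i j)
  then obtain r where r: "r \<in> carrier R" "j = r \<otimes> z" by (auto simp: mem_cgenideal)
  have "i \<otimes> j = i \<otimes> r \<otimes> z" "i \<otimes> r \<in> I"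
    using r prod assms ideal.Icarr[OF assms(1)] by (auto simp: m_assoc intro: ideal_closed)
  then show ?case by blast
next
  case (sum s1 s2)
  then obtain i1 i2 where "i1 \<in> I" "i2 \<in> I" "s1 = i1 \<otimes> z" "s2 = i2 \<otimes> z" by blast
  moreover from this have "s1 \<oplus> s2 = (i1 \<oplus> i2) \<otimes> z"
    using assms ideal.Icarr[OF assms(1)] by (simp add: l_distr)
  ultimately show ?case using ideal_add[OF assms(1)] by blast
qed

section \<open>Products of finite lists of ideals\<close>

lemma ideal_list_prod_Nil [simp]: "ideal_list_prod R [] = carrier R"
  and ideal_list_prod_Cons [simp]: "ideal_list_prod R (I # Is) = I \<cdot> ideal_list_prod R Is"
  by (simp_all add: ideal_list_prod_def)

lemma ideal_list_prod_ideal: "(\<And>I. I \<in> set Is \<Longrightarrow> ideal I R) \<Longrightarrow> ideal (ideal_list_prod R Is) R"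
  by (induct Is) (auto intro: oneideal ideal_prod_is_ideal)

lemma ideal_list_prod_append:
  assumes "\<And>I. I \<in> set (Is @ Js) \<Longrightarrow> ideal I R"
  shows "ideal_list_prod R (Is @ Js) = ideal_list_prod R Is \<cdot> ideal_list_prod R Js"
  using assms
proof (induct Is)
  case Nil
  then have "ideal (ideal_list_prod R Js) R" using ideal_list_prod_ideal[of Js] by auto
  then show ?case
    using ideal_prod_one[of "ideal_list_prod R Js"] ideal_prod_commute[OF oneideal] by simp
next
  case (Cons I Is)
  then show ?case
    by (simp add: ideal_prod_assoc ideal_list_prod_ideal)
qed

lemma ideal_list_prod_split:
  assumes id: "\<And>I. I \<in> set Is \<Longrightarrow> ideal I R" and J: "J \<in> set Is"
  obtains Js where "set Js \<subseteq> set Is" "set Is = insert J (set Js)"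
    "ideal_list_prod R Is = J \<cdot> ideal_list_prod R Js"
proof -
  obtain xs ys where split: "Is = xs @ J # ys" using J by (meson split_list)
  have i: "ideal J R" "ideal (ideal_list_prod R xs) R" "ideal (ideal_list_prod R ys) R"
    using id split by (auto intro!: ideal_list_prod_ideal)
  have "ideal_list_prod R Is = J \<cdot> ideal_list_prod R (xs @ ys)"
    using ideal_list_prod_append[of xs "J # ys"] ideal_list_prod_append[of xs ys] id split i
    by simp (metis ideal_prod_assoc ideal_prod_commute)
  then show thesis using that[of "xs @ ys"] split by auto
qed

lemma ideal_list_prod_subset:
  assumes "\<And>I. I \<in> set Is \<Longrightarrow> ideal I R" "J \<in> set Is"
  shows "ideal_list_prod R Is \<subseteq> J"
proof -
  obtain Js where "set Js \<subseteq> set Is" "ideal_list_prod R Is = J \<cdot> ideal_list_prod R Js"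
    using ideal_list_prod_split[OF assms] by metis
  then show ?thesis
    using ideal_prod_inter[of J "ideal_list_prod R Js"] assms ideal_list_prod_ideal[of Js] by auto
qed

lemma primeideal_ideal_list_prod:
  assumes "primeideal P R" "\<And>I. I \<in> set Is \<Longrightarrow> ideal I R" "ideal_list_prod R Is \<subseteq> P"
  shows "\<exists>I \<in> set Is. I \<subseteq> P"
  using assms(2,3)
proof (induct Is)
  case Nil
  then show ?case using primeideal_proper[OF assms(1)] ideal_subset by (auto simp: proper_ideal_def)
next
  case (Cons I Is)
  then show ?case
    using primeideal_divides_ideal_prod[OF assms(1), of I "ideal_list_prod R Is"]
      ideal_list_prod_ideal[of Is] by auto
qed

lemma primeideal_is_ideal: "primeideal P R \<Longrightarrow> ideal P R"
  by (simp add: primeideal.axioms(1))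

lemma maximalideal_is_ideal: "maximalideal P R \<Longrightarrow> ideal P R"
  by (simp add: maximalideal.axioms(1))

lemma maximalideal_eqI:
  "\<lbrakk>maximalideal M R; proper_ideal J R; M \<subseteq> J\<rbrakk> \<Longrightarrow> J = M"
  using maximalideal.I_maximal[of M R J] ideal_subset unfolding proper_ideal_def by blast

lemma primeideal_mult: "\<lbrakk>primeideal P R; a \<in> carrier R; b \<in> carrier R; a \<otimes> b \<in> P\<rbrakk> \<Longrightarrow> a \<in> P \<or> b \<in> P"
  by (rule primeideal.I_prime)

end

section \<open>Rings with OA-factorization\<close>

context cring
begin

lemma primeideal_OA_ideal: "primeideal P R \<Longrightarrow> OA_ideal P R"
  unfolding OA_ideal_def using primeideal_proper primeideal_mult by auto

lemma OA_ideal_ideal: "OA_ideal I R \<Longrightarrow> ideal I R"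
  by (simp add: OA_ideal_def proper_ideal_def)

lemma OA_idealD:
  "\<lbrakk>OA_ideal I R; a \<in> nonunits R; b \<in> nonunits R; c \<in> nonunits R; a \<otimes> b \<otimes> c \<in> I\<rbrakk>
    \<Longrightarrow> a \<otimes> b \<in> I \<or> c \<in> I"
  unfolding OA_ideal_def by blast

text \<open>Choose \<open>a \<otimes> b \<in> I\<close> with neither factor in \<open>I\<close>;
  both are nonunits. From \<open>v a b \<in> I\<close> and \<open>b \<notin> I\<close> follows
  \<open>v a \<in> I\<close>, and from \<open>u v a \<in> I\<close> and \<open>a \<notin> I\<close>
  follows \<open>u v \<in> I\<close>.\<close>

lemma nonprime_OA_ideal:
  assumes OA: "OA_ideal I R" and np: "\<not> primeideal I R"
    and u: "u \<in> nonunits R" and v: "v \<in> nonunits R"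
  shows "u \<otimes> v \<in> I"
proof -
  have I: "proper_ideal I R" "ideal I R" using OA by (auto simp: OA_ideal_def proper_ideal_def)
  note OAD = OA_idealD[OF OA]
  obtain a b where ab: "a \<in> carrier R" "b \<in> carrier R" "a \<otimes> b \<in> I" "a \<notin> I" "b \<notin> I"
    using np I primeidealI[of I R] is_cring by (metis proper_ideal_def)
  have "a \<notin> Units R"
  proof
    assume "a \<in> Units R"
    then have "b = inv a \<otimes> (a \<otimes> b)" using ab by (simp add: m_assoc[symmetric])
    then show False using ab I \<open>a \<in> Units R\<close> by (metis Units_inv_closed ideal.I_l_closed)
  qed
  moreover have "b \<notin> Units R"
  proof
    assume "b \<in> Units R"
    then have "a = (a \<otimes> b) \<otimes> inv b" using ab by (simp add: m_assoc)
    then show False using ab I \<open>b \<in> Units R\<close> by (metis Units_inv_closed ideal.I_r_closed)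
  qed
  ultimately have n: "a \<in> nonunits R" "b \<in> nonunits R" using ab by auto
  have va: "v \<otimes> a \<in> I"
    using OAD[OF v n] v ab I by (simp add: m_assoc ideal.I_l_closed)
  then have "u \<otimes> v \<otimes> a \<in> I"
    using u v ab I by (simp add: m_assoc ideal.I_l_closed)
  then show ?thesis using OAD[OF u v n(1)] ab by blast
qed

text \<open>The square of a sum of two nonunits is a sum of products of nonunits and thus lies in
  the proper ideal \<open>I\<close>. Hence the sum is no unit.\<close>

lemma nonprime_OA_ideal_nonunits:
  assumes OA: "OA_ideal I R" and np: "\<not> primeideal I R"
  shows "ideal (nonunits R) R"
proof (rule idealI')
  note prod = nonprime_OA_ideal[OF OA np]
  have I: "ideal I R" "\<one> \<notin> I" "I \<noteq> carrier R"
    using OA by (auto simp: OA_ideal_def proper_ideal_one)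
  show "\<zero> \<in> nonunits R" using I unit_in_ideal ideal_zero by blast
  fix a b assume ab: "a \<in> nonunits R" "b \<in> nonunits R"
  have "a \<oplus> b \<notin> Units R"
  proof
    assume u: "a \<oplus> b \<in> Units R"
    then have "(a \<oplus> b) \<otimes> (a \<oplus> b) \<in> Units R" by simp
    moreover have "(a \<oplus> b) \<otimes> (a \<oplus> b) = (a \<otimes> a \<oplus> a \<otimes> b) \<oplus> (b \<otimes> a \<oplus> b \<otimes> b)"
      using ab by (simp add: l_distr r_distr a_ac)
    moreover have "\<dots> \<in> I" by (intro ideal_add[OF I(1)] prod ab)
    ultimately show False using unit_in_ideal I by metis
  qed
  then show "a \<oplus> b \<in> nonunits R" using ab by simp
next
  fix a x assume "a \<in> nonunits R" "x \<in> carrier R"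
  then show "x \<otimes> a \<in> nonunits R"
    using Units_factor[of a x] by (auto simp: m_comm)
qed auto

lemma OAF_ringE:
  assumes "OAF_ring R" "proper_ideal I R"
  obtains Js where "Js \<noteq> []" "\<And>J. J \<in> set Js \<Longrightarrow> OA_ideal J R"
    "\<And>J. J \<in> set Js \<Longrightarrow> ideal J R" "I = ideal_list_prod R Js"
  using assms OA_ideal_ideal unfolding OAF_ring_def by metis

lemma general_ZPI_ringE:
  assumes "general_ZPI_ring R" "proper_ideal I R"
  obtains Ps where "Ps \<noteq> []" "\<And>P. P \<in> set Ps \<Longrightarrow> primeideal P R"
    "\<And>P. P \<in> set Ps \<Longrightarrow> ideal P R" "I = ideal_list_prod R Ps"
  using assms primeideal_is_ideal unfolding general_ZPI_ring_def by metis

lemma general_ZPI_imp_OAF: "general_ZPI_ring R \<Longrightarrow> OAF_ring R"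
  unfolding general_ZPI_ring_def OAF_ring_def using primeideal_OA_ideal by meson

lemma OAF_nonlocal_imp_general_ZPI:
  "\<lbrakk>OAF_ring R; \<not> ideal (nonunits R) R\<rbrakk> \<Longrightarrow> general_ZPI_ring R"
  unfolding general_ZPI_ring_def OAF_ring_def using nonprime_OA_ideal_nonunits by meson

text \<open>For \<open>x \<in> M - P\<close> write \<open>P + (x\<^sup>3) = J K\<close> with an OA-ideal \<open>J \<subseteq> M\<close>. Then also \<open>K \<subseteq> M\<close>, and
  locally at \<open>M\<close> the ideals \<open>J\<close> and \<open>K\<close> are \<open>P + (j)\<close> and \<open>P + (k)\<close> with \<open>j k \<notin> P\<close>; comparing
  \<open>P \<subseteq> J K\<close> modulo \<open>P M\<close> gives the claim. The cube is needed because OA-ideals only control triple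
  products.\<close>

lemma OAF_prime_subset_prod:
  assumes OAF: "OAF_ring R" and M: "maximalideal M R" and P: "primeideal P R" and PM: "P \<subset> M"
  shows "P \<subseteq> P \<cdot> M"
proof -
  note iM = maximalideal_is_ideal[OF M] and iP = primeideal_is_ideal[OF P]
  note Mc = ideal.Icarr[OF iM] and Pc = ideal.Icarr[OF iP]
  have pM: "primeideal M R" using maximalideal_prime[OF M] .
  have M1: "\<one> \<notin> M" using maximalideal_proper[OF M] by (simp add: proper_ideal_one)
  have Mn: "M \<subseteq> nonunits R" using proper_ideal_nonunits[OF maximalideal_proper[OF M]] .
  obtain x where x: "x \<in> M" "x \<notin> P" using PM by blast
  note xc [simp] = Mc[OF x(1)]
  note cs = xc
  define x3 where "x3 = x \<otimes> x \<otimes> x"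
  have x3: "x3 \<in> carrier R" "x3 \<in> M" "x3 \<notin> P"
    using x primeideal_mult[OF P, of "x \<otimes> x" x] primeideal_mult[OF P, of x x] iM
    by (auto simp: x3_def intro: ideal_closed)
  note cs = cs x3(1)
  define I where "I = P <+> PIdl x3"
  have i3: "ideal (PIdl x3) R" using x3 by (simp add: cgenideal_ideal)
  have iI: "ideal I R" unfolding I_def using iP i3 by (rule add_ideals)
  have memI: "y \<in> I \<longleftrightarrow> (\<exists>p \<in> P. \<exists>r \<in> carrier R. y = p \<oplus> r \<otimes> x3)" for y
    unfolding I_def mem_set_add Bex_def mem_cgenideal by blast
  have PI: "P \<subseteq> I" "x3 \<in> I" 
    unfolding I_def using set_add_ideal_upper[OF iP i3] cgenideal_self[OF x3(1)] by auto
  have IM: "I \<subseteq> M"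
    using PM x3 iM by (auto simp: memI subset_iff psubset_eq intro!: ideal_add ideal.I_l_closed)
  then have "proper_ideal I R" using iI M1 by (auto simp: proper_ideal_one)
  then obtain Js where Js: "\<And>J. J \<in> set Js \<Longrightarrow> OA_ideal J R" "\<And>J. J \<in> set Js \<Longrightarrow> ideal J R"
    "I = ideal_list_prod R Js" using OAF_ringE[OF OAF] by metis
  obtain J where J: "J \<in> set Js" "J \<subseteq> M"
    using primeideal_ideal_list_prod[OF pM Js(2)] IM Js(3) by metis
  obtain Ks where Ks: "set Ks \<subseteq> set Js" "ideal_list_prod R Js = J \<cdot> ideal_list_prod R Ks"
    using ideal_list_prod_split[OF Js(2) J(1)] by metis
  define K where "K = ideal_list_prod R Ks"
  have iJ: "ideal J R" and iK: "ideal K R"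
    using Js Ks J by (auto simp: K_def intro!: ideal_list_prod_ideal)
  have IJK: "I = J \<cdot> K" using Js Ks K_def by simp
  then have IJ: "I \<subseteq> J" using ideal_prod_inter[OF iJ iK] by auto
  have "x3 \<in> J" using PI IJ by blast
  moreover have "x \<in> nonunits R" using x(1) Mn by blast
  \<comment> \<open>The OA-property leaves \<open>x \<otimes> x \<in> J\<close> or
    \<open>x \<in> J\<close>, and the second implies the first.\<close>
  ultimately have xJ: "x \<otimes> x \<in> J"
    using OA_idealD[OF Js(1)[OF J(1)], of x x x] ideal.I_l_closed[OF iJ, of x x] xc
    unfolding x3_def by blast
  \<comment> \<open>This excludes in particular that \<open>K\<close> is the whole ring. For
    \<open>k \<in> K\<close> the element \<open>x x k\<close> lies in \<open>J K = I\<close>, and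
    cancelling \<open>x x\<close> modulo the prime \<open>P\<close> puts \<open>k\<close> into
    \<open>P + (x)\<close>, which is contained in \<open>M\<close>.\<close>
  have KM: "K \<subseteq> M"
  proof
    fix k assume k: "k \<in> K"
    then have kc [simp]: "k \<in> carrier R" using iK ideal.Icarr by metis
    note cs = cs kc
    have "x \<otimes> x \<otimes> k \<in> I" using IJK xJ k by (auto intro: ideal_prod.prod)
    then obtain p r where pr: "p \<in> P" "r \<in> carrier R" "x \<otimes> x \<otimes> k = p \<oplus> r \<otimes> x3"
      by (auto simp: memI)
    note cs = cs pr(2) Pc[OF pr(1)]
    note [simp] = cs
    have "x \<otimes> x \<otimes> (k \<ominus> r \<otimes> x) = x \<otimes> x \<otimes> k \<ominus> r \<otimes> x3"
      unfolding x3_def using cs by algebra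
    also have "\<dots> = p" unfolding pr(3) using cs by algebra
    finally have "k \<ominus> r \<otimes> x \<in> P"
      using x pr primeideal_mult[OF P, of "x \<otimes> x" "k \<ominus> r \<otimes> x"] primeideal_mult[OF P, of x x] by auto
    then have "(k \<ominus> r \<otimes> x) \<oplus> r \<otimes> x \<in> M"
      using PM ideal_add[OF iM _ ideal.I_l_closed[OF iM x(1) pr(2)]] by blast
    moreover have "(k \<ominus> r \<otimes> x) \<oplus> r \<otimes> x = k" using cs by algebra
    ultimately show "k \<in> M" by simp
  qed
  \<comment> \<open>Some product generates \<open>I\<close> modulo \<open>P\<close> up to a factor
    \<open>r\<close> outside \<open>M\<close>. Otherwise \<open>I\<close> lies in
    \<open>P + M (x3)\<close>, so \<open>(1 - m) x3 \<in> P\<close> for some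
    \<open>m \<in> M\<close>, and then \<open>1 - m \<in> P\<close> although \<open>P\<close> is
    contained in \<open>M\<close>.\<close>
  have "\<exists>j \<in> J. \<exists>k \<in> K. \<exists>p \<in> P. \<exists>r \<in> carrier R - M. j \<otimes> k = p \<oplus> r \<otimes> x3"
  proof (rule ccontr)
    assume no: "\<not> ?thesis"
    have iT: "ideal (P <+> M \<cdot> (PIdl x3)) R" using iP i3 iM by (intro add_ideals ideal_prod_is_ideal)
    have "I \<subseteq> P <+> M \<cdot> (PIdl x3)"
      unfolding IJK
    proof (rule ideal_prod_subsetI[OF iT])
      fix j k assume jk: "j \<in> J" "k \<in> K"
      then have "j \<otimes> k \<in> I" using IJK by (auto intro: ideal_prod.prod)
      then obtain p r where pr: "p \<in> P" "r \<in> carrier R" "j \<otimes> k = p \<oplus> r \<otimes> x3"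
        by (auto simp: memI)
      then have "r \<in> M" using no jk by blast
      then have "r \<otimes> x3 \<in> M \<cdot> (PIdl x3)" using cgenideal_self[OF x3(1)] by (auto intro: ideal_prod.prod)
      then show "j \<otimes> k \<in> P <+> M \<cdot> (PIdl x3)" using pr by (auto simp: mem_set_add)
    qed
    then obtain p t where pt: "p \<in> P" "t \<in> M \<cdot> (PIdl x3)" "x3 = p \<oplus> t"
      using PI(2) unfolding subset_iff mem_set_add by blast
    then obtain m where m: "m \<in> M" "t = m \<otimes> x3" using ideal_prod_cgenideal[OF iM x3(1)] by blast
    note cs = cs Mc[OF m(1)] Pc[OF pt(1)] x3(1)
    note [simp] = cs
    have "(\<one> \<ominus> m) \<otimes> x3 = x3 \<ominus> m \<otimes> x3" using cs by algebra
    also have "\<dots> = p \<oplus> m \<otimes> x3 \<ominus> m \<otimes> x3" using pt(3) m(2) by simp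
    also have "\<dots> = p" using cs by algebra
    finally have "\<one> \<ominus> m \<in> P" using primeideal_mult[OF P, of "\<one> \<ominus> m" x3] x3 pt by auto
    then have "(\<one> \<ominus> m) \<oplus> m \<in> M" using PM ideal_add[OF iM _ m(1)] by blast
    moreover have "(\<one> \<ominus> m) \<oplus> m = \<one>" using cs by algebra
    ultimately show False using M1 by simp
  qed
  then obtain j k p r where jk: "j \<in> J" "k \<in> K" "p \<in> P" "r \<in> carrier R" "r \<notin> M"
    and jkp: "j \<otimes> k = p \<oplus> r \<otimes> x3" by blast
  have jM: "j \<in> M" and kM: "k \<in> M" using jk J KM by auto
  note cs = cs Mc[OF jM] Mc[OF kM] Pc[OF jk(3)] jk(4) x3(1)
  note [simp] = cs
  have jknP: "j \<otimes> k \<notin> P"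
  proof
    assume "j \<otimes> k \<in> P"
    then have "j \<otimes> k \<ominus> p \<in> P" using jk iP by (auto intro: ideal_closed)
    moreover have "j \<otimes> k \<ominus> p = r \<otimes> x3" unfolding jkp using cs by algebra
    ultimately show False using primeideal_mult[OF P, of r x3] jk PM x3 by auto
  qed
  then have jP: "j \<notin> P" and kP: "k \<notin> P" using iP by (auto intro: ideal_closed)
  \<comment> \<open>Up to the factor \<open>r\<close>, which acts as a unit at \<open>M\<close>,
    this gives \<open>J = P + (j)\<close> and \<open>K = P + (k)\<close>: it is used with
    \<open>u = j\<close>, \<open>v = k\<close> for elements of \<open>J\<close> and with the roles
    exchanged for \<open>K\<close>. The difference \<open>r y - t u\<close> lies in \<open>P\<close>
    because its multiple by \<open>v \<notin> P\<close> does.\<close>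
  have key: "\<exists>q \<in> P. \<exists>t \<in> carrier R. r \<otimes> y = q \<oplus> t \<otimes> u"
    if h: "y \<in> carrier R" "v \<otimes> y \<in> I" "u \<in> carrier R" "v \<in> carrier R" "v \<notin> P"
      "u \<otimes> v = p \<oplus> r \<otimes> x3" for y u v
  proof -
    note cs = cs h(1,3,4)
    note [simp] = cs
    obtain p' t where t: "p' \<in> P" "t \<in> carrier R" "v \<otimes> y = p' \<oplus> t \<otimes> x3" 
      using h(2) unfolding memI by blast
    note cs = cs t(2) Pc[OF t(1)]
    note [simp] = cs
    have "v \<otimes> (r \<otimes> y \<ominus> t \<otimes> u) = r \<otimes> (v \<otimes> y) \<ominus> t \<otimes> (u \<otimes> v)" using cs by algebra
    also have "\<dots> = r \<otimes> p' \<ominus> t \<otimes> p" unfolding t(3) h(6) using cs by algebra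
    also have "\<dots> \<in> P" using t jk iP by (simp add: ideal_diff ideal.I_l_closed)
    finally have "v \<otimes> (r \<otimes> y \<ominus> t \<otimes> u) \<in> P" .
    then have "r \<otimes> y \<ominus> t \<otimes> u \<in> P"
      using primeideal_mult[OF P, of v "r \<otimes> y \<ominus> t \<otimes> u"] h(5) by simp
    moreover have "r \<otimes> y = (r \<otimes> y \<ominus> t \<otimes> u) \<oplus> t \<otimes> u" using cs by algebra
    ultimately show ?thesis using t(2) by blast
  qed
  have iPM: "ideal (P \<cdot> M) R" using iP iM by (rule ideal_prod_is_ideal)
  have ijk: "ideal (PIdl (j \<otimes> k)) R" by (simp add: cgenideal_ideal)
  have iU: "ideal (P \<cdot> M <+> PIdl (j \<otimes> k)) R" using iPM ijk by (rule add_ideals)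
  \<comment> \<open>Multiplying the two descriptions leaves only \<open>j k\<close> outside
    \<open>P \<cdot> M\<close>, since \<open>j\<close>, \<open>k\<close> and \<open>P\<close> all
    lie in \<open>M\<close>.\<close>
  have rr: "r \<otimes> r \<otimes> s \<in> P \<cdot> M <+> PIdl (j \<otimes> k)" if "s \<in> J \<cdot> K" for s
    using that
  proof induct
    case (prod y z)
    have yz [simp]: "y \<in> carrier R" "z \<in> carrier R" using prod iJ iK ideal.Icarr by metis+
    note cs = cs yz
    have I: "k \<otimes> y \<in> I" "j \<otimes> z \<in> I"
      using prod jk IJK m_comm[of k y] by (auto intro: ideal_prod.prod)
    obtain q t where q: "q \<in> P" "t \<in> carrier R" "r \<otimes> y = q \<oplus> t \<otimes> j"
      using key[of y k j] I kP jkp by auto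
    obtain q' t' where q': "q' \<in> P" "t' \<in> carrier R" "r \<otimes> z = q' \<oplus> t' \<otimes> k"
      using key[of z j k] I jP jkp m_comm[of k j] by auto
    note cs = cs q(2) q'(2) Pc[OF q(1)] Pc[OF q'(1)]
    note [simp] = cs
    have "r \<otimes> r \<otimes> (y \<otimes> z) = (r \<otimes> y) \<otimes> (r \<otimes> z)" using cs by algebra
    also have "\<dots> = (q \<otimes> (q' \<oplus> t' \<otimes> k) \<oplus> q' \<otimes> (t \<otimes> j)) \<oplus> (t \<otimes> t') \<otimes> (j \<otimes> k)"
      unfolding q(3) q'(3) using cs by algebra
    finally have eq: "r \<otimes> r \<otimes> (y \<otimes> z) = (q \<otimes> (q' \<oplus> t' \<otimes> k) \<oplus> q' \<otimes> (t \<otimes> j)) \<oplus> (t \<otimes> t') \<otimes> (j \<otimes> k)" .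
    have "q' \<oplus> t' \<otimes> k \<in> M" "t \<otimes> j \<in> M" 
      using ideal_add[OF iM _ ideal.I_l_closed[OF iM kM q'(2)], of q']
        ideal.I_l_closed[OF iM jM q(2)] q'(1) PM by auto
    then have "q \<otimes> (q' \<oplus> t' \<otimes> k) \<oplus> q' \<otimes> (t \<otimes> j) \<in> P \<cdot> M"
      using q q' by (auto intro!: ideal_add[OF iPM] ideal_prod.prod)
    moreover have "(t \<otimes> t') \<otimes> (j \<otimes> k) \<in> PIdl (j \<otimes> k)" by (auto simp: mem_cgenideal)
    ultimately show ?case unfolding eq mem_set_add by blast
  next
    case (sum s1 s2)
    have "s1 \<in> carrier R" "s2 \<in> carrier R" using sum iJ iK ideal_prod_in_carrier by blast+
    then show ?case using sum ideal_add[OF iU] by (simp add: r_distr)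
  qed
  show "P \<subseteq> P \<cdot> M"
  proof
    fix a assume a: "a \<in> P"
    note cs = cs Pc[OF a]
    note [simp] = cs
    obtain m b where mb: "m \<in> P \<cdot> M" "b \<in> carrier R" "r \<otimes> r \<otimes> a = m \<oplus> b \<otimes> (j \<otimes> k)"
      using rr[of a] subsetD[OF PI(1) a] unfolding IJK mem_set_add Bex_def mem_cgenideal by blast
    have mP: "m \<in> P" using mb ideal_prod_inter[OF iP iM] by blast
    note cs = cs mb(2) Pc[OF mP]
    note [simp] = cs
    have "r \<otimes> r \<otimes> a \<ominus> m \<in> P" using a mP iP by (simp add: ideal_diff ideal.I_l_closed)
    moreover have "r \<otimes> r \<otimes> a \<ominus> m = b \<otimes> (j \<otimes> k)" unfolding mb(3) using cs by algebra
    \<comment> \<open>The coefficient of \<open>j k\<close> lies in \<open>P\<close> because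
      \<open>j k\<close> does not, and \<open>j k \<in> M\<close> then places the whole term in
      \<open>P \<cdot> M\<close>.\<close>
    ultimately have "b \<in> P" using primeideal_mult[OF P, of b "j \<otimes> k"] jknP by auto
    then have "b \<otimes> (j \<otimes> k) \<in> P \<cdot> M"
      using ideal.I_l_closed[OF iM kM Mc[OF jM]] by (rule ideal_prod.prod)
    then have rra: "r \<otimes> r \<otimes> a \<in> P \<cdot> M" using mb ideal_add[OF iPM] by simp
    \<comment> \<open>The factor \<open>r \<otimes> r\<close> is now removed by inverting it modulo
      \<open>M\<close>; the error term is \<open>a m'\<close>, which again lies in
      \<open>P \<cdot> M\<close>.\<close>
    have "r \<otimes> r \<notin> M" using primeideal_mult[OF pM, of r r] jk by auto
    then obtain s m' where s: "s \<in> carrier R" "m' \<in> M" "\<one> = s \<otimes> (r \<otimes> r) \<oplus> m'"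
      using maximalideal_witness[OF M, of "r \<otimes> r"] by auto
    note cs = cs s(1) Mc[OF s(2)]
    note [simp] = cs
    have "a = \<one> \<otimes> a" by simp
    also have "\<dots> = s \<otimes> (r \<otimes> r \<otimes> a) \<oplus> a \<otimes> m'" unfolding s(3) using cs by algebra
    also have "\<dots> \<in> P \<cdot> M"
      by (intro ideal_add[OF iPM] ideal.I_l_closed[OF iPM rra s(1)] ideal_prod.prod[OF a s(2)])
    finally show "a \<in> P \<cdot> M" .
  qed
qed

lemma one_minus_notin:
  assumes "ideal M R" "\<one> \<notin> M" "m \<in> M"
  shows "\<one> \<ominus> m \<in> carrier R" "\<one> \<ominus> m \<notin> M"
proof -
  have m: "m \<in> carrier R" using assms ideal.Icarr by metis
  then show "\<one> \<ominus> m \<in> carrier R" by simp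
  have "(\<one> \<ominus> m) \<oplus> m = \<one>" using m by algebra
  then show "\<one> \<ominus> m \<notin> M" using assms ideal_add by metis
qed

lemma one_minus_mult_eq_zero:
  assumes "a \<in> carrier R" "m \<in> carrier R" "a = m \<otimes> a"
  shows "(\<one> \<ominus> m) \<otimes> a = \<zero>"
proof -
  have "(\<one> \<ominus> m) \<otimes> a = a \<ominus> m \<otimes> a" using assms(1,2) by algebra
  then show ?thesis using assms by (metis r_neg a_minus_def)
qed

text \<open>In a factorization of \<open>(p)\<close> some factor \<open>J\<close> lies in
  \<open>P\<close>. It is prime: a nonprime OA-ideal contains the square of every element of
  \<open>M\<close>, which would give \<open>M \<subseteq> P\<close>. So \<open>J = J M\<close>, and
  multiplying by the remaining factors gives \<open>(p) = M (p)\<close>.\<close>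

lemma OAF_nonmaximal_prime_fixed:
  assumes OAF: "OAF_ring R" and M: "maximalideal M R" and P: "primeideal P R" and PM: "P \<subset> M"
    and p: "p \<in> P"
  shows "\<exists>m \<in> M. p = m \<otimes> p"
proof -
  note iM = maximalideal_is_ideal[OF M] and iP = primeideal_is_ideal[OF P]
  have pc: "p \<in> carrier R" using p ideal.Icarr[OF iP] by blast
  have "p \<in> nonunits R" using proper_ideal_nonunits[OF primeideal_proper[OF P]] p by blast
  then have "proper_ideal (PIdl p) R" by (rule proper_cgenideal)
  then obtain Js where Js: "\<And>J. J \<in> set Js \<Longrightarrow> OA_ideal J R" "\<And>J. J \<in> set Js \<Longrightarrow> ideal J R"
    "PIdl p = ideal_list_prod R Js" using OAF_ringE[OF OAF] by metis
  have "PIdl p \<subseteq> P" using p iP by (intro cgenideal_minimal)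
  then obtain J where J: "J \<in> set Js" "J \<subseteq> P"
    using primeideal_ideal_list_prod[OF P Js(2)] Js(3) by metis
  obtain Ks where Ks: "set Ks \<subseteq> set Js" "ideal_list_prod R Js = J \<cdot> ideal_list_prod R Ks"
    using ideal_list_prod_split[OF Js(2) J(1)] by metis
  define B where "B = ideal_list_prod R Ks"
  have iJ: "ideal J R" and iB: "ideal B R"
    using Js Ks J by (auto simp: B_def intro!: ideal_list_prod_ideal)
  have "primeideal J R"
  proof (rule ccontr)
    assume np: "\<not> primeideal J R"
    have "M \<subseteq> P"
    proof
      fix x assume x: "x \<in> M"
      then have "x \<in> nonunits R" using proper_ideal_nonunits[OF maximalideal_proper[OF M]] by blast
      then have "x \<otimes> x \<in> P" using nonprime_OA_ideal[OF Js(1)[OF J(1)] np] J(2) by blast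
      then show "x \<in> P" using primeideal_mult[OF P, of x x] ideal.Icarr[OF iM x] by blast
    qed
    then show False using PM by blast
  qed
  then have JM: "J \<subseteq> J \<cdot> M" using OAF_prime_subset_prod[OF OAF M] J(2) PM by blast
  have "PIdl p = J \<cdot> B" using Js Ks B_def by simp
  also have "\<dots> \<subseteq> (J \<cdot> M) \<cdot> B" using JM by (rule ideal_prod_mono) simp
  also have "\<dots> = M \<cdot> (J \<cdot> B)"
    using iJ iM iB by (metis ideal_prod_assoc ideal_prod_commute)
  also have "\<dots> = M \<cdot> (PIdl p)" using Js Ks B_def by simp
  finally show ?thesis using ideal_prod_cgenideal[OF iM pc] cgenideal_self[OF pc] by blast
qed

text \<open>From \<open>p = m p\<close> follows \<open>(1 - m) p = 0 \<in> Q\<close>, and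
  \<open>1 - m\<close> lies outside \<open>M\<close>, hence outside \<open>Q\<close>. Below a
  maximal ideal there is therefore at most one other prime.\<close>

lemma OAF_nonmaximal_prime_minimal:
  assumes OAF: "OAF_ring R" and M: "maximalideal M R" and P: "primeideal P R" and PM: "P \<subset> M"
    and Q: "primeideal Q R" "Q \<subseteq> M"
  shows "P \<subseteq> Q"
proof
  fix p assume p: "p \<in> P"
  obtain m where m: "m \<in> M" "p = m \<otimes> p" using OAF_nonmaximal_prime_fixed[OF OAF M P PM p] by blast
  note iM = maximalideal_is_ideal[OF M]
  have c: "m \<in> carrier R" "p \<in> carrier R"
    using ideal.Icarr[OF iM m(1)] ideal.Icarr[OF primeideal_is_ideal[OF P] p] by auto
  have "\<one> \<notin> M" using maximalideal_proper[OF M] by (simp add: proper_ideal_one)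
  from one_minus_notin[OF iM this m(1)] have "\<one> \<ominus> m \<notin> Q" "\<one> \<ominus> m \<in> carrier R" using Q by auto
  moreover have "(\<one> \<ominus> m) \<otimes> p \<in> Q"
    using one_minus_mult_eq_zero[OF c(2,1) m(2)] ideal_zero[OF primeideal_is_ideal[OF Q(1)]] by simp
  ultimately show "p \<in> Q" using primeideal_mult[OF Q(1)] c by blast
qed

section \<open>Idempotent maximal ideals of general ZPI-rings\<close>

text \<open>For \<open>a \<in> P - Q\<close>, a prime factor \<open>J \<subseteq> P\<close> of
  \<open>(a)\<close> contains \<open>a\<close> and so is not contained in \<open>Q\<close>. By the
  minimality of nonmaximal primes \<open>J = P\<close>. Idempotence gives
  \<open>(a) = P (a)\<close>, and \<open>(1 - m) a = 0\<close> with \<open>1 - m \<notin> Q\<close>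
  forces \<open>a \<in> Q\<close>.\<close>

lemma general_ZPI_idempotent_maximal_minimal:
  assumes ZPI: "general_ZPI_ring R" and P: "maximalideal P R" and idem: "P \<cdot> P = P"
    and Q: "primeideal Q R" "Q \<subseteq> P"
  shows "Q = P"
proof (rule ccontr)
  assume "Q \<noteq> P"
  then obtain a where a: "a \<in> P" "a \<notin> Q" using Q by blast
  note iP = maximalideal_is_ideal[OF P]
  have ac: "a \<in> carrier R" using a ideal.Icarr[OF iP] by blast
  have "a \<in> nonunits R" using proper_ideal_nonunits[OF maximalideal_proper[OF P]] a by blast
  then have "proper_ideal (PIdl a) R" by (rule proper_cgenideal)
  then obtain Js where Js: "\<And>J. J \<in> set Js \<Longrightarrow> primeideal J R" "\<And>J. J \<in> set Js \<Longrightarrow> ideal J R"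
    "PIdl a = ideal_list_prod R Js" using general_ZPI_ringE[OF ZPI] by metis
  have "PIdl a \<subseteq> P" using a iP by (intro cgenideal_minimal)
  then obtain J where J: "J \<in> set Js" "J \<subseteq> P"
    using primeideal_ideal_list_prod[OF maximalideal_prime[OF P] Js(2)] Js(3) by metis
  have aJ: "a \<in> J" using ideal_list_prod_subset[OF Js(2) J(1)] Js(3) cgenideal_self[OF ac] by blast
  have "J = P"
    using OAF_nonmaximal_prime_minimal[OF general_ZPI_imp_OAF[OF ZPI] P Js(1)[OF J(1)] _ Q] J(2) aJ a(2)
    by blast
  obtain Ks where Ks: "set Ks \<subseteq> set Js" "ideal_list_prod R Js = J \<cdot> ideal_list_prod R Ks"
    using ideal_list_prod_split[OF Js(2) J(1)] by metis
  have iB: "ideal (ideal_list_prod R Ks) R" using Js Ks by (auto intro!: ideal_list_prod_ideal)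
  have "PIdl a = P \<cdot> (PIdl a)"
    using Js(3) Ks(2) \<open>J = P\<close> ideal_prod_assoc[OF iP iP iB] idem by simp
  then obtain m where m: "m \<in> P" "a = m \<otimes> a"
    using ideal_prod_cgenideal[OF iP ac, of a] cgenideal_self[OF ac] by auto
  have "\<one> \<notin> P" using maximalideal_proper[OF P] by (simp add: proper_ideal_one)
  from one_minus_notin[OF iP this m(1)] have "\<one> \<ominus> m \<notin> Q" "\<one> \<ominus> m \<in> carrier R" using Q by auto
  moreover have "(\<one> \<ominus> m) \<otimes> a \<in> Q"
    using one_minus_mult_eq_zero[OF ac ideal.Icarr[OF iP m(1)] m(2)]
      ideal_zero[OF primeideal_is_ideal[OF Q(1)]] by simp
  ultimately show False using primeideal_mult[OF Q(1)] ac a by blast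
qed

text \<open>Factor the zero ideal into primes. A factor \<open>P\<close> is absorbed by
  \<open>P = P P\<close>, and any other factor contains some \<open>q \<notin> P\<close>, since
  \<open>P\<close> has no other primes below it. The product of these \<open>q\<close> is a
  \<open>b \<notin> P\<close> with \<open>b P = 0\<close>. Writing \<open>1 = s b + m\<close> yields
  \<open>x = x m\<close> on \<open>P\<close>, so \<open>m\<close> is the idempotent
  generator.\<close>

lemma general_ZPI_idempotent_maximal_generator:
  assumes ZPI: "general_ZPI_ring R" and P: "maximalideal P R" and idem: "P \<cdot> P = P"
  shows "\<exists>e \<in> carrier R. e \<otimes> e = e \<and> P = PIdl e"
proof -
  note iP = maximalideal_is_ideal[OF P]
  note Pc = ideal.Icarr[OF iP]
  have "\<one> \<notin> P" using maximalideal_proper[OF P] by (simp add: proper_ideal_one)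
  moreover have "\<zero> \<in> P" using iP by (rule ideal_zero)
  ultimately have "proper_ideal {\<zero>} R" by (auto simp: proper_ideal_one zeroideal)
  then obtain Ps where Ps: "\<And>J. J \<in> set Ps \<Longrightarrow> primeideal J R" "{\<zero>} = ideal_list_prod R Ps"
    using general_ZPI_ringE[OF ZPI] by metis
  have "\<exists>b \<in> carrier R - P. \<forall>x \<in> P. b \<otimes> x \<in> ideal_list_prod R Ps"
    using Ps(1)
  proof (induct Ps)
    case Nil
    show ?case using \<open>\<one> \<notin> P\<close> by (intro bexI[of _ \<one>]) (auto simp: Pc)
  next
    case (Cons Q Ps)
    then obtain b where b: "b \<in> carrier R" "b \<notin> P" "\<And>x. x \<in> P \<Longrightarrow> b \<otimes> x \<in> ideal_list_prod R Ps"
      by auto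
    have Q: "primeideal Q R" and iL: "ideal (ideal_list_prod R Ps) R"
      using Cons(2) primeideal_is_ideal by (auto intro!: ideal_list_prod_ideal)
    note iQ = primeideal_is_ideal[OF Q]
    show ?case
    proof (cases "Q = P")
      case True
      have "b \<otimes> x \<in> P \<cdot> ideal_list_prod R Ps" if "x \<in> P \<cdot> P" for x
        using that
      proof induct
        case (prod y z)
        have "b \<otimes> (y \<otimes> z) = y \<otimes> (b \<otimes> z)" using b prod Pc by (simp add: m_lcomm)
        then show ?case using b prod by (auto intro: ideal_prod.prod)
      next
        case (sum s t)
        have "s \<in> P" "t \<in> P" using sum idem by auto
        then have "b \<otimes> (s \<oplus> t) = b \<otimes> s \<oplus> b \<otimes> t" using b Pc by (simp add: r_distr)
        then show ?case using sum by (auto intro: ideal_prod.sum)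
      qed
      then show ?thesis using b True idem by auto
    next
      case False
      then obtain q where q: "q \<in> Q" "q \<notin> P"
        using general_ZPI_idempotent_maximal_minimal[OF ZPI P idem Q] by blast
      have qc: "q \<in> carrier R" using q ideal.Icarr[OF iQ] by blast
      have "q \<otimes> b \<notin> P" using primeideal_mult[OF maximalideal_prime[OF P] qc b(1)] q b by blast
      moreover have "q \<otimes> b \<otimes> x \<in> Q \<cdot> ideal_list_prod R Ps" if "x \<in> P" for x
        using q b(3)[OF that] b(1) qc Pc[OF that] by (auto simp: m_assoc intro: ideal_prod.prod)
      ultimately show ?thesis using qc b(1) by (intro bexI[of _ "q \<otimes> b"]) auto
    qed
  qed
  then obtain b where b: "b \<in> carrier R" "b \<notin> P" "\<And>x. x \<in> P \<Longrightarrow> b \<otimes> x = \<zero>"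
    using Ps(2) by auto
  obtain s m where s: "s \<in> carrier R" "m \<in> P" "\<one> = s \<otimes> b \<oplus> m"
    using maximalideal_witness[OF P b(1,2)] .
  have fix': "x = x \<otimes> m" if "x \<in> P" for x
  proof -
    note cs = Pc[OF that] Pc[OF s(2)] b(1) s(1)
    have "x = \<one> \<otimes> x" using cs by simp
    also have "\<dots> = s \<otimes> (b \<otimes> x) \<oplus> x \<otimes> m" unfolding s(3) using cs by algebra
    finally show ?thesis using b(3)[OF that] cs by simp
  qed
  have "P = PIdl m"
  proof
    show "P \<subseteq> PIdl m" using fix' Pc unfolding subset_iff mem_cgenideal by blast
    show "PIdl m \<subseteq> P" using iP s(2) by (rule cgenideal_minimal)
  qed
  then show ?thesis using fix'[OF s(2)] Pc[OF s(2)] by (metis (lifting))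
qed

text \<open>Complementary idempotents decompose the ring into two factors, and each of the two sums
  agrees with \<open>J\<close> in one factor and is everything in the other. By hand:
  \<open>j = e j + j f\<close>, and cross terms outside \<open>J\<close> vanish by
  \<open>e f = 0\<close>.\<close>

lemma ideal_split_idempotent:
  assumes J: "ideal J R" and e: "e \<in> carrier R" "f \<in> carrier R" "e \<oplus> f = \<one>" "e \<otimes> f = \<zero>"
  shows "J = (J <+> PIdl e) \<cdot> (J <+> PIdl f)"
proof
  note Jc = ideal.Icarr[OF J]
  have ie: "ideal (PIdl e) R" "ideal (PIdl f) R" using e by (auto intro: cgenideal_ideal)
  note up = set_add_ideal_upper[OF J ie(1)] set_add_ideal_upper[OF J ie(2)]
  show "(J <+> PIdl e) \<cdot> (J <+> PIdl f) \<subseteq> J"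
  proof (rule ideal_prod_subsetI[OF J])
    fix a b assume "a \<in> J <+> PIdl e" "b \<in> J <+> PIdl f"
    then obtain j r k s where jk: "j \<in> J" "r \<in> carrier R" "a = j \<oplus> r \<otimes> e"
      "k \<in> J" "s \<in> carrier R" "b = k \<oplus> s \<otimes> f"
      unfolding mem_set_add Bex_def mem_cgenideal by blast
    have "a \<otimes> b = ((k \<oplus> s \<otimes> f) \<otimes> j \<oplus> (r \<otimes> e) \<otimes> k) \<oplus> (r \<otimes> s) \<otimes> (e \<otimes> f)"
      unfolding jk(3,6) using Jc[OF jk(1)] Jc[OF jk(4)] jk(2,5) e(1,2) by algebra
    also have "\<dots> = (k \<oplus> s \<otimes> f) \<otimes> j \<oplus> (r \<otimes> e) \<otimes> k"
      using e jk(2,5) Jc[OF jk(1)] Jc[OF jk(4)] by simp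
    also have "\<dots> \<in> J"
      using e jk(2,5) Jc[OF jk(4)]
      by (intro ideal_add[OF J] ideal.I_l_closed[OF J jk(1)] ideal.I_l_closed[OF J jk(4)]) auto
    finally show "a \<otimes> b \<in> J" .
  qed
  have iP: "ideal ((J <+> PIdl e) \<cdot> (J <+> PIdl f)) R"
    using J ie by (intro ideal_prod_is_ideal add_ideals)
  show "J \<subseteq> (J <+> PIdl e) \<cdot> (J <+> PIdl f)"
  proof
    fix j assume j: "j \<in> J"
    have "j = (e \<oplus> f) \<otimes> j" using e j Jc by simp
    also have "\<dots> = e \<otimes> j \<oplus> j \<otimes> f" using e(1,2) Jc[OF j] by algebra
    also have "\<dots> \<in> (J <+> PIdl e) \<cdot> (J <+> PIdl f)"
      using up j cgenideal_self e by (intro ideal_add[OF iP] ideal_prod.prod) auto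
    finally show "j \<in> (J <+> PIdl e) \<cdot> (J <+> PIdl f)" .
  qed
qed

lemma one_minus_idempotent:
  assumes "e \<in> carrier R" "e \<otimes> e = e"
  shows "\<one> \<ominus> e \<in> carrier R" "e \<oplus> (\<one> \<ominus> e) = \<one>" "e \<otimes> (\<one> \<ominus> e) = \<zero>"
proof -
  show "\<one> \<ominus> e \<in> carrier R" using assms by simp
  show "e \<oplus> (\<one> \<ominus> e) = \<one>" using assms(1) by algebra
  have "e \<otimes> (\<one> \<ominus> e) = e \<ominus> e \<otimes> e" using assms(1) by algebra
  then show "e \<otimes> (\<one> \<ominus> e) = \<zero>" using assms by (simp add: a_minus_def r_neg)
qed

section \<open>Local rings with OA-factorization\<close>

lemma ideals_set_simps [simp]:
  "\<one>\<^bsub>ideals_set R\<^esub> = carrier R" "I \<otimes>\<^bsub>ideals_set R\<^esub> J = I \<cdot> J"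
  by (simp_all add: ideals_set_def)

lemma ideal_pow_ideal: "ideal I R \<Longrightarrow> ideal (ideal_pow R I n) R"
  by (induct n) (auto intro: oneideal ideal_prod_is_ideal)

lemma ideal_pow_1: "ideal I R \<Longrightarrow> ideal_pow R I (Suc 0) = I"
  using ideal_prod_commute[OF oneideal, of I] ideal_prod_one[of I] by simp

lemma ideal_pow_2: "ideal I R \<Longrightarrow> ideal_pow R I 2 = I \<cdot> I"
  using ideal_prod_commute[OF oneideal, of I] ideal_prod_one[of I] by (simp add: numeral_2_eq_2)

lemma ideal_pow_add:
  "ideal I R \<Longrightarrow> ideal_pow R I (m + n) = ideal_pow R I m \<cdot> ideal_pow R I n"
  by (induct n) (simp_all add: ideal_prod_one ideal_pow_ideal ideal_prod_assoc)

lemma ideal_pow_antimono: "ideal I R \<Longrightarrow> m \<le> n \<Longrightarrow> ideal_pow R I n \<subseteq> ideal_pow R I m"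
  using ideal_pow_add[of I m "n - m"] ideal_prod_inter[of "ideal_pow R I m" "ideal_pow R I (n - m)"]
    ideal_pow_ideal by simp

lemma maximalideal_nonunits:
  assumes N: "ideal (nonunits R) R"
  shows "maximalideal (nonunits R) R"
    and "maximalideal M R \<Longrightarrow> M = nonunits R"
proof -
  show m: "maximalideal (nonunits R) R"
  proof (rule maximalidealI)
    show "carrier R \<noteq> nonunits R" by auto
    show "J = nonunits R \<or> J = carrier R" if "ideal J R" "nonunits R \<subseteq> J" for J
      using that unit_in_ideal[of J] ideal_subset[of J] by blast
  qed (rule N)
  show "M = nonunits R" if "maximalideal M R"
    using maximalideal_eqI[OF that] maximalideal_proper[OF m] maximalideal_proper[OF that]
      proper_ideal_nonunits by metis
qed

lemma local_ring_nonunits: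
  assumes "local_ring R"
  shows "ideal (nonunits R) R" "jacobson_radical R = nonunits R"
proof -
  obtain M where M: "maximalideal M R" and uniq: "\<And>P. maximalideal P R \<Longrightarrow> P = M"
    using assms unfolding local_ring_def by auto
  have "nonunits R \<subseteq> M"
  proof
    fix a assume a: "a \<in> nonunits R"
    obtain P where "maximalideal P R" "PIdl a \<subseteq> P"
      using exists_maximalideal[OF proper_cgenideal[OF a]] .
    then show "a \<in> M" using uniq cgenideal_self[of a] a by auto
  qed
  then have "M = nonunits R" using proper_ideal_nonunits[OF maximalideal_proper[OF M]] by blast
  moreover have "jacobson_radical R = M"
    using uniq M ideal.Icarr[OF maximalideal_is_ideal[OF M]]
    unfolding jacobson_radical_def by blast
  ultimately show "ideal (nonunits R) R" "jacobson_radical R = nonunits R"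
    using maximalideal_is_ideal[OF M] by simp_all
qed

lemma local_ring_iff: "local_ring R \<longleftrightarrow> ideal (nonunits R) R"
  using local_ring_nonunits(1) maximalideal_nonunits unfolding local_ring_def by metis

lemma prod_nonunits_OA_ideal:
  assumes "proper_ideal I R" "nonunits R \<cdot> nonunits R \<subseteq> I"
  shows "OA_ideal I R"
  using assms ideal_prod.prod[of _ "nonunits R" _ "nonunits R" R] unfolding OA_ideal_def by blast

text \<open>An ideal with at least two factors lies in the square of the maximal ideal. With a
  single factor it is an OA-ideal: a nonprime one contains the square, and a prime one is zero or
  the maximal ideal.\<close>

lemma local_OAF_divided:
  assumes N: "ideal (nonunits R) R" and OAF: "OAF_ring R"
    and primes: "\<And>P. primeideal P R \<Longrightarrow> P \<noteq> {\<zero>} \<Longrightarrow> P = nonunits R"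
  shows "divided_ideal (nonunits R \<cdot> nonunits R) R"
  unfolding divided_ideal_def
proof (intro conjI allI impI)
  let ?N = "nonunits R"
  show NN: "ideal (?N \<cdot> ?N) R" using N by (simp add: ideal_prod_is_ideal)
  fix J assume J: "ideal J R"
  show "?N \<cdot> ?N \<subseteq> J \<or> J \<subseteq> ?N \<cdot> ?N"
  proof (cases "proper_ideal J R")
    case False
    then show ?thesis using J ideal_subset[OF NN] by (auto simp: proper_ideal_def)
  next
    case True
    then obtain Js where Js: "Js \<noteq> []" "\<And>J. J \<in> set Js \<Longrightarrow> OA_ideal J R"
      "\<And>J. J \<in> set Js \<Longrightarrow> ideal J R" "J = ideal_list_prod R Js" using OAF_ringE[OF OAF] by metis
    obtain I Is where Is: "Js = I # Is" using Js(1) by (cases Js) auto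
    have sub: "K \<subseteq> ?N" if "K \<in> set Js" for K
      using proper_ideal_nonunits Js(2)[OF that] by (simp add: OA_ideal_def)
    show ?thesis
    proof (cases Is)
      case Nil
      then have "J = I" "OA_ideal I R"
        using Js Is ideal_prod_one by auto
      show ?thesis
      proof (cases "primeideal I R")
        case True
        then show ?thesis
          using primes[OF True] \<open>J = I\<close> ideal_zero[OF NN] ideal_prod_inter[OF N N] by auto
      next
        case False
        then have "?N \<cdot> ?N \<subseteq> I"
          using nonprime_OA_ideal[OF \<open>OA_ideal I R\<close> False] OA_ideal_ideal[OF \<open>OA_ideal I R\<close>]
          by (intro ideal_prod_subsetI) auto
        then show ?thesis using \<open>J = I\<close> by simp
      qed
    next
      case (Cons I' Is')
      have iI: "ideal (ideal_list_prod R Is) R"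
        using Js(3) Is by (auto intro!: ideal_list_prod_ideal)
      have "ideal_list_prod R Is \<subseteq> ?N"
        using ideal_list_prod_subset[of Is I'] Js(3) Is Cons sub[of I'] by auto
      then have "I \<cdot> ideal_list_prod R Is \<subseteq> ?N \<cdot> ?N"
        using Is sub[of I] by (intro ideal_prod_mono) auto
      then show ?thesis using Js(4) Is by simp
    qed
  qed
qed

lemma ideal_pow_subset_OA_prod:
  assumes N: "ideal (nonunits R) R"
    and Js: "\<And>J. J \<in> set Js \<Longrightarrow> ideal J R" "\<And>J. J \<in> set Js \<Longrightarrow> nonunits R \<cdot> nonunits R \<subseteq> J"
  shows "\<exists>n. ideal_pow R (nonunits R) n \<subseteq> ideal_list_prod R Js"
  using Js
proof (induct Js)
  case Nil
  have "ideal_pow R (nonunits R) 0 \<subseteq> ideal_list_prod R []" by simp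
  then show ?case by blast
next
  case (Cons J Js)
  then obtain n where n: "ideal_pow R (nonunits R) n \<subseteq> ideal_list_prod R Js" by auto
  have "ideal_pow R (nonunits R) (2 + n) = (nonunits R \<cdot> nonunits R) \<cdot> ideal_pow R (nonunits R) n"
    using N by (subst ideal_pow_add) (simp_all add: ideal_pow_2)
  also have "\<dots> \<subseteq> J \<cdot> ideal_list_prod R Js" using Cons n by (intro ideal_prod_mono) auto
  finally have "ideal_pow R (nonunits R) (2 + n) \<subseteq> ideal_list_prod R (J # Js)" by simp
  then show ?case by blast
qed

text \<open>A nonmaximal prime of a local OAF-ring is fixed elementwise by multiplication with nonunits,
  so it is zero.\<close>

theorem local_OAF_imp:
  assumes N: "ideal (nonunits R) R" and OAF: "OAF_ring R"
  shows "divided_ideal (nonunits R \<cdot> nonunits R) R"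
    and "nilpotent_ideal (nonunits R) R \<or>
      domain R \<and> (\<Inter>n \<in> {1..}. ideal_pow R (nonunits R) n) = {\<zero>}"
proof -
  let ?N = "nonunits R"
  note mN = maximalideal_nonunits(1)[OF N]
  have fix0: "p = \<zero>" if "m \<in> ?N" "p \<in> carrier R" "p = m \<otimes> p" for p m
  proof -
    have "\<one> \<notin> ?N" by simp
    from one_minus_notin[OF N this that(1)] have "\<one> \<ominus> m \<in> Units R" by simp
    moreover have "(\<one> \<ominus> m) \<otimes> p = \<zero>" using one_minus_mult_eq_zero that by simp
    ultimately show ?thesis using that(2)
      by (metis Units_inv_closed Units_l_inv Units_closed l_one m_assoc r_null)
  qed
  have primes: "P = {\<zero>}" if P: "primeideal P R" "P \<noteq> ?N" for P
  proof -
    have "P \<subset> ?N" using proper_ideal_nonunits[OF primeideal_proper[OF P(1)]] P(2) by blast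
    then have "p = \<zero>" if "p \<in> P" for p
      using OAF_nonmaximal_prime_fixed[OF OAF mN P(1) _ that] fix0
        ideal.Icarr[OF primeideal_is_ideal[OF P(1)] that] by metis
    then show ?thesis using ideal_zero[OF primeideal_is_ideal[OF P(1)]] by blast
  qed
  show "divided_ideal (?N \<cdot> ?N) R" using local_OAF_divided[OF N OAF] primes by blast
  have OAN: "?N \<cdot> ?N \<subseteq> J" if "OA_ideal J R" "primeideal J R \<Longrightarrow> J = ?N" for J
  proof (cases "primeideal J R")
    case True
    then show ?thesis using that ideal_prod_inter[OF N N] by auto
  next
    case False
    then show ?thesis
      using nonprime_OA_ideal[OF that(1) False] OA_ideal_ideal[OF that(1)]
      by (intro ideal_prod_subsetI) auto
  qed
  have z: "\<zero> \<in> ?N" using N by (rule ideal_zero)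
  then have "\<one> \<noteq> \<zero>" using Units_one_closed by (metis DiffD2)
  then have p0: "proper_ideal {\<zero>} R" by (simp add: proper_ideal_one zeroideal)
  show "nilpotent_ideal ?N R \<or> domain R \<and> (\<Inter>n \<in> {1..}. ideal_pow R ?N n) = {\<zero>}"
  \<comment> \<open>A field is sent to the second case, where it counts as nilpotent. In that case
    the maximal ideal is the only prime.\<close>
  proof (cases "primeideal {\<zero>} R \<and> ?N \<noteq> {\<zero>}")
    case True
    then have dom: "domain R" using zeroprimeideal_domainI is_cring by blast
    \<comment> \<open>The factors of \<open>(x)\<close> are nonzero for
      \<open>x \<noteq> \<zero>\<close>, so each contains the square of the maximal ideal
      \<open>N\<close>, and \<open>(x)\<close> contains some power of \<open>N\<close>. Since
      \<open>x\<close> lies in the next power, \<open>x \<in> N (x)\<close>, which makes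
      \<open>x\<close> vanish.\<close>
    have "x = \<zero>" if x: "x \<in> (\<Inter>n \<in> {1..}. ideal_pow R ?N n)" for x
    proof (rule ccontr)
      assume x0: "x \<noteq> \<zero>"
      have xn: "x \<in> ideal_pow R ?N (Suc n)" for n by (rule INT_D[OF x]) simp
      from xn[of 0] have xN: "x \<in> ?N" unfolding ideal_pow_1[OF N] .
      then have xc: "x \<in> carrier R" by simp
      obtain Js where Js: "\<And>J. J \<in> set Js \<Longrightarrow> OA_ideal J R"
        "\<And>J. J \<in> set Js \<Longrightarrow> ideal J R" "PIdl x = ideal_list_prod R Js"
        using OAF_ringE[OF OAF proper_cgenideal[OF xN]] by metis
      have "?N \<cdot> ?N \<subseteq> J" if J: "J \<in> set Js" for J
      proof (rule OAN[OF Js(1)[OF J]])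
        have "x \<in> J" using ideal_list_prod_subset[OF Js(2) J] Js(3) cgenideal_self[OF xc] by auto
        then show "J = ?N" if "primeideal J R" using primes[OF that] x0 by blast
      qed
      then obtain n where n: "ideal_pow R ?N n \<subseteq> PIdl x"
        using ideal_pow_subset_OA_prod[OF N Js(2)] Js(3) by metis
      have "x \<in> ?N \<cdot> ideal_pow R ?N n"
        using xn[of n] ideal_prod_commute N ideal_pow_ideal[OF N] by simp
      then have "x \<in> ?N \<cdot> (PIdl x)" using n ideal_prod_mono[of ?N ?N] by blast
      then obtain m where "m \<in> ?N" "x = m \<otimes> x" using ideal_prod_cgenideal[OF N xc] by blast
      then show False using fix0 xc x0 by blast
    qed
    moreover have "\<zero> \<in> (\<Inter>n \<in> {1..}. ideal_pow R ?N n)"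
      using ideal_zero ideal_pow_ideal[OF N] by blast
    ultimately have "(\<Inter>n \<in> {1..}. ideal_pow R ?N n) = {\<zero>}" by blast
    with dom show ?thesis by blast
  next
    case False
    then have all: "P = ?N" if "primeideal P R" for P
      using that primes by metis
    obtain Js where Js: "\<And>J. J \<in> set Js \<Longrightarrow> OA_ideal J R"
      "\<And>J. J \<in> set Js \<Longrightarrow> ideal J R" "{\<zero>} = ideal_list_prod R Js"
      using OAF_ringE[OF OAF p0] by metis
    then obtain n where n: "ideal_pow R ?N n \<subseteq> {\<zero>}"
      using ideal_pow_subset_OA_prod[OF N Js(2)] OAN all by metis
    \<comment> \<open>The successor supplies the positive exponent demanded by
      \<open>nilpotent_ideal\<close>.\<close>
    then have "ideal_pow R ?N (Suc n) = {\<zero>}"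
      using ideal_pow_antimono[OF N, of n "Suc n"] ideal_zero[OF ideal_pow_ideal[OF N, of "Suc n"]]
      by (meson empty_subsetI insert_subset le_SucI order_refl subset_antisym subset_trans)
    then show ?thesis using N unfolding nilpotent_ideal_def by (metis le_add1 plus_1_eq_Suc)
  qed
qed

text \<open>For \<open>y \<in> M - M\<^sup>2\<close> dividedness gives \<open>M\<^sup>2 = y M\<close>. An ideal contained in \<open>M\<^sup>n\<close> but not in
  \<open>M\<^bsup>n+1\<^esup>\<close> is therefore \<open>y\<^bsup>n-1\<^esup> L\<close> with \<open>L\<close> not contained in \<open>M\<^sup>2\<close>, and both \<open>(y)\<close> and \<open>L\<close> are
  OA-ideals because they contain \<open>M\<^sup>2\<close>.\<close>

theorem local_OAF_if:
  assumes N: "ideal (nonunits R) R"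
    and div: "divided_ideal (nonunits R \<cdot> nonunits R) R"
    and alt: "nilpotent_ideal (nonunits R) R \<or>
      domain R \<and> (\<Inter>n \<in> {1..}. ideal_pow R (nonunits R) n) = {\<zero>}"
  shows "OAF_ring R"
  unfolding OAF_ring_def
proof (intro allI impI)
  let ?N = "nonunits R"
  fix I assume I: "proper_ideal I R"
  then have iI: "ideal I R" and IN: "I \<subseteq> ?N" using proper_ideal_nonunits by (auto simp: proper_ideal_def)
  have NN: "ideal (?N \<cdot> ?N) R" using N by (simp add: ideal_prod_is_ideal)
  have mN: "maximalideal ?N R" using maximalideal_nonunits(1)[OF N] .
  have OAN: "OA_ideal ?N R" using maximalideal_prime[OF mN] primeideal_OA_ideal by blast
  have cmp: "?N \<cdot> ?N \<subseteq> J" if "ideal J R" "\<not> J \<subseteq> ?N \<cdot> ?N" for J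
    using div that unfolding divided_ideal_def by blast
  have powlist: "ideal_pow R J n = ideal_list_prod R (replicate n J)" if "ideal J R" for J n
  proof (induct n)
    case (Suc n)
    have "ideal (ideal_list_prod R (replicate n J)) R"
      using that by (auto intro: ideal_list_prod_ideal)
    from ideal_prod_commute[OF that this] Suc show ?case by simp
  qed simp
  show "\<exists>Js. Js \<noteq> [] \<and> (\<forall>J\<in>set Js. OA_ideal J R) \<and> I = ideal_list_prod R Js"
  proof (cases "\<exists>n. \<not> I \<subseteq> ideal_pow R ?N n")
    case False
    show ?thesis
      using alt
    proof
      assume "nilpotent_ideal ?N R"
      then obtain n where n: "n \<ge> 1" "ideal_pow R ?N n = {\<zero>}" by (auto simp: nilpotent_ideal_def)
      then have "I = {\<zero>}" using False ideal_zero[OF iI] by blast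
      then show ?thesis
        using n powlist[OF N, of n] OAN by (intro exI[of _ "replicate n ?N"]) auto
    next
      assume d: "domain R \<and> (\<Inter>n \<in> {1..}. ideal_pow R ?N n) = {\<zero>}"
      then have "I = {\<zero>}" using False ideal_zero[OF iI] by blast
      moreover have "primeideal {\<zero>} R" using d domain.zeroprimeideal by blast
      ultimately show ?thesis
        using primeideal_OA_ideal ideal_prod_one iI by (intro exI[of _ "[I]"]) auto
    qed
  next
    case True
    \<comment> \<open>Here \<open>n\<close> is the first exponent that fails, one more than the
      \<open>n\<close> of the comment above the theorem. It is at least 2, so
      \<open>n = k + 2\<close>, and the exponent of \<open>y\<close> becomes
      \<open>k\<close>.\<close>
    define n where "n = (LEAST n. \<not> I \<subseteq> ideal_pow R ?N n)"
    have n: "\<not> I \<subseteq> ideal_pow R ?N n" unfolding n_def using True by (rule LeastI_ex)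
    have less: "I \<subseteq> ideal_pow R ?N k" if "k < n" for k
      using not_less_Least[of k "\<lambda>n. \<not> I \<subseteq> ideal_pow R ?N n"] that unfolding n_def by blast
    note N1 = ideal_pow_1[OF N]
    have "n \<noteq> 0" using n ideal_subset[OF iI] by (intro notI) simp
    moreover have "n \<noteq> Suc 0" using n IN N1 by metis
    ultimately obtain k where k: "n = Suc (Suc k)" by (metis not0_implies_Suc)
    show ?thesis
    proof (cases "I \<subseteq> ?N \<cdot> ?N")
      case False
      then show ?thesis
        using prod_nonunits_OA_ideal[OF I cmp[OF iI False]] ideal_prod_one[OF iI]
        by (intro exI[of _ "[I]"]) auto
    next
      case True
      \<comment> \<open>Otherwise the powers with exponents \<open>k + 1\<close> and
        \<open>k + 2\<close> coincide, although \<open>I\<close> lies in the former and not in the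
        latter.\<close>
      have "?N \<noteq> ?N \<cdot> ?N"
      proof
        assume "?N = ?N \<cdot> ?N"
        then have "ideal_pow R ?N (Suc (Suc k)) = ideal_pow R ?N (Suc k)"
          using ideal_prod_assoc[OF ideal_pow_ideal[OF N] N N, of k] by simp
        then show False using n less[of "Suc k"] k by simp
      qed
      then obtain y where y: "y \<in> ?N" "y \<notin> ?N \<cdot> ?N" using ideal_prod_inter[OF N N] by blast
      then have yc: "y \<in> carrier R" by simp
      have iy: "ideal (PIdl y) R" using yc by (rule cgenideal_ideal)
      have NNy: "?N \<cdot> ?N \<subseteq> PIdl y" using cmp[OF iy] cgenideal_self[OF yc] y by blast
      \<comment> \<open>The coefficient of \<open>y\<close> cannot be a unit, because
        \<open>y\<close> itself lies outside the square.\<close>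
      have NNy': "\<exists>m \<in> ?N. z = m \<otimes> y" if z: "z \<in> ?N \<cdot> ?N" for z
      proof -
        obtain r where r: "r \<in> carrier R" "z = r \<otimes> y" 
          using subsetD[OF NNy z] unfolding mem_cgenideal by blast
        have "r \<notin> Units R"
        proof
          assume "r \<in> Units R"
          then have "y = inv r \<otimes> z" using r yc by (simp add: m_assoc[symmetric])
          then show False using y z NN \<open>r \<in> Units R\<close> by (metis Units_inv_closed ideal.I_l_closed)
        qed
        then show ?thesis using r by auto
      qed
      have pw: "\<exists>m \<in> ?N. z = y [^] j \<otimes> m" if "z \<in> ideal_pow R ?N (Suc j)" for z j
        using that
      proof (induct j arbitrary: z)
        case 0
        then show ?case using N1 by (auto intro!: bexI[of _ z])
      next
        case (Suc j)
        have iz: "ideal (?N \<cdot> (PIdl (y [^] Suc j))) R"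
          using N yc by (auto intro!: ideal_prod_is_ideal cgenideal_ideal)
        have yjc: "y [^] Suc j \<in> carrier R" using yc by simp
        have "ideal_pow R ?N (Suc j) \<cdot> ?N \<subseteq> ?N \<cdot> (PIdl (y [^] Suc j))"
        proof (rule ideal_prod_subsetI[OF iz])
          fix a b assume ab: "a \<in> ideal_pow R ?N (Suc j)" "b \<in> ?N"
          obtain m where m: "m \<in> ?N" "a = y [^] j \<otimes> m" using Suc(1)[OF ab(1)] by blast
          obtain m' where m': "m' \<in> ?N" "m \<otimes> b = m' \<otimes> y"
            using NNy'[of "m \<otimes> b"] m(1) ab(2) by (auto intro: ideal_prod.prod)
          have "a \<otimes> b = y [^] j \<otimes> (m \<otimes> b)" using m ab yc by (simp add: m_assoc)
          also have "\<dots> = m' \<otimes> y [^] Suc j" using m' yc by (simp add: m_ac)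
          finally show "a \<otimes> b \<in> ?N \<cdot> (PIdl (y [^] Suc j))"
            using m' cgenideal_self[OF yjc] by (auto intro: ideal_prod.prod)
        qed
        then obtain m where "m \<in> ?N" "z = m \<otimes> y [^] Suc j"
          using Suc(2) ideal_prod_cgenideal[OF N yjc, of z] by (auto simp del: nat_pow_Suc)
        then show ?case using yjc m_comm by (metis DiffD1)
      qed
      define L where "L = {l \<in> ?N. y [^] k \<otimes> l \<in> I}"
      have ykc: "y [^] k \<in> carrier R" using yc by simp
      have iL: "ideal L R"
      proof (rule idealI')
        show "L \<subseteq> carrier R" by (auto simp: L_def)
        show "\<zero> \<in> L" using ideal_zero[OF N] ideal_zero[OF iI] ykc by (auto simp: L_def)
        show "a \<oplus> b \<in> L" if "a \<in> L" "b \<in> L" for a b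
          using that ideal_add[OF N, of a b] ideal_add[OF iI] ykc unfolding L_def
          by (simp add: r_distr)
        show "x \<otimes> a \<in> L" if "a \<in> L" "x \<in> carrier R" for x a
          using that ideal.I_l_closed[OF N, of a x] ideal.I_l_closed[OF iI, of _ x] ykc unfolding L_def
          by (simp add: m_lcomm[of "y [^] k" x a])
      qed
      have "I \<subseteq> ideal_pow R ?N (Suc k)" using less k by blast
      then have rep: "\<exists>l \<in> L. z = y [^] k \<otimes> l" if "z \<in> I" for z
        using pw[of z k] that unfolding L_def by blast
      \<comment> \<open>Otherwise \<open>I\<close>, which consists of elements
        \<open>y [^] k \<otimes> l\<close>, would lie in the power with exponent
        \<open>k + 2 = n\<close>.\<close>
      have "\<not> L \<subseteq> ?N \<cdot> ?N"
      proof
        assume LN: "L \<subseteq> ?N \<cdot> ?N"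
        have yk: "y [^] j \<in> ideal_pow R ?N j" for j
          using y(1) by (induct j) (auto intro: ideal_prod.prod)
        have "I \<subseteq> ideal_pow R ?N k \<cdot> (?N \<cdot> ?N)"
        proof
          fix z assume "z \<in> I"
          then obtain l where "l \<in> L" "z = y [^] k \<otimes> l" using rep by blast
          then show "z \<in> ideal_pow R ?N k \<cdot> (?N \<cdot> ?N)"
            using ideal_prod.prod[OF yk[of k] subsetD[OF LN], of l] by simp
        qed
        then show False using n k ideal_prod_assoc[OF ideal_pow_ideal[OF N] N N, of k] by simp
      qed
      moreover have "proper_ideal L R" using iL by (auto simp: proper_ideal_one L_def)
      ultimately have OAL: "OA_ideal L R" using prod_nonunits_OA_ideal cmp iL by blast
      have "OA_ideal (PIdl y) R" using prod_nonunits_OA_ideal[OF proper_cgenideal[OF y(1)] NNy] .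
      moreover have "I = ideal_list_prod R (L # replicate k (PIdl y))"
      proof -
        have pk: "ideal_pow R (PIdl y) j = PIdl (y [^] j)" for j
        proof (induct j)
          case 0
          show ?case using genideal_one cgenideal_eq_genideal[OF one_closed] by simp
        next
          case (Suc j)
          have c: "y [^] j \<in> carrier R" using yc by simp
          have "(PIdl (y [^] j)) \<cdot> (PIdl y) = PIdl (y [^] j \<otimes> y)"
          proof
            show "(PIdl (y [^] j)) \<cdot> (PIdl y) \<subseteq> PIdl (y [^] j \<otimes> y)"
            proof (rule ideal_prod_subsetI)
              fix a b assume "a \<in> PIdl (y [^] j)" "b \<in> PIdl y"
              then obtain r s where "r \<in> carrier R" "s \<in> carrier R" "a = r \<otimes> y [^] j" "b = s \<otimes> y"
                unfolding mem_cgenideal by blast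
              moreover from this have "a \<otimes> b = (r \<otimes> s) \<otimes> (y [^] j \<otimes> y)" using yc c by (simp add: m_ac)
              ultimately show "a \<otimes> b \<in> PIdl (y [^] j \<otimes> y)" using mem_cgenideal m_closed by metis
            qed (use yc in \<open>simp add: cgenideal_ideal\<close>)
            have "ideal ((PIdl (y [^] j)) \<cdot> (PIdl y)) R"
              using yc by (intro ideal_prod_is_ideal cgenideal_ideal) auto
            then show "PIdl (y [^] j \<otimes> y) \<subseteq> (PIdl (y [^] j)) \<cdot> (PIdl y)"
              using cgenideal_self[OF yc] cgenideal_self[OF c]
              by (intro cgenideal_minimal) (auto intro: ideal_prod.prod)
          qed
          then show ?case using Suc by simp
        qed
        have "I = L \<cdot> (PIdl (y [^] k))"
        proof
          show "I \<subseteq> L \<cdot> (PIdl (y [^] k))"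
          proof
            fix z assume "z \<in> I"
            then obtain l where l: "l \<in> L" "z = y [^] k \<otimes> l" using rep by blast
            then have "z = l \<otimes> y [^] k" using ykc ideal.Icarr[OF iL] m_comm by metis
            then show "z \<in> L \<cdot> (PIdl (y [^] k))"
              using l(1) cgenideal_self[OF ykc] by (auto intro: ideal_prod.prod)
          qed
          show "L \<cdot> (PIdl (y [^] k)) \<subseteq> I"
          proof
            fix z assume "z \<in> L \<cdot> (PIdl (y [^] k))"
            then obtain l where l: "l \<in> L" "z = l \<otimes> y [^] k" using ideal_prod_cgenideal[OF iL ykc] by blast
            then have "z = y [^] k \<otimes> l" using ykc ideal.Icarr[OF iL] m_comm by metis
            then show "z \<in> I" using l(1) by (simp add: L_def)
          qed
        qed
        then show ?thesis using powlist[OF iy, of k] pk[of k] by simp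
      qed
      ultimately show ?thesis
        using OAL by (intro exI[of _ "L # replicate k (PIdl y)"]) auto
    qed
  qed
qed

section \<open>Rings in which every proper ideal is an OA-ideal\<close>

text \<open>The zero ideal decides. If it is not prime, it contains all products of two nonunits. If
  it is prime, the OA-ideal generated by the cube of a nonunit \<open>x \<noteq> \<zero>\<close>
  contains \<open>x x\<close>, and cancelling in \<open>x x = r x x x\<close> makes \<open>x\<close>
  a unit; the ring is a field. Conversely, every ideal contains the zero square of the maximal
  ideal.\<close>

theorem all_OA_iff:
  assumes "\<one> \<noteq> \<zero>"
  shows "(\<forall>I. proper_ideal I R \<longrightarrow> OA_ideal I R) \<longleftrightarrow>
    ideal (nonunits R) R \<and> nonunits R \<cdot> nonunits R = {\<zero>}"
proof
  assume all: "\<forall>I. proper_ideal I R \<longrightarrow> OA_ideal I R"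
  have p0: "proper_ideal {\<zero>} R" using assms by (simp add: proper_ideal_one zeroideal)
  then have OA0: "OA_ideal {\<zero>} R" using all by blast
  have z: "\<zero> \<in> nonunits R" using proper_ideal_nonunits[OF p0] by blast
  show "ideal (nonunits R) R \<and> nonunits R \<cdot> nonunits R = {\<zero>}"
  proof (cases "primeideal {\<zero>} R")
    case False
    have N: "ideal (nonunits R) R" by (rule nonprime_OA_ideal_nonunits[OF OA0 False])
    have "nonunits R \<cdot> nonunits R \<subseteq> {\<zero>}"
      using nonprime_OA_ideal[OF OA0 False] by (intro ideal_prod_subsetI[OF zeroideal])
    then show ?thesis using N ideal_zero[OF ideal_prod_is_ideal[OF N N]] by blast
  next
    case True
    have "x = \<zero>" if x: "x \<in> nonunits R" for x
    proof (rule ccontr)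
      assume x0: "x \<noteq> \<zero>"
      let ?x3 = "x \<otimes> x \<otimes> x"
      have xc: "x \<in> carrier R" using x by simp
      have "?x3 \<notin> Units R" using Units_factor[of x "x \<otimes> x"] x by (auto simp: m_assoc)
      then have "OA_ideal (PIdl ?x3) R" using all proper_cgenideal[of ?x3] xc by simp
      moreover have "?x3 \<in> PIdl ?x3" using xc by (intro cgenideal_self) simp
      ultimately have "x \<otimes> x \<in> PIdl ?x3"
        using OA_idealD[of "PIdl ?x3" x x x] x ideal.I_l_closed[OF cgenideal_ideal[of ?x3], of x x] xc
        by auto
      then obtain r where r: "r \<in> carrier R" "x \<otimes> x = r \<otimes> ?x3" unfolding mem_cgenideal by blast
      have "x \<otimes> x \<otimes> (\<one> \<ominus> r \<otimes> x) = x \<otimes> x \<ominus> r \<otimes> ?x3" using r(1) xc by algebra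
      also have "\<dots> = \<zero>" unfolding r(2)[symmetric] using xc by (simp add: a_minus_def r_neg)
      finally have "\<one> \<ominus> r \<otimes> x = \<zero>"
        using primeideal_mult[OF True, of "x \<otimes> x" "\<one> \<ominus> r \<otimes> x"] primeideal_mult[OF True, of x x]
          x0 r(1) xc by auto
      moreover have "(\<one> \<ominus> r \<otimes> x) \<oplus> x \<otimes> r = \<one>" using r(1) xc by algebra
      ultimately have "x \<otimes> r = \<one>" using r(1) xc by simp
      then show False using Units_factor[OF xc r(1)] Units_one_closed x by simp
    qed
    then have "nonunits R = {\<zero>}" using z by blast
    then show ?thesis using zeroideal ideal_prod_zero[OF zeroideal] by simp
  qed
next
  assume N: "ideal (nonunits R) R \<and> nonunits R \<cdot> nonunits R = {\<zero>}"
  show "\<forall>I. proper_ideal I R \<longrightarrow> OA_ideal I R"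
    using N prod_nonunits_OA_ideal ideal_zero unfolding proper_ideal_def by (metis empty_subsetI insert_subset)
qed

end

section \<open>Surjective ring homomorphisms\<close>

text \<open>Quotients are treated through surjections with an explicit kernel condition. Two
  instances occur: the projection \<open>fst\<close> of a trivial extension, and the embedding of
  \<open>A\<close> when \<open>E\<close> is zero.\<close>

locale surj_ring_hom = ring_hom_cring R S h for R (structure) and S (structure) and h +
  assumes surj: "h ` carrier R = carrier S"
begin

lemma img_ideal:
  assumes "ideal I R"
  shows "ideal (h ` I) S"
proof (rule S.idealI')
  note Ic = ideal.Icarr[OF assms]
  show "h ` I \<subseteq> carrier S" using Ic surj by blast
  show "\<zero>\<^bsub>S\<^esub> \<in> h ` I" using R.ideal_zero[OF assms] by (force simp: image_iff)
  show "a \<oplus>\<^bsub>S\<^esub> b \<in> h ` I" if ab: "a \<in> h ` I" "b \<in> h ` I" for a b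
  proof -
    obtain i j where "i \<in> I" "j \<in> I" "a = h i" "b = h j" using ab by blast
    then show ?thesis using R.ideal_add[OF assms, of i j] Ic by (auto intro!: image_eqI[of _ h "i \<oplus> j"])
  qed
  show "x \<otimes>\<^bsub>S\<^esub> a \<in> h ` I" if ax: "a \<in> h ` I" "x \<in> carrier S" for a x
  proof -
    obtain i r where "i \<in> I" "r \<in> carrier R" "a = h i" "x = h r" using ax surj by blast
    then show ?thesis
      using ideal.I_l_closed[OF assms, of i r] Ic by (auto intro!: image_eqI[of _ h "r \<otimes> i"])
  qed
qed

lemma img_prod:
  assumes I: "ideal I R" and J: "ideal J R"
  shows "h ` (I \<cdot> J) = (h ` I) \<cdot>\<^bsub>S\<^esub> (h ` J)"
proof
  note Ic = ideal.Icarr[OF I] and Jc = ideal.Icarr[OF J]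
  have IJc: "x \<in> carrier R" if "x \<in> I \<cdot> J" for x
    using R.ideal_prod_in_carrier[OF I J] that by blast
  have "h x \<in> (h ` I) \<cdot>\<^bsub>S\<^esub> (h ` J)" if "x \<in> I \<cdot> J" for x
    using that
  proof induct
    case (prod i j)
    then show ?case using Ic Jc by (simp add: ideal_prod.prod)
  next
    case (sum s t)
    then show ?case using IJc by (simp add: ideal_prod.sum)
  qed
  then show "h ` (I \<cdot> J) \<subseteq> (h ` I) \<cdot>\<^bsub>S\<^esub> (h ` J)" by blast
  show "(h ` I) \<cdot>\<^bsub>S\<^esub> (h ` J) \<subseteq> h ` (I \<cdot> J)"
  proof (rule S.ideal_prod_subsetI)
    show "ideal (h ` (I \<cdot> J)) S" using I J by (intro img_ideal R.ideal_prod_is_ideal)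
    fix a b assume "a \<in> h ` I" "b \<in> h ` J"
    then obtain i j where "i \<in> I" "j \<in> J" "a = h i" "b = h j" by blast
    then show "a \<otimes>\<^bsub>S\<^esub> b \<in> h ` (I \<cdot> J)"
      using Ic Jc ideal_prod.prod[of i I j J R] by (auto intro!: image_eqI[of _ h "i \<otimes> j"])
  qed
qed

lemma img_list_prod:
  "(\<And>J. J \<in> set Js \<Longrightarrow> ideal J R) \<Longrightarrow>
    h ` ideal_list_prod R Js = ideal_list_prod S (map ((`) h) Js)"
  by (induct Js) (simp_all add: surj img_prod R.ideal_list_prod_ideal)

lemma vimg_ideal:
  assumes "ideal J S"
  shows "ideal {r \<in> carrier R. h r \<in> J} R"
  by (rule R.idealI')
    (auto simp: S.ideal_zero[OF assms] S.ideal_add[OF assms] ideal.I_l_closed[OF assms])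

lemma img_vimg: "J \<subseteq> carrier S \<Longrightarrow> h ` {r \<in> carrier R. h r \<in> J} = J"
  unfolding surj[symmetric] by blast

lemma kernel_mem:
  assumes I: "ideal I R" and ker: "{r \<in> carrier R. h r = \<zero>\<^bsub>S\<^esub>} \<subseteq> I"
    and r: "r \<in> carrier R" "h r \<in> h ` I"
  shows "r \<in> I"
proof -
  obtain i where i: "i \<in> I" "h r = h i" using r by blast
  have ic: "i \<in> carrier R" using i ideal.Icarr[OF I] by blast
  have "h (r \<ominus> i) = \<zero>\<^bsub>S\<^esub>" using r ic i(2) by (simp add: a_minus_def S.r_neg)
  then have "r \<ominus> i \<in> I" using ker r ic by auto
  moreover have "r = (r \<ominus> i) \<oplus> i" using r ic by algebra
  ultimately show ?thesis using R.ideal_add[OF I] i(1) by metis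
qed

lemma img_proper:
  assumes I: "proper_ideal I R" and ker: "{r \<in> carrier R. h r = \<zero>\<^bsub>S\<^esub>} \<subseteq> I"
  shows "proper_ideal (h ` I) S"
proof -
  have "ideal I R" "\<one> \<notin> I" using I by (auto simp: R.proper_ideal_one)
  then show ?thesis
    using kernel_mem[of I \<one>] ker by (auto simp: S.proper_ideal_one img_ideal)
qed

lemma Units_img:
  assumes "u \<in> Units R"
  shows "h u \<in> Units S"
proof -
  have "h u \<otimes>\<^bsub>S\<^esub> h (inv u) = \<one>\<^bsub>S\<^esub>"
    using hom_mult[of u "inv u"] assms R.Units_closed[OF assms] by simp
  then show ?thesis
    using S.Units_factor[of "h u" "h (inv u)"] assms R.Units_closed[OF assms] by simp
qed

text \<open>Nonunits lift to nonunits, since units map to units, and membership in the image can be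
  tested on any lift because \<open>I\<close> contains the kernel.\<close>

lemma img_OA:
  assumes I: "OA_ideal I R" and ker: "{r \<in> carrier R. h r = \<zero>\<^bsub>S\<^esub>} \<subseteq> I"
  shows "OA_ideal (h ` I) S"
  unfolding OA_ideal_def
proof (intro conjI ballI impI)
  show "proper_ideal (h ` I) S" using I ker by (intro img_proper) (auto simp: OA_ideal_def)
  fix a b c
  assume abc: "a \<in> nonunits S" "b \<in> nonunits S" "c \<in> nonunits S" "a \<otimes>\<^bsub>S\<^esub> b \<otimes>\<^bsub>S\<^esub> c \<in> h ` I"
  have lift: "\<exists>r \<in> nonunits R. x = h r" if "x \<in> nonunits S" for x
    using that Units_img unfolding surj[symmetric] by blast
  obtain r s t where rst: "r \<in> nonunits R" "s \<in> nonunits R" "t \<in> nonunits R"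
    "a = h r" "b = h s" "c = h t" using lift abc(1-3) by meson
  then have "h (r \<otimes> s \<otimes> t) \<in> h ` I" using abc(4) by simp
  then have "r \<otimes> s \<otimes> t \<in> I"
    using kernel_mem[OF R.OA_ideal_ideal[OF I] ker, of "r \<otimes> s \<otimes> t"] rst by simp
  then have "r \<otimes> s \<in> I \<or> t \<in> I" using R.OA_idealD[OF I] rst by blast
  moreover have "a \<otimes>\<^bsub>S\<^esub> b = h (r \<otimes> s)" using rst by simp
  ultimately show "a \<otimes>\<^bsub>S\<^esub> b \<in> h ` I \<or> c \<in> h ` I" using rst by blast
qed

lemma img_prime:
  assumes I: "primeideal I R" and ker: "{r \<in> carrier R. h r = \<zero>\<^bsub>S\<^esub>} \<subseteq> I"
  shows "primeideal (h ` I) S"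
proof (rule primeidealI)
  show "ideal (h ` I) S" "carrier S \<noteq> h ` I"
    using img_proper[OF R.primeideal_proper[OF I] ker] by (auto simp: proper_ideal_def)
  show "cring S" by (rule S.is_cring)
  fix a b assume ab: "a \<in> carrier S" "b \<in> carrier S" "a \<otimes>\<^bsub>S\<^esub> b \<in> h ` I"
  obtain r s where rs: "r \<in> carrier R" "s \<in> carrier R" "a = h r" "b = h s" using ab surj by blast
  then have "h (r \<otimes> s) \<in> h ` I" using ab(3) by simp
  then have "r \<otimes> s \<in> I"
    using kernel_mem[OF R.primeideal_is_ideal[OF I] ker, of "r \<otimes> s"] rs by simp
  then show "a \<in> h ` I \<or> b \<in> h ` I" using R.primeideal_mult[OF I] rs by blast
qed

text \<open>The preimage of \<open>I\<close> contains the kernel, hence so does each of its factors,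
  and factors that contain the kernel have images of the required kind. The predicates
  \<open>C\<close> and \<open>D\<close> cover the OA-ideals and the primes together.\<close>

lemma factorization_img:
  assumes fac: "\<And>I. proper_ideal I R \<Longrightarrow> \<exists>Js. Js \<noteq> [] \<and> (\<forall>J \<in> set Js. C J) \<and> I = ideal_list_prod R Js"
    and C: "\<And>J. C J \<Longrightarrow> ideal J R"
    and D: "\<And>J. \<lbrakk>C J; {r \<in> carrier R. h r = \<zero>\<^bsub>S\<^esub>} \<subseteq> J\<rbrakk> \<Longrightarrow> D (h ` J)"
    and I: "proper_ideal I S"
  shows "\<exists>Js. Js \<noteq> [] \<and> (\<forall>J \<in> set Js. D J) \<and> I = ideal_list_prod S Js"
proof -
  let ?I = "{r \<in> carrier R. h r \<in> I}"
  have I': "ideal I S" "\<one>\<^bsub>S\<^esub> \<notin> I" using I by (auto simp: S.proper_ideal_one)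
  then have "proper_ideal ?I R" by (auto simp: R.proper_ideal_one vimg_ideal)
  then obtain Js where Js: "Js \<noteq> []" "\<And>J. J \<in> set Js \<Longrightarrow> C J" "?I = ideal_list_prod R Js"
    using fac by meson
  have id: "ideal J R" if "J \<in> set Js" for J using Js(2) C that by blast
  have "{r \<in> carrier R. h r = \<zero>\<^bsub>S\<^esub>} \<subseteq> ?I" using S.ideal_zero[OF I'(1)] by auto
  then have "D (h ` J)" if "J \<in> set Js" for J
    using R.ideal_list_prod_subset[OF id that] Js(2)[OF that] Js(3) by (intro D) auto
  moreover have "I = ideal_list_prod S (map ((`) h) Js)"
    using img_vimg[OF S.ideal_subset[OF I'(1)]] img_list_prod[OF id] Js(3) by simp
  ultimately show ?thesis using Js(1) by (intro exI[of _ "map ((`) h) Js"]) auto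
qed

lemma OAF_img: "OAF_ring R \<Longrightarrow> OAF_ring S"
  using factorization_img[of "\<lambda>J. OA_ideal J R" "\<lambda>J. OA_ideal J S"] R.OA_ideal_ideal img_OA
  unfolding OAF_ring_def by blast

lemma general_ZPI_img: "general_ZPI_ring R \<Longrightarrow> general_ZPI_ring S"
  using factorization_img[of "\<lambda>J. primeideal J R" "\<lambda>J. primeideal J S"] R.primeideal_is_ideal img_prime
  unfolding general_ZPI_ring_def by blast

end

section \<open>Ideals of a trivial ring extension\<close>

lemma trivial_extension_simps [simp]:
  "carrier (A \<propto> E) = carrier A \<times> carrier E"
  "(a, x) \<otimes>\<^bsub>A \<propto> E\<^esub> (b, y) = (a \<otimes>\<^bsub>A\<^esub> b, a \<odot>\<^bsub>E\<^esub> y \<oplus>\<^bsub>E\<^esub> b \<odot>\<^bsub>E\<^esub> x)"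
  "\<one>\<^bsub>A \<propto> E\<^esub> = (\<one>\<^bsub>A\<^esub>, \<zero>\<^bsub>E\<^esub>)" "\<zero>\<^bsub>A \<propto> E\<^esub> = (\<zero>\<^bsub>A\<^esub>, \<zero>\<^bsub>E\<^esub>)"
  "(a, x) \<oplus>\<^bsub>A \<propto> E\<^esub> (b, y) = (a \<oplus>\<^bsub>A\<^esub> b, x \<oplus>\<^bsub>E\<^esub> y)"
  by (simp_all add: trivial_extension_def)

locale idealization = module A E for A (structure) and E (structure)
begin

sublocale T: cring "A \<propto> E"
  by (rule trivial_extension_cring) unfold_locales

abbreviation full :: "'a set \<Rightarrow> ('a \<times> 'c) set" where "full K \<equiv> K \<times> carrier E"

abbreviation Z :: "('a \<times> 'c) set" where "Z \<equiv> full {\<zero>}"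

abbreviation IE :: "'a set \<Rightarrow> 'c set" where "IE I \<equiv> ideal_smult I E"

lemma fst_hom: "surj_ring_hom (A \<propto> E) A fst"
proof -
  have "fst ` (carrier A \<times> carrier E) = carrier A" using M.zero_closed by force
  moreover have "fst \<in> ring_hom (A \<propto> E) A" by (auto simp: ring_hom_def)
  ultimately show ?thesis
    by (intro surj_ring_hom.intro surj_ring_hom_axioms.intro ring_hom_cring.intro ring_hom_cring_axioms.intro T.is_cring R.is_cring)
      simp_all
qed

lemma IE_carrier: "I \<subseteq> carrier A \<Longrightarrow> IE I \<subseteq> carrier E"
proof
  show "x \<in> carrier E" if "I \<subseteq> carrier A" "x \<in> IE I" for x
    using that(2) by induct (use that(1) in auto)
qed

lemma IE_zero: "ideal I A \<Longrightarrow> \<zero>\<^bsub>E\<^esub> \<in> IE I"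
  using ideal_smult.smult[of \<zero> I "\<zero>\<^bsub>E\<^esub>" E] R.ideal_zero by simp

lemma IE_smult:
  assumes "ideal I A" "a \<in> carrier A" "x \<in> IE I"
  shows "a \<odot>\<^bsub>E\<^esub> x \<in> IE I"
  using assms(3)
proof induct
  case (smult b x)
  have "a \<odot>\<^bsub>E\<^esub> (b \<odot>\<^bsub>E\<^esub> x) = (a \<otimes> b) \<odot>\<^bsub>E\<^esub> x"
    using smult assms ideal.Icarr[OF assms(1)] by (simp add: smult_assoc1)
  then show ?case using smult assms by (simp add: ideal_smult.smult ideal.I_l_closed)
next
  case (sum x y)
  then show ?case
    using IE_carrier[OF R.ideal_subset[OF assms(1)]] assms(2)
    by (auto simp: smult_r_distr subset_iff intro: ideal_smult.sum)
qed

lemma Times_ideal: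
  assumes K: "ideal K A" and F: "F \<subseteq> carrier E" "\<zero>\<^bsub>E\<^esub> \<in> F"
    and add: "\<And>x y. \<lbrakk>x \<in> F; y \<in> F\<rbrakk> \<Longrightarrow> x \<oplus>\<^bsub>E\<^esub> y \<in> F"
    and mult: "\<And>a x. \<lbrakk>a \<in> carrier A; x \<in> F\<rbrakk> \<Longrightarrow> a \<odot>\<^bsub>E\<^esub> x \<in> F"
    and KF: "\<And>k x. \<lbrakk>k \<in> K; x \<in> carrier E\<rbrakk> \<Longrightarrow> k \<odot>\<^bsub>E\<^esub> x \<in> F"
  shows "ideal (K \<times> F) (A \<propto> E)"
proof (rule T.idealI')
  show "K \<times> F \<subseteq> carrier (A \<propto> E)" using R.ideal_subset[OF K] F by auto
  show "\<zero>\<^bsub>A \<propto> E\<^esub> \<in> K \<times> F" using R.ideal_zero[OF K] F by simp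
  show "p \<oplus>\<^bsub>A \<propto> E\<^esub> q \<in> K \<times> F" if "p \<in> K \<times> F" "q \<in> K \<times> F" for p q
    using that R.ideal_add[OF K] add by auto
  show "r \<otimes>\<^bsub>A \<propto> E\<^esub> p \<in> K \<times> F" if "p \<in> K \<times> F" "r \<in> carrier (A \<propto> E)" for p r
    using that ideal.I_l_closed[OF K] add mult KF by auto
qed

lemma full_ideal: "ideal K A \<Longrightarrow> ideal (full K) (A \<propto> E)"
  using ideal.Icarr[of K A] by (intro Times_ideal) auto

lemma Z_ideal: "ideal Z (A \<propto> E)"
  by (rule full_ideal[OF R.zeroideal])

lemma full_proper: "proper_ideal K A \<Longrightarrow> proper_ideal (full K) (A \<propto> E)"
  by (auto simp: R.proper_ideal_one T.proper_ideal_one full_ideal)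

lemma fst_full [simp]: "fst ` full K = K"
  using M.zero_closed by force

text \<open>The second coordinate can be changed at will by adding elements of
  \<open>Z\<close>.\<close>

lemma full_fst:
  assumes J: "ideal J (A \<propto> E)" and Z: "Z \<subseteq> J"
  shows "J = full (fst ` J)"
proof -
  have "(a, y) \<in> J" if "(a, x) \<in> J" "y \<in> carrier E" for a x y
  proof -
    have c: "a \<in> carrier A" "x \<in> carrier E" using ideal.Icarr[OF J that(1)] by auto
    have "(\<zero>, y \<ominus>\<^bsub>E\<^esub> x) \<in> J" using Z c that by auto
    then have "(a, x) \<oplus>\<^bsub>A \<propto> E\<^esub> (\<zero>, y \<ominus>\<^bsub>E\<^esub> x) \<in> J" using T.ideal_add[OF J] that(1) by blast
    moreover have "x \<oplus>\<^bsub>E\<^esub> (y \<ominus>\<^bsub>E\<^esub> x) = y"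
      using c that by (metis M.a_comm M.add.inv_solve_right M.minus_closed a_minus_def)
    ultimately show ?thesis using c by simp
  qed
  then show ?thesis using ideal.Icarr[OF J] by force
qed

lemma primeideal_full:
  assumes P: "primeideal P A"
  shows "primeideal (full P) (A \<propto> E)"
proof (rule primeidealI)
  show "ideal (full P) (A \<propto> E)" "carrier (A \<propto> E) \<noteq> full P"
    using full_proper[OF R.primeideal_proper[OF P]] by (auto simp: proper_ideal_def)
  show "cring (A \<propto> E)" by (rule T.is_cring)
  show "p \<in> full P \<or> q \<in> full P"
    if "p \<in> carrier (A \<propto> E)" "q \<in> carrier (A \<propto> E)" "p \<otimes>\<^bsub>A \<propto> E\<^esub> q \<in> full P" for p q
    using that by (auto dest: R.primeideal_mult[OF P])
qed

lemma Z_subset_prime: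
  assumes Q: "primeideal Q (A \<propto> E)"
  shows "Z \<subseteq> Q"
proof
  fix p assume "p \<in> Z"
  then obtain x where x: "x \<in> carrier E" "p = (\<zero>, x)" by auto
  have "p \<otimes>\<^bsub>A \<propto> E\<^esub> p = \<zero>\<^bsub>A \<propto> E\<^esub>" using x by simp
  then show "p \<in> Q"
    using T.primeideal_mult[OF Q, of p p] T.ideal_zero[OF T.primeideal_is_ideal[OF Q]] x by auto
qed

lemma primeideal_fst:
  assumes Q: "primeideal Q (A \<propto> E)"
  shows "primeideal (fst ` Q) A" "Q = full (fst ` Q)"
proof -
  interpret h: surj_ring_hom "A \<propto> E" A fst by (rule fst_hom)
  have "{r \<in> carrier (A \<propto> E). fst r = \<zero>} \<subseteq> Q" using Z_subset_prime[OF Q] by auto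
  then show "primeideal (fst ` Q) A" using h.img_prime[OF Q] by blast
  show "Q = full (fst ` Q)"
    using full_fst[OF T.primeideal_is_ideal[OF Q] Z_subset_prime[OF Q]] .
qed

text \<open>The product \<open>(a, x) (b, y) = (a b, a y + b x)\<close> gives one inclusion. For the
  other, \<open>(i, 0) (j, 0)\<close> and \<open>(a, 0) (0, x)\<close> generate the two coordinates
  separately.\<close>

lemma full_square:
  assumes K: "ideal K A"
  shows "full K \<cdot>\<^bsub>A \<propto> E\<^esub> full K = (K \<cdot> K) \<times> IE K"
proof
  note Kc = ideal.Icarr[OF K] and iF = full_ideal[OF K]
  have KK: "ideal (K \<cdot> K) A" "K \<cdot> K \<subseteq> K"
    using K R.ideal_prod_is_ideal R.ideal_prod_inter[OF K K] by auto
  have "ideal ((K \<cdot> K) \<times> IE K) (A \<propto> E)"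
    by (rule Times_ideal)
      (use KK K IE_carrier[OF R.ideal_subset[OF K]] IE_zero IE_smult in
        \<open>auto intro: ideal_smult.intros\<close>)
  then show "full K \<cdot>\<^bsub>A \<propto> E\<^esub> full K \<subseteq> (K \<cdot> K) \<times> IE K"
  proof (rule T.ideal_prod_subsetI)
    fix p q assume "p \<in> full K" "q \<in> full K"
    then obtain a x b y where "p = (a, x)" "q = (b, y)" "a \<in> K" "b \<in> K" "x \<in> carrier E" "y \<in> carrier E"
      by blast
    moreover from this have "a \<otimes> b \<in> K \<cdot> K" by (intro ideal_prod.prod)
    moreover from calculation have "a \<odot>\<^bsub>E\<^esub> y \<oplus>\<^bsub>E\<^esub> b \<odot>\<^bsub>E\<^esub> x \<in> IE K"
      by (intro ideal_smult.sum ideal_smult.smult)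
    ultimately show "p \<otimes>\<^bsub>A \<propto> E\<^esub> q \<in> (K \<cdot> K) \<times> IE K" by simp
  qed
  have iFF: "ideal (full K \<cdot>\<^bsub>A \<propto> E\<^esub> full K) (A \<propto> E)" using iF by (intro T.ideal_prod_is_ideal)
  have 1: "(m, \<zero>\<^bsub>E\<^esub>) \<in> full K \<cdot>\<^bsub>A \<propto> E\<^esub> full K" if "m \<in> K \<cdot> K" for m
    using that
  proof induct
    case (prod i j)
    then have "(i, \<zero>\<^bsub>E\<^esub>) \<otimes>\<^bsub>A \<propto> E\<^esub> (j, \<zero>\<^bsub>E\<^esub>) \<in> full K \<cdot>\<^bsub>A \<propto> E\<^esub> full K"
      by (intro ideal_prod.prod) auto
    then show ?case using prod Kc by simp
  next
    case (sum s t)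
    then show ?case using T.ideal_add[OF iFF, of "(s, \<zero>\<^bsub>E\<^esub>)" "(t, \<zero>\<^bsub>E\<^esub>)"] by simp
  qed
  have 2: "(\<zero>, x) \<in> full K \<cdot>\<^bsub>A \<propto> E\<^esub> full K" if "x \<in> IE K" for x
    using that
  proof induct
    case (smult a x)
    then have "(a, \<zero>\<^bsub>E\<^esub>) \<otimes>\<^bsub>A \<propto> E\<^esub> (\<zero>, x) \<in> full K \<cdot>\<^bsub>A \<propto> E\<^esub> full K"
      using R.ideal_zero[OF K] by (intro ideal_prod.prod) auto
    then show ?case using smult Kc by simp
  next
    case (sum x y)
    then show ?case using T.ideal_add[OF iFF, of "(\<zero>, x)" "(\<zero>, y)"] by simp
  qed
  show "(K \<cdot> K) \<times> IE K \<subseteq> full K \<cdot>\<^bsub>A \<propto> E\<^esub> full K"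
  proof
    fix p assume "p \<in> (K \<cdot> K) \<times> IE K"
    then obtain m x where mx: "m \<in> K \<cdot> K" "x \<in> IE K" "p = (m, x)" by auto
    have "m \<in> carrier A" "x \<in> carrier E"
      using mx KK Kc IE_carrier[OF R.ideal_subset[OF K]] by auto
    then have "p = (m, \<zero>\<^bsub>E\<^esub>) \<oplus>\<^bsub>A \<propto> E\<^esub> (\<zero>, x)" using mx by simp
    then show "p \<in> full K \<cdot>\<^bsub>A \<propto> E\<^esub> full K" using T.ideal_add[OF iFF 1[OF mx(1)] 2[OF mx(2)]] by metis
  qed
qed

lemma Z_subset_Z_prod_full:
  assumes P: "ideal P A" and PE: "IE P = carrier E"
  shows "Z \<subseteq> Z \<cdot>\<^bsub>A \<propto> E\<^esub> full P"
proof -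
  have "(\<zero>, x) \<in> Z \<cdot>\<^bsub>A \<propto> E\<^esub> full P" if "x \<in> IE P" for x
    using that
  proof induct
    case (smult a x)
    then have "(\<zero>, x) \<otimes>\<^bsub>A \<propto> E\<^esub> (a, \<zero>\<^bsub>E\<^esub>) \<in> Z \<cdot>\<^bsub>A \<propto> E\<^esub> full P"
      by (intro ideal_prod.prod) auto
    then show ?case using smult ideal.Icarr[OF P] by simp
  next
    case (sum x y)
    have "(\<zero>, x) \<oplus>\<^bsub>A \<propto> E\<^esub> (\<zero>, y) \<in> Z \<cdot>\<^bsub>A \<propto> E\<^esub> full P" using sum by (intro ideal_prod.sum)
    then show ?case by simp
  qed
  then show ?thesis using PE by auto
qed

text \<open>Since \<open>(0, x) (a, 0) = (0, a x)\<close>, a factor \<open>P\<close> with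
  \<open>IE P = carrier E\<close> can be inserted without shrinking \<open>Z\<close>.\<close>

lemma Z_subset_Z_prod_list:
  assumes "\<And>P. P \<in> set Ps \<Longrightarrow> ideal P A \<and> IE P = carrier E"
  shows "Z \<subseteq> Z \<cdot>\<^bsub>A \<propto> E\<^esub> ideal_list_prod (A \<propto> E) (map full Ps)"
  using assms
proof (induct Ps)
  case Nil
  then show ?case using T.ideal_prod_one[OF Z_ideal] by simp
next
  case (Cons P Ps)
  let ?L = "ideal_list_prod (A \<propto> E) (map full Ps)"
  have P: "ideal P A" "IE P = carrier E" and L: "ideal ?L (A \<propto> E)"
    using Cons(2) by (auto intro!: T.ideal_list_prod_ideal full_ideal)
  have "Z \<subseteq> Z \<cdot>\<^bsub>A \<propto> E\<^esub> ?L" using Cons by simp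
  also have "\<dots> \<subseteq> (Z \<cdot>\<^bsub>A \<propto> E\<^esub> full P) \<cdot>\<^bsub>A \<propto> E\<^esub> ?L"
    using Z_subset_Z_prod_full[OF P] by (rule T.ideal_prod_mono) simp
  also have "\<dots> = Z \<cdot>\<^bsub>A \<propto> E\<^esub> (full P \<cdot>\<^bsub>A \<propto> E\<^esub> ?L)"
    by (rule T.ideal_prod_assoc[OF Z_ideal full_ideal[OF P(1)] L])
  finally show ?case by simp
qed

lemma fst_list_prod:
  assumes "\<And>P. P \<in> set Ps \<Longrightarrow> ideal P A"
  shows "fst ` ideal_list_prod (A \<propto> E) (map full Ps) = ideal_list_prod A Ps"
proof -
  interpret h: surj_ring_hom "A \<propto> E" A fst by (rule fst_hom)
  have "map ((`) fst) (map full Ps) = Ps" unfolding map_map comp_def fst_full by simp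
  then show ?thesis
    using h.img_list_prod[of "map full Ps"] assms full_ideal by auto
qed

section \<open>Trivial extensions that are general ZPI-rings\<close>

context
  assumes ZPI: "general_ZPI_ring (A \<propto> E)"
begin

lemma ZPI_base: "general_ZPI_ring A"
  using surj_ring_hom.general_ZPI_img[OF fst_hom ZPI] .

lemma ZPI_factorization:
  assumes "proper_ideal K (A \<propto> E)"
  obtains Ps where "Ps \<noteq> []" "\<And>P. P \<in> set Ps \<Longrightarrow> primeideal P A"
    "K = ideal_list_prod (A \<propto> E) (map full Ps)"
proof -
  obtain Qs where Qs: "Qs \<noteq> []" "\<And>Q. Q \<in> set Qs \<Longrightarrow> primeideal Q (A \<propto> E)"
    "K = ideal_list_prod (A \<propto> E) Qs" using T.general_ZPI_ringE[OF ZPI assms] by metis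
  have "map full (map ((`) fst) Qs) = Qs"
    using primeideal_fst(2)[OF Qs(2)] by (simp add: map_idI)
  then show thesis
    using that[of "map ((`) fst) Qs"] Qs primeideal_fst(1)[OF Qs(2)] by auto
qed

text \<open>Every prime factor of \<open>full (P \<cdot> P)\<close> is \<open>full P\<close>. A
  single factor gives \<open>P \<cdot> P = P\<close>; two or more place
  \<open>full (P \<cdot> P)\<close> inside \<open>(P \<cdot> P) \<times> IE P\<close>, so that
  \<open>IE P\<close> is all of \<open>E\<close>.\<close>

lemma ZPI_maximal_cases:
  assumes P: "maximalideal P A"
  shows "P \<cdot> P = P \<or> IE P = carrier E"
proof -
  note iP = R.maximalideal_is_ideal[OF P] and pP = R.maximalideal_prime[OF P]
  have PP: "ideal (P \<cdot> P) A" "P \<cdot> P \<subseteq> P" using iP R.ideal_prod_is_ideal R.ideal_prod_inter[OF iP iP] by auto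
  have "proper_ideal (P \<cdot> P) A" using PP R.maximalideal_proper[OF P] by (auto simp: R.proper_ideal_one)
  then obtain Ps where Ps: "Ps \<noteq> []" "\<And>Q. Q \<in> set Ps \<Longrightarrow> primeideal Q A"
    "full (P \<cdot> P) = ideal_list_prod (A \<propto> E) (map full Ps)"
    using ZPI_factorization[OF full_proper] by metis
  have idl: "ideal L (A \<propto> E)" if "L \<in> set (map full Ps)" for L
    using that Ps(2) R.primeideal_is_ideal full_ideal by auto
  have eq: "Q = P" if Q: "Q \<in> set Ps" for Q
  proof -
    have "full (P \<cdot> P) \<subseteq> full Q" using T.ideal_list_prod_subset[of "map full Ps" "full Q", OF idl] Q Ps(3) by auto
    then have "P \<cdot> P \<subseteq> Q" using M.zero_closed by blast
    then have "P \<subseteq> Q" using R.primeideal_divides_ideal_prod[OF Ps(2)[OF Q] iP iP] by blast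
    then show ?thesis using R.maximalideal_eqI[OF P R.primeideal_proper[OF Ps(2)[OF Q]]] by blast
  qed
  obtain rest where rest: "Ps = P # rest" using Ps(1) eq by (cases Ps) auto
  show ?thesis
  proof (cases rest)
    case Nil
    then have "full (P \<cdot> P) = full P" using Ps(3) rest T.ideal_prod_one[OF full_ideal[OF iP]] by simp
    then have "P \<cdot> P = P" by (metis fst_full)
    then show ?thesis by blast
  next
    case (Cons Q r)
    then have "Q = P" using eq rest by simp
    then have "ideal_list_prod (A \<propto> E) (map full rest) \<subseteq> full P"
      using T.ideal_list_prod_subset[of "map full rest" "full P"] idl rest Cons by auto
    then have "full (P \<cdot> P) \<subseteq> full P \<cdot>\<^bsub>A \<propto> E\<^esub> full P"
      using Ps(3) rest T.ideal_prod_mono[of "full P" "full P"] by simp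
    then have "carrier E \<subseteq> IE P"
      using R.ideal_zero[OF PP(1)] unfolding full_square[OF iP] by blast
    then show ?thesis using IE_carrier[OF R.ideal_subset[OF iP]] by blast
  qed
qed

text \<open>Expresses that \<open>E/QE\<close> is simple or zero; the proof factors the ideal \<open>Q \<propto> (QE + Ax)\<close>.\<close>

lemma ZPI_quotient_simple:
  assumes Q: "primeideal Q A" and above: "\<And>P. \<lbrakk>primeideal P A; Q \<subset> P\<rbrakk> \<Longrightarrow> IE P = carrier E"
    and x: "x \<in> carrier E" "x \<notin> IE Q" and z: "z \<in> carrier E"
  shows "\<exists>y \<in> IE Q. \<exists>a \<in> carrier A. z = y \<oplus>\<^bsub>E\<^esub> a \<odot>\<^bsub>E\<^esub> x"
proof -
  note iQ = R.primeideal_is_ideal[OF Q]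
  note QEc = subsetD[OF IE_carrier[OF R.ideal_subset[OF iQ]]]
  define F where "F = {y \<oplus>\<^bsub>E\<^esub> a \<odot>\<^bsub>E\<^esub> x | y a. y \<in> IE Q \<and> a \<in> carrier A}"
  have QF: "y \<in> F" if "y \<in> IE Q" for y
    unfolding F_def using that QEc x by (force intro: exI[of _ y] exI[of _ \<zero>])
  have xF: "x \<in> F" unfolding F_def using IE_zero[OF iQ] x by (force intro: exI[of _ \<one>])
  have iK: "ideal (Q \<times> F) (A \<propto> E)"
  proof (rule Times_ideal[OF iQ])
    show "F \<subseteq> carrier E" unfolding F_def using QEc x by auto
    show "\<zero>\<^bsub>E\<^esub> \<in> F" using QF IE_zero[OF iQ] by blast
    show "k \<odot>\<^bsub>E\<^esub> u \<in> F" if "k \<in> Q" "u \<in> carrier E" for k u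
      using QF ideal_smult.smult[OF that] by blast
    show "u \<oplus>\<^bsub>E\<^esub> v \<in> F" if uv: "u \<in> F" "v \<in> F" for u v
    proof -
      obtain y a y' a' where 1: "y \<in> IE Q" "a \<in> carrier A" "u = y \<oplus>\<^bsub>E\<^esub> a \<odot>\<^bsub>E\<^esub> x"
        "y' \<in> IE Q" "a' \<in> carrier A" "v = y' \<oplus>\<^bsub>E\<^esub> a' \<odot>\<^bsub>E\<^esub> x"
        using uv unfolding F_def by blast
      have "u \<oplus>\<^bsub>E\<^esub> v = (y \<oplus>\<^bsub>E\<^esub> y') \<oplus>\<^bsub>E\<^esub> (a \<oplus> a') \<odot>\<^bsub>E\<^esub> x"
        using 1 QEc x by (simp add: smult_l_distr M.a_ac)
      then show ?thesis unfolding F_def using 1 ideal_smult.sum[of y Q E y'] by blast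
    qed
    show "b \<odot>\<^bsub>E\<^esub> u \<in> F" if b: "b \<in> carrier A" and u: "u \<in> F" for b u
    proof -
      obtain y a where 1: "y \<in> IE Q" "a \<in> carrier A" "u = y \<oplus>\<^bsub>E\<^esub> a \<odot>\<^bsub>E\<^esub> x"
        using u unfolding F_def by blast
      have "b \<odot>\<^bsub>E\<^esub> u = b \<odot>\<^bsub>E\<^esub> y \<oplus>\<^bsub>E\<^esub> (b \<otimes> a) \<odot>\<^bsub>E\<^esub> x"
        using 1 QEc x b by (simp add: smult_r_distr smult_assoc1)
      then show ?thesis unfolding F_def using 1 b IE_smult[OF iQ b 1(1)] by blast
    qed
  qed
  have "\<one> \<notin> Q" using R.primeideal_proper[OF Q] by (simp add: R.proper_ideal_one)
  then have "proper_ideal (Q \<times> F) (A \<propto> E)" using iK by (auto simp: T.proper_ideal_one)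
  then obtain Ps where Ps: "\<And>P. P \<in> set Ps \<Longrightarrow> primeideal P A"
    "Q \<times> F = ideal_list_prod (A \<propto> E) (map full Ps)" using ZPI_factorization by metis
  have idl: "ideal L (A \<propto> E)" if "L \<in> set (map full Ps)" for L
    using that Ps(1) R.primeideal_is_ideal full_ideal by auto
  have sup: "Q \<subseteq> P" if P: "P \<in> set Ps" for P
    using T.ideal_list_prod_subset[of "map full Ps" "full P", OF idl] P Ps(2) xF by auto
  have "Q \<times> F \<subseteq> full Q" using ideal.Icarr[OF iK] by auto
  then obtain L where L: "L \<in> set (map full Ps)" "L \<subseteq> full Q"
    using T.primeideal_ideal_list_prod[OF primeideal_full[OF Q] idl] Ps(2) by metis
  then obtain P where "P \<in> set Ps" "full P \<subseteq> full Q" by auto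
  \<comment> \<open>Every factor lies above \<open>Q\<close> and one lies below, so
    \<open>full Q\<close> occurs among the factors.\<close>
  then have "P = Q" using sup[of P] M.zero_closed by blast
  then have "full Q \<in> set (map full Ps)" using \<open>P \<in> set Ps\<close> by auto
  then obtain Js where Js: "set Js \<subseteq> set (map full Ps)"
    "ideal_list_prod (A \<propto> E) (map full Ps) = full Q \<cdot>\<^bsub>A \<propto> E\<^esub> ideal_list_prod (A \<propto> E) Js"
    using T.ideal_list_prod_split[OF idl] by metis
  have idJ: "ideal J (A \<propto> E)" if "J \<in> set Js" for J using that Js(1) idl by blast
  \<comment> \<open>A second occurrence would force \<open>F \<subseteq> IE Q\<close>, against
    \<open>x \<in> F\<close>.\<close>
  have "full Q \<notin> set Js"
  proof
    assume "full Q \<in> set Js"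
    then have "ideal_list_prod (A \<propto> E) Js \<subseteq> full Q" by (intro T.ideal_list_prod_subset idJ)
    then have "Q \<times> F \<subseteq> full Q \<cdot>\<^bsub>A \<propto> E\<^esub> full Q"
      using Ps(2) Js(2) T.ideal_prod_mono[of "full Q" "full Q"] by simp
    then show False using xF x R.ideal_zero[OF iQ] unfolding full_square[OF iQ] by blast
  qed
  have "\<forall>J \<in> set Js. \<exists>P \<in> set Ps. J = full P" using Js(1) by auto
  then obtain g where g: "\<And>J. J \<in> set Js \<Longrightarrow> g J \<in> set Ps \<and> J = full (g J)" by metis
  have mapg: "map full (map g Js) = Js" using g by (simp add: map_idI)
  \<comment> \<open>The remaining factors are strictly above \<open>Q\<close> and leave
    \<open>Z\<close> unchanged, so all of \<open>Z\<close> survives in the product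
    \<open>Q \<times> F\<close>, that is, \<open>F\<close> is all of \<open>E\<close>.\<close>
  have "ideal P A \<and> IE P = carrier E" if gJ: "P \<in> set (map g Js)" for P
  proof -
    obtain J where J: "J \<in> set Js" "P = g J" using gJ by auto
    then have P: "P \<in> set Ps" "J = full P" using g by auto
    then have "P \<noteq> Q" using \<open>full Q \<notin> set Js\<close> J by blast
    then show ?thesis
      using above[OF Ps(1)[OF P(1)]] sup[OF P(1)] R.primeideal_is_ideal[OF Ps(1)[OF P(1)]] by blast
  qed
  then have "Z \<subseteq> Z \<cdot>\<^bsub>A \<propto> E\<^esub> ideal_list_prod (A \<propto> E) Js"
    using Z_subset_Z_prod_list[of "map g Js"] mapg by simp
  also have "\<dots> \<subseteq> full Q \<cdot>\<^bsub>A \<propto> E\<^esub> ideal_list_prod (A \<propto> E) Js"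
    using R.ideal_zero[OF iQ] by (intro T.ideal_prod_mono) auto
  finally have "carrier E \<subseteq> F" using Ps(2) Js(2) by blast
  then show ?thesis using z unfolding F_def by blast
qed

text \<open>Suppose \<open>Q\<close> violates both alternatives; then it is not maximal. A prime
  strictly above \<open>Q\<close> is maximal by minimality of nonmaximal primes and not idempotent
  because \<open>Q\<close> lies below it, so it multiplies \<open>E\<close> onto itself. Hence E/QE
  is simple and its annihilator \<open>L\<close> is maximal, strictly above \<open>Q\<close>. Then
  LE = E, while LE is contained in QE.\<close>

lemma ZPI_prime_cases:
  assumes Q: "primeideal Q A"
  shows "IE Q = carrier E \<or> maximalideal Q A \<and> Q \<cdot> Q = Q"
proof (rule ccontr)
  assume no: "\<not> ?thesis"
  note iQ = R.primeideal_is_ideal[OF Q]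
  have QEc: "IE Q \<subseteq> carrier E" using IE_carrier[OF R.ideal_subset[OF iQ]] .
  have nm: "\<not> maximalideal Q A" using no ZPI_maximal_cases by blast
  obtain x where x: "x \<in> carrier E" "x \<notin> IE Q" using no QEc by blast
  have above: "IE P = carrier E" if P: "primeideal P A" "Q \<subset> P" for P
  proof -
    obtain M where M: "maximalideal M A" "P \<subseteq> M"
      using R.exists_maximalideal[OF R.primeideal_proper[OF P(1)]] .
    have "P = M"
      using R.OAF_nonmaximal_prime_minimal[OF R.general_ZPI_imp_OAF[OF ZPI_base] M(1) P(1) _ Q] M(2) P(2)
      by blast
    then show ?thesis
      using R.general_ZPI_idempotent_maximal_minimal[OF ZPI_base _ _ Q] ZPI_maximal_cases[OF M(1)] M P
      by blast
  qed
  have simple: "\<exists>y \<in> IE Q. \<exists>a \<in> carrier A. v = y \<oplus>\<^bsub>E\<^esub> a \<odot>\<^bsub>E\<^esub> u"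
    if "u \<in> carrier E" "u \<notin> IE Q" "v \<in> carrier E" for u v
    using ZPI_quotient_simple[OF Q _ that] above by blast
  define L where "L = {a \<in> carrier A. a \<odot>\<^bsub>E\<^esub> x \<in> IE Q}"
  have iL: "ideal L A"
  proof (rule R.idealI')
    show "\<zero> \<in> L" using x IE_zero[OF iQ] by (simp add: L_def)
    show "a \<oplus> b \<in> L" if "a \<in> L" "b \<in> L" for a b
      using that x by (auto simp: L_def smult_l_distr intro: ideal_smult.sum)
    show "r \<otimes> a \<in> L" if "a \<in> L" "r \<in> carrier A" for a r
      using that x by (auto simp: L_def smult_assoc1 intro: IE_smult[OF iQ])
  qed (auto simp: L_def)
  have pL: "proper_ideal L A" using iL x by (simp add: R.proper_ideal_one L_def)
  have mL: "maximalideal L A"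
  proof (rule R.maximalidealI_witness[OF pL])
    fix r assume r: "r \<in> carrier A" "r \<notin> L"
    then have "r \<odot>\<^bsub>E\<^esub> x \<notin> IE Q" by (simp add: L_def)
    then obtain y a where ya: "y \<in> IE Q" "a \<in> carrier A" "x = y \<oplus>\<^bsub>E\<^esub> a \<odot>\<^bsub>E\<^esub> (r \<odot>\<^bsub>E\<^esub> x)"
      using simple[of "r \<odot>\<^bsub>E\<^esub> x" x] r x by auto
    have yc: "y \<in> carrier E" using ya QEc by blast
    have "(\<one> \<ominus> a \<otimes> r) \<odot>\<^bsub>E\<^esub> x = x \<ominus>\<^bsub>E\<^esub> a \<odot>\<^bsub>E\<^esub> (r \<odot>\<^bsub>E\<^esub> x)"
      using ya(2) r x by (simp add: a_minus_def smult_l_distr smult_l_minus smult_assoc1)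
    also have "\<dots> = y" using ya x r yc
      by (metis M.add.inv_solve_right M.add.m_closed a_minus_def smult_closed)
    finally have "\<one> \<ominus> a \<otimes> r \<in> L" using ya r by (simp add: L_def)
    moreover have "\<one> = a \<otimes> r \<oplus> (\<one> \<ominus> a \<otimes> r)" using ya(2) r(1) by algebra
    ultimately show "\<exists>s \<in> carrier A. \<exists>m \<in> L. \<one> = s \<otimes> r \<oplus> m" using ya(2) by blast
  qed
  have "Q \<subseteq> L" using ideal.Icarr[OF iQ] x by (auto simp: L_def intro: ideal_smult.smult)
  then have "Q \<subset> L" using nm mL by blast
  then have LE: "IE L = carrier E" using above[OF R.maximalideal_prime[OF mL]] by blast
  have "w \<in> IE Q" if "w \<in> IE L" for w
    using that
  proof induct
    case (smult l w)
    obtain y b where yb: "y \<in> IE Q" "b \<in> carrier A" "w = y \<oplus>\<^bsub>E\<^esub> b \<odot>\<^bsub>E\<^esub> x"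
      using simple[OF x smult(2)] by blast
    have l: "l \<in> carrier A" "l \<odot>\<^bsub>E\<^esub> x \<in> IE Q" using smult(1) by (auto simp: L_def)
    have "l \<odot>\<^bsub>E\<^esub> w = l \<odot>\<^bsub>E\<^esub> y \<oplus>\<^bsub>E\<^esub> b \<odot>\<^bsub>E\<^esub> (l \<odot>\<^bsub>E\<^esub> x)"
      using yb l x QEc by (auto simp: smult_r_distr smult_assoc1[symmetric] R.m_comm)
    then show ?case using IE_smult[OF iQ] yb l by (auto intro: ideal_smult.sum)
  qed (rule ideal_smult.sum)
  then show False using LE x by blast
qed

lemma annihilator_ideal: "ideal (annihilator A E) A"
  by (rule R.idealI') (auto simp: annihilator_def smult_l_distr smult_assoc1)

text \<open>The list \<open>S\<close> keeps the idempotent maximal factors; the others multiply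
  \<open>E\<close> onto itself and are absorbed by \<open>Z\<close>. For a factorization of zero the
  conclusion says that the product of \<open>S\<close> kills \<open>E\<close>.\<close>

lemma ZPI_list_annihilates:
  assumes "\<And>P. P \<in> set Ps \<Longrightarrow> primeideal P A"
  shows "\<exists>S. (\<forall>P \<in> set S. maximalideal P A \<and> idempotent_ideal P A) \<and>
    (\<forall>s \<in> ideal_list_prod A S. \<forall>x \<in> carrier E.
      (\<zero>, s \<odot>\<^bsub>E\<^esub> x) \<in> Z \<cdot>\<^bsub>A \<propto> E\<^esub> ideal_list_prod (A \<propto> E) (map full Ps))"
  using assms
proof (induct Ps)
  case Nil
  show ?case using T.ideal_prod_one[OF Z_ideal] by (intro exI[of _ "[]"]) auto
next
  case (Cons P Ps)
  let ?L = "ideal_list_prod (A \<propto> E) (map full Ps)"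
  obtain S where S: "\<And>Q. Q \<in> set S \<Longrightarrow> maximalideal Q A \<and> idempotent_ideal Q A"
    "\<And>s x. \<lbrakk>s \<in> ideal_list_prod A S; x \<in> carrier E\<rbrakk> \<Longrightarrow> (\<zero>, s \<odot>\<^bsub>E\<^esub> x) \<in> Z \<cdot>\<^bsub>A \<propto> E\<^esub> ?L"
    using Cons by (metis list.set_intros(2))
  have P: "primeideal P A" "ideal P A" using Cons(2) R.primeideal_is_ideal by auto
  have L: "ideal ?L (A \<propto> E)"
    using Cons(2) R.primeideal_is_ideal by (auto intro!: T.ideal_list_prod_ideal full_ideal)
  have iS: "ideal (ideal_list_prod A S) A"
    using S(1) R.maximalideal_is_ideal by (auto intro!: R.ideal_list_prod_ideal)
  note Sc = ideal.Icarr[OF iS]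
  have com: "full P \<cdot>\<^bsub>A \<propto> E\<^esub> (Z \<cdot>\<^bsub>A \<propto> E\<^esub> ?L) = Z \<cdot>\<^bsub>A \<propto> E\<^esub> (full P \<cdot>\<^bsub>A \<propto> E\<^esub> ?L)"
    using full_ideal[OF P(2)] Z_ideal L by (metis T.ideal_prod_assoc T.ideal_prod_commute)
  show ?case
  proof (cases "IE P = carrier E")
    case True
    have "Z \<cdot>\<^bsub>A \<propto> E\<^esub> ?L \<subseteq> (Z \<cdot>\<^bsub>A \<propto> E\<^esub> full P) \<cdot>\<^bsub>A \<propto> E\<^esub> ?L"
      using Z_subset_Z_prod_full[OF P(2) True] by (rule T.ideal_prod_mono) simp
    then have "Z \<cdot>\<^bsub>A \<propto> E\<^esub> ?L \<subseteq> Z \<cdot>\<^bsub>A \<propto> E\<^esub> (full P \<cdot>\<^bsub>A \<propto> E\<^esub> ?L)"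
      using T.ideal_prod_assoc[OF Z_ideal full_ideal[OF P(2)] L] by simp
    then show ?thesis using S by (intro exI[of _ S]) auto
  next
    case False
    then have idem: "maximalideal P A" "idempotent_ideal P A"
      using ZPI_prime_cases[OF P(1)] P(2) by (auto simp: idempotent_ideal_def)
    have "(\<zero>, s \<odot>\<^bsub>E\<^esub> x) \<in> full P \<cdot>\<^bsub>A \<propto> E\<^esub> (Z \<cdot>\<^bsub>A \<propto> E\<^esub> ?L)"
      if "s \<in> P \<cdot> ideal_list_prod A S" "x \<in> carrier E" for s x
      using that(1)
    proof induct
      case (prod p t)
      have "(p, \<zero>\<^bsub>E\<^esub>) \<otimes>\<^bsub>A \<propto> E\<^esub> (\<zero>, t \<odot>\<^bsub>E\<^esub> x) \<in> full P \<cdot>\<^bsub>A \<propto> E\<^esub> (Z \<cdot>\<^bsub>A \<propto> E\<^esub> ?L)"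
        using prod S(2) that(2) by (intro ideal_prod.prod) auto
      then show ?case using prod that(2) Sc ideal.Icarr[OF P(2)] by (simp add: smult_assoc1)
    next
      case (sum s t)
      have "s \<in> carrier A" "t \<in> carrier A" using sum R.ideal_prod_in_carrier[OF P(2) iS] by auto
      then show ?case using ideal_prod.sum[OF sum(2,4)] that(2) by (simp add: smult_l_distr)
    qed
    then show ?thesis using S(1) idem com by (intro exI[of _ "P # S"]) auto
  qed
qed

text \<open>The annihilator contains a product of idempotent maximal ideals, obtained by factoring
  zero. Each prime factor of the annihilator then contains one of these ideals and equals it by
  maximality. For zero \<open>E\<close> the list is empty.\<close>

lemma ZPI_annihilator:
  assumes "\<one> \<noteq> \<zero>"
  shows "\<exists>S. (\<forall>P \<in> set S. maximalideal P A \<and> idempotent_ideal P A) \<and>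
    annihilator A E = ideal_list_prod A S"
proof -
  have "proper_ideal {\<zero>\<^bsub>A \<propto> E\<^esub>} (A \<propto> E)" using assms T.zeroideal by (auto simp: T.proper_ideal_one)
  then obtain Ps where Ps: "\<And>P. P \<in> set Ps \<Longrightarrow> primeideal P A"
    "{\<zero>\<^bsub>A \<propto> E\<^esub>} = ideal_list_prod (A \<propto> E) (map full Ps)" using ZPI_factorization by metis
  obtain S where S: "\<And>P. P \<in> set S \<Longrightarrow> maximalideal P A \<and> idempotent_ideal P A"
    "\<And>s x. \<lbrakk>s \<in> ideal_list_prod A S; x \<in> carrier E\<rbrakk> \<Longrightarrow> (\<zero>, s \<odot>\<^bsub>E\<^esub> x) \<in> Z \<cdot>\<^bsub>A \<propto> E\<^esub> {\<zero>\<^bsub>A \<propto> E\<^esub>}"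
    using ZPI_list_annihilates[of Ps] Ps by metis
  have idS: "ideal P A" if "P \<in> set S" for P using S(1)[OF that] R.maximalideal_is_ideal by blast
  have sub: "ideal_list_prod A S \<subseteq> annihilator A E"
    using S(2) R.ideal_subset[OF R.ideal_list_prod_ideal[OF idS]] T.ideal_prod_zero[OF Z_ideal]
    by (auto simp: annihilator_def)
  show ?thesis
  proof (cases "annihilator A E = carrier A")
    case True
    then show ?thesis by (intro exI[of _ "[]"]) simp
  next
    case False
    then have "proper_ideal (annihilator A E) A" using annihilator_ideal by (simp add: proper_ideal_def)
    then obtain Qs where Qs: "\<And>Q. Q \<in> set Qs \<Longrightarrow> primeideal Q A" "\<And>Q. Q \<in> set Qs \<Longrightarrow> ideal Q A"
      "annihilator A E = ideal_list_prod A Qs" using R.general_ZPI_ringE[OF ZPI_base] by metis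
    have "maximalideal Q A \<and> idempotent_ideal Q A" if Q: "Q \<in> set Qs" for Q
    proof -
      have "ideal_list_prod A S \<subseteq> Q" using sub R.ideal_list_prod_subset[OF Qs(2) Q] Qs(3) by blast
      then obtain P where P: "P \<in> set S" "P \<subseteq> Q"
        using R.primeideal_ideal_list_prod[OF Qs(1)[OF Q] idS] by blast
      then have "Q = P" using R.maximalideal_eqI S(1) R.primeideal_proper[OF Qs(1)[OF Q]] by blast
      then show ?thesis using S(1) P by blast
    qed
    then show ?thesis using Qs(3) by blast
  qed
qed

text \<open>Chinese remaindering with the idempotent \<open>e\<close> generating \<open>P\<close>
  and \<open>f = 1 - e\<close>: here \<open>f\<close> kills PE, while \<open>e\<close> maps LE into
  PLE, where \<open>L\<close> is the product of the rest of the list.\<close>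

lemma ZPI_cyclic_modulo:
  assumes "\<And>P. P \<in> set S \<Longrightarrow> maximalideal P A \<and> idempotent_ideal P A"
  shows "\<exists>y \<in> carrier E. \<forall>z \<in> carrier E. \<exists>w \<in> IE (ideal_list_prod A S). \<exists>a \<in> carrier A.
    z = w \<oplus>\<^bsub>E\<^esub> a \<odot>\<^bsub>E\<^esub> y"
  using assms
proof (induct S)
  case Nil
  have "z \<in> IE (carrier A)" if "z \<in> carrier E" for z
    using ideal_smult.smult[of \<one> "carrier A" z E] that by simp
  then have all: "\<exists>w \<in> IE (carrier A). \<exists>a \<in> carrier A. z = w \<oplus>\<^bsub>E\<^esub> a \<odot>\<^bsub>E\<^esub> \<zero>\<^bsub>E\<^esub>"
    if "z \<in> carrier E" for z
    using that by (intro bexI[of _ z] bexI[of _ \<zero>]) auto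
  show ?case unfolding R.ideal_list_prod_Nil 
    by (rule bexI[OF _ M.zero_closed], rule ballI, rule all)
next
  case (Cons P S)
  let ?L = "ideal_list_prod A S"
  obtain y where y: "y \<in> carrier E"
    "\<And>z. z \<in> carrier E \<Longrightarrow> \<exists>w \<in> IE ?L. \<exists>a \<in> carrier A. z = w \<oplus>\<^bsub>E\<^esub> a \<odot>\<^bsub>E\<^esub> y"
    using Cons by (metis list.set_intros(2))
  have mP: "maximalideal P A" "P \<cdot> P = P" using Cons(2) by (auto simp: idempotent_ideal_def)
  note iP = R.maximalideal_is_ideal[OF mP(1)]
  have iL: "ideal ?L A" using Cons(2) R.maximalideal_is_ideal by (auto intro!: R.ideal_list_prod_ideal)
  obtain e where e: "e \<in> carrier A" "e \<otimes> e = e" "P = PIdl\<^bsub>A\<^esub> e"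
    using R.general_ZPI_idempotent_maximal_generator[OF ZPI_base mP] by blast
  have eP: "e \<in> P" using e R.cgenideal_self by blast
  have PEc: "IE P \<subseteq> carrier E" using IE_carrier[OF R.ideal_subset[OF iP]] .
  have LEc: "IE ?L \<subseteq> carrier E" using IE_carrier[OF R.ideal_subset[OF iL]] .
  have noabove: "IE Q = carrier E" if "primeideal Q A" "P \<subset> Q" for Q
    using R.maximalideal_eqI[OF mP(1) R.primeideal_proper[OF that(1)]] that by blast
  obtain x where x: "x \<in> carrier E"
    "\<And>z. z \<in> carrier E \<Longrightarrow> \<exists>w \<in> IE P. \<exists>a \<in> carrier A. z = w \<oplus>\<^bsub>E\<^esub> a \<odot>\<^bsub>E\<^esub> x"
  proof (cases "IE P = carrier E")
    case True
    have "\<exists>w \<in> IE P. \<exists>a \<in> carrier A. z = w \<oplus>\<^bsub>E\<^esub> a \<odot>\<^bsub>E\<^esub> \<zero>\<^bsub>E\<^esub>" if "z \<in> carrier E" for z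
      using that True by (intro bexI[of _ z] bexI[of _ \<zero>]) auto
    then show ?thesis using that[of "\<zero>\<^bsub>E\<^esub>"] by blast
  next
    case False
    then obtain x where "x \<in> carrier E" "x \<notin> IE P" using PEc by blast
    then show ?thesis
      using that[of x] ZPI_quotient_simple[OF R.maximalideal_prime[OF mP(1)] noabove] by blast
  qed
  define f where "f = \<one> \<ominus> e"
  have f: "f \<in> carrier A" "e \<oplus> f = \<one>" "f \<otimes> e = \<zero>" "e \<otimes> f = \<zero>" "f \<otimes> f = f"
  proof -
    show "f \<in> carrier A" using e by (simp add: f_def)
    show "e \<oplus> f = \<one>" unfolding f_def using e(1) by algebra
    have "f \<otimes> e = e \<ominus> e \<otimes> e" unfolding f_def using e(1) by algebra
    then show fe: "f \<otimes> e = \<zero>" using e by (simp add: a_minus_def R.r_neg)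
    then show "e \<otimes> f = \<zero>" using e(1) \<open>f \<in> carrier A\<close> by (simp add: R.m_comm)
    have "f \<otimes> f = f \<ominus> f \<otimes> e" unfolding f_def using e(1) by algebra
    then show "f \<otimes> f = f" using fe \<open>f \<in> carrier A\<close> by (simp add: a_minus_def)
  qed
  have fPE: "f \<odot>\<^bsub>E\<^esub> w = \<zero>\<^bsub>E\<^esub>" if "w \<in> IE P" for w
    using that
  proof induct
    case (smult p w)
    then obtain r where r: "r \<in> carrier A" "p = r \<otimes> e" unfolding e(3) R.mem_cgenideal by blast
    have "f \<otimes> (r \<otimes> e) = r \<otimes> (f \<otimes> e)" using r(1) f(1) e(1) by algebra
    then show ?case using smult r f e by (simp add: smult_assoc1[symmetric])
  next
    case (sum w w')
    then have "w \<in> carrier E" "w' \<in> carrier E" using PEc by auto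
    then show ?case using sum(2,4) f(1) by (simp add: smult_r_distr)
  qed
  have eLE: "e \<odot>\<^bsub>E\<^esub> w \<in> IE (P \<cdot> ?L)" if "w \<in> IE ?L" for w
    using that
  proof induct
    case (smult s w)
    have "e \<odot>\<^bsub>E\<^esub> (s \<odot>\<^bsub>E\<^esub> w) = (e \<otimes> s) \<odot>\<^bsub>E\<^esub> w"
      using smult e ideal.Icarr[OF iL] by (simp add: smult_assoc1)
    then show ?case using smult eP by (simp add: ideal_smult.smult ideal_prod.prod)
  next
    case (sum w w')
    then have "w \<in> carrier E" "w' \<in> carrier E" using LEc by auto
    then show ?case using sum(2,4) e(1) by (simp add: smult_r_distr ideal_smult.sum)
  qed
  \<comment> \<open>Chosen so that \<open>e y' = e y\<close> and \<open>f y' = f x\<close>; the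
    coefficient \<open>e a + f b\<close> then reproduces \<open>e z\<close> up to \<open>e w\<close>
    and \<open>f z\<close> exactly.\<close>
  define y' where "y' = e \<odot>\<^bsub>E\<^esub> y \<oplus>\<^bsub>E\<^esub> f \<odot>\<^bsub>E\<^esub> x"
  have "\<exists>w \<in> IE (P \<cdot> ?L). \<exists>a \<in> carrier A. z = w \<oplus>\<^bsub>E\<^esub> a \<odot>\<^bsub>E\<^esub> y'" if z: "z \<in> carrier E" for z
  proof -
    obtain w a where w: "w \<in> IE ?L" "a \<in> carrier A" "z = w \<oplus>\<^bsub>E\<^esub> a \<odot>\<^bsub>E\<^esub> y" using y(2)[OF z] by blast
    obtain v b where v: "v \<in> IE P" "b \<in> carrier A" "z = v \<oplus>\<^bsub>E\<^esub> b \<odot>\<^bsub>E\<^esub> x" using x(2)[OF z] by blast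
    have c: "w \<in> carrier E" "v \<in> carrier E" using w v PEc LEc by auto
    have "(e \<otimes> a \<oplus> f \<otimes> b) \<otimes> e = a \<otimes> (e \<otimes> e) \<oplus> b \<otimes> (f \<otimes> e)"
      "(e \<otimes> a \<oplus> f \<otimes> b) \<otimes> f = a \<otimes> (e \<otimes> f) \<oplus> b \<otimes> (f \<otimes> f)"
      using e(1) f(1) w(2) v(2) by algebra+
    then have s: "(e \<otimes> a \<oplus> f \<otimes> b) \<otimes> e = e \<otimes> a" "(e \<otimes> a \<oplus> f \<otimes> b) \<otimes> f = f \<otimes> b"
      using e(1,2) f w(2) v(2) by (simp_all add: R.m_comm)
    have "z = (e \<oplus> f) \<odot>\<^bsub>E\<^esub> z" using z f by simp
    also have "\<dots> = e \<odot>\<^bsub>E\<^esub> z \<oplus>\<^bsub>E\<^esub> f \<odot>\<^bsub>E\<^esub> z" by (rule smult_l_distr[OF e(1) f(1) z])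
    also have "e \<odot>\<^bsub>E\<^esub> z = e \<odot>\<^bsub>E\<^esub> w \<oplus>\<^bsub>E\<^esub> (e \<otimes> a) \<odot>\<^bsub>E\<^esub> y"
      using w y(1) e c by (simp add: smult_r_distr smult_assoc1)
    also have "f \<odot>\<^bsub>E\<^esub> z = (f \<otimes> b) \<odot>\<^bsub>E\<^esub> x"
      unfolding v(3) using v(1,2) x(1) f(1) c fPE[OF v(1)] by (simp add: smult_r_distr smult_assoc1)
    also have "(e \<odot>\<^bsub>E\<^esub> w \<oplus>\<^bsub>E\<^esub> (e \<otimes> a) \<odot>\<^bsub>E\<^esub> y) \<oplus>\<^bsub>E\<^esub> (f \<otimes> b) \<odot>\<^bsub>E\<^esub> x =
        e \<odot>\<^bsub>E\<^esub> w \<oplus>\<^bsub>E\<^esub> (e \<otimes> a \<oplus> f \<otimes> b) \<odot>\<^bsub>E\<^esub> y'"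
      unfolding y'_def using e(1) f(1) c x(1) y(1) w(2) v(2) s
      by (simp add: smult_r_distr smult_assoc1[symmetric] M.a_assoc)
    finally show ?thesis using eLE[OF w(1)] e(1) f(1) w(2) v(2) by blast
  qed
  moreover have "y' \<in> carrier E" using e f x y by (simp add: y'_def)
  ultimately show ?case by auto
qed

theorem ZPI_imp:
  assumes "\<one> \<noteq> \<zero>"
  shows "general_ZPI_ring A" "cyclic_module A E"
    "\<exists>S. (\<forall>P \<in> set S. maximalideal P A \<and> idempotent_ideal P A) \<and>
      annihilator A E = ideal_list_prod A S"
proof -
  show "general_ZPI_ring A" by (rule ZPI_base)
  show ann: "\<exists>S. (\<forall>P \<in> set S. maximalideal P A \<and> idempotent_ideal P A) \<and>
      annihilator A E = ideal_list_prod A S" using ZPI_annihilator[OF assms] .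
  then obtain S where S: "\<And>P. P \<in> set S \<Longrightarrow> maximalideal P A \<and> idempotent_ideal P A"
    "annihilator A E = ideal_list_prod A S" by blast
  obtain y where y: "y \<in> carrier E" "\<And>z. z \<in> carrier E \<Longrightarrow>
      \<exists>w \<in> IE (annihilator A E). \<exists>a \<in> carrier A. z = w \<oplus>\<^bsub>E\<^esub> a \<odot>\<^bsub>E\<^esub> y"
    using ZPI_cyclic_modulo[OF S(1)] S(2) by metis
  have "w = \<zero>\<^bsub>E\<^esub>" if "w \<in> IE (annihilator A E)" for w
    using that by induct (auto simp: annihilator_def)
  then have "\<exists>a \<in> carrier A. z = a \<odot>\<^bsub>E\<^esub> y" if "z \<in> carrier E" for z
    using y(2)[OF that] y(1) by fastforce
  then have "carrier E = {a \<odot>\<^bsub>E\<^esub> y | a. a \<in> carrier A}" using y(1) by blast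
  then show "cyclic_module A E" unfolding cyclic_module_def using y(1) by blast
qed

end

section \<open>Prime factorizations obtained by splitting off idempotents\<close>

text \<open>The empty product is allowed, so the whole ring is a product of primes.\<close>

definition prime_product :: "('a \<times> 'c) set \<Rightarrow> bool" where
  "prime_product J \<longleftrightarrow> (\<exists>Ps. (\<forall>P \<in> set Ps. primeideal P (A \<propto> E)) \<and> J = ideal_list_prod (A \<propto> E) Ps)"

lemma prime_product_prod:
  assumes "prime_product I" "prime_product J"
  shows "prime_product (I \<cdot>\<^bsub>A \<propto> E\<^esub> J)"
proof -
  obtain Ps where Ps: "\<forall>P \<in> set Ps. primeideal P (A \<propto> E)" "I = ideal_list_prod (A \<propto> E) Ps"
    using assms(1) unfolding prime_product_def by blast
  obtain Qs where Qs: "\<forall>Q \<in> set Qs. primeideal Q (A \<propto> E)" "J = ideal_list_prod (A \<propto> E) Qs"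
    using assms(2) unfolding prime_product_def by blast
  have primes: "\<forall>P \<in> set (Ps @ Qs). primeideal P (A \<propto> E)" using Ps Qs by auto
  then have "ideal_list_prod (A \<propto> E) (Ps @ Qs) = I \<cdot>\<^bsub>A \<propto> E\<^esub> J"
    unfolding Ps(2) Qs(2) by (intro T.ideal_list_prod_append) (blast intro: T.primeideal_is_ideal)
  then show ?thesis using primes unfolding prime_product_def by metis
qed

lemma prime_product_prime: "primeideal P (A \<propto> E) \<Longrightarrow> prime_product P"
  unfolding prime_product_def
  by (intro exI[of _ "[P]"])
    (simp add: T.ideal_prod_one[OF T.primeideal_is_ideal] del: trivial_extension_simps)

lemma prime_product_carrier: "prime_product (carrier (A \<propto> E))"
  unfolding prime_product_def by (intro exI[of _ "[]"]) (simp add: ideal_list_prod_def)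

text \<open>Modulo \<open>(e, 0)\<close> the ring becomes \<open>k \<propto> k\<close> or \<open>k\<close> with \<open>k = A/P\<close>, so \<open>J\<close> is the whole ring,
  \<open>P \<propto> E\<close> or its square.\<close>

lemma prime_product_over_idempotent:
  assumes P: "maximalideal P A" and e: "e \<in> carrier A" "e \<otimes> e = e" "P = PIdl\<^bsub>A\<^esub> e"
    and x0: "x0 \<in> carrier E" "carrier E = {a \<odot>\<^bsub>E\<^esub> x0 | a. a \<in> carrier A}"
    and J: "ideal J (A \<propto> E)" "(e, \<zero>\<^bsub>E\<^esub>) \<in> J"
  shows "prime_product J"
proof -
  note iP = R.maximalideal_is_ideal[OF P]
  note Pc = ideal.Icarr[OF iP]
  have pF: "primeideal (full P) (A \<propto> E)" by (rule primeideal_full[OF R.maximalideal_prime[OF P]])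
  have eP: "e \<in> P" using e R.cgenideal_self by blast
  have ep: "e \<otimes> p = p" if p: "p \<in> P" for p
  proof -
    obtain r where r: "r \<in> carrier A" "p = r \<otimes> e" using p unfolding e(3) R.mem_cgenideal by blast
    have "e \<otimes> p = r \<otimes> (e \<otimes> e)" unfolding r(2) using r(1) e(1) by algebra
    then show ?thesis using e r by simp
  qed
  define f where "f = \<one> \<ominus> e"
  note f = R.one_minus_idempotent[OF e(1,2), folded f_def]
  have JeE: "(\<zero>, e \<odot>\<^bsub>E\<^esub> y) \<in> J" if "y \<in> carrier E" for y
  proof -
    have "(\<zero>, y) \<otimes>\<^bsub>A \<propto> E\<^esub> (e, \<zero>\<^bsub>E\<^esub>) \<in> J" using that J by (intro ideal.I_l_closed[OF J(1)]) auto
    then show ?thesis using that e by simp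
  qed
  have Jp: "(p, \<zero>\<^bsub>E\<^esub>) \<in> J" if "p \<in> P" for p
  proof -
    have "(p, \<zero>\<^bsub>E\<^esub>) \<otimes>\<^bsub>A \<propto> E\<^esub> (e, \<zero>\<^bsub>E\<^esub>) \<in> J"
      using that Pc J by (intro ideal.I_l_closed[OF J(1)]) auto
    then show ?thesis using ep[OF that] Pc[OF that] e by (simp add: R.m_comm)
  qed
  have eIE: "e \<odot>\<^bsub>E\<^esub> y \<in> IE P" if "y \<in> carrier E" for y
    using ideal_smult.smult[OF eP that] .
  have IEe: "e \<odot>\<^bsub>E\<^esub> y = y" if "y \<in> IE P" for y
    using that
  proof induct
    case (smult p y)
    then show ?case using ep Pc e by (simp add: smult_assoc1[symmetric])
  next
    case (sum y z)
    then have "y \<in> carrier E" "z \<in> carrier E" using IE_carrier[OF R.ideal_subset[OF iP]] by auto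
    then show ?case using sum(2,4) e(1) by (simp add: smult_r_distr)
  qed
  have Jlow: "(p, y) \<in> J" if py: "p \<in> P" "y \<in> carrier E" "(\<zero>, y) \<in> J" for p y
    using T.ideal_add[OF J(1) Jp[OF py(1)] py(3)] Pc[OF py(1)] py(2) by simp
  \<comment> \<open>These are the ideals of k \<propto> k: the whole ring, zero and 0 \<propto> k.
    The third case is void when \<open>IE P\<close> is all of \<open>E\<close>.\<close>
  consider (unit) a x where "(a, x) \<in> J" "a \<notin> P"
    | (square) "J \<subseteq> P \<times> IE P"
    | (mid) a x where "J \<subseteq> full P" "(a, x) \<in> J" "x \<notin> IE P"
  proof (cases "J \<subseteq> full P")
    case True
    then show thesis using square mid by blast
  next
    case False
    then obtain p where p: "p \<in> J" "p \<notin> full P" by blast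
    then have "fst p \<notin> P" using ideal.Icarr[OF J(1) p(1)] by (cases p) simp
    then show thesis using unit[of "fst p" "snd p"] p(1) by simp
  qed
  then show ?thesis
  proof cases
    case unit
    have c: "a \<in> carrier A" "x \<in> carrier E" using ideal.Icarr[OF J(1) unit(1)] by auto
    obtain s p where s: "s \<in> carrier A" "p \<in> P" "\<one> = s \<otimes> a \<oplus> p"
      using R.maximalideal_witness[OF P c(1) unit(2)] .
    have sJ: "(s, \<zero>\<^bsub>E\<^esub>) \<otimes>\<^bsub>A \<propto> E\<^esub> (a, x) \<in> J"
      using s unit by (intro ideal.I_l_closed[OF J(1)]) auto
    from T.ideal_add[OF J(1) sJ Jp[OF s(2)]] have "(\<one>, s \<odot>\<^bsub>E\<^esub> x) \<in> J"
      using s(1) c Pc[OF s(2)] unfolding s(3) by simp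
    then have "(\<one>, \<ominus>\<^bsub>E\<^esub> (s \<odot>\<^bsub>E\<^esub> x)) \<otimes>\<^bsub>A \<propto> E\<^esub> (\<one>, s \<odot>\<^bsub>E\<^esub> x) \<in> J"
      using s(1) c by (intro ideal.I_l_closed[OF J(1)]) auto
    then have "\<one>\<^bsub>A \<propto> E\<^esub> \<in> J" using s(1) c by (simp add: M.r_neg)
    then show ?thesis using ideal.one_imp_carrier[OF J(1)] prime_product_carrier by metis
  next
    case square
    have "J = full P \<cdot>\<^bsub>A \<propto> E\<^esub> full P"
      unfolding full_square[OF iP]
    proof
      have "P \<subseteq> P \<cdot> P" using ep ideal_prod.prod[OF eP, of _ P A] by fastforce
      then show "J \<subseteq> (P \<cdot> P) \<times> IE P" using square by blast
      have "P \<cdot> P \<subseteq> P" using R.ideal_prod_inter[OF iP iP] by blast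
      moreover have "(p, y) \<in> J" if "p \<in> P" "y \<in> IE P" for p y
        using Jlow[OF that(1)] JeE[of y] IEe[OF that(2)] IE_carrier[OF R.ideal_subset[OF iP]] that(2)
        by auto
      ultimately show "(P \<cdot> P) \<times> IE P \<subseteq> J" by blast
    qed
    then show ?thesis using prime_product_prod prime_product_prime[OF pF] by simp
  next
    case mid
    have c: "a \<in> carrier A" "x \<in> carrier E" "a \<in> P" using mid(1,2) Pc by auto
    have fx: "f \<odot>\<^bsub>E\<^esub> x \<noteq> \<zero>\<^bsub>E\<^esub>"
    proof
      assume 0: "f \<odot>\<^bsub>E\<^esub> x = \<zero>\<^bsub>E\<^esub>"
      have "x = (e \<oplus> f) \<odot>\<^bsub>E\<^esub> x" using c f by simp
      also have "\<dots> = e \<odot>\<^bsub>E\<^esub> x" using smult_l_distr[OF e(1) f(1) c(2)] c e 0 by simp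
      finally show False using eIE[OF c(2)] mid(3) by simp
    qed
    have fa: "f \<otimes> a = \<zero>"
    proof -
      have "f \<otimes> a = f \<otimes> (e \<otimes> a)" using ep[OF c(3)] by simp
      also have "\<dots> = (e \<otimes> f) \<otimes> a" using f(1) e(1) c(1) by algebra
      finally show ?thesis using f c by simp
    qed
    have "(f, \<zero>\<^bsub>E\<^esub>) \<otimes>\<^bsub>A \<propto> E\<^esub> (a, x) \<in> J" using f mid by (intro ideal.I_l_closed[OF J(1)]) auto
    then have fxJ: "(\<zero>, f \<odot>\<^bsub>E\<^esub> x) \<in> J" using fa f c by simp
    obtain b where b: "b \<in> carrier A" "f \<odot>\<^bsub>E\<^esub> x = b \<odot>\<^bsub>E\<^esub> x0" using x0 c f by blast
    \<comment> \<open>On multiples of \<open>P\<close> the idempotent \<open>e\<close> acts as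
      identity, but it kills \<open>f x\<close>, which is nonzero.\<close>
    have "b \<notin> P"
    proof
      assume "b \<in> P"
      then have "f \<odot>\<^bsub>E\<^esub> x = e \<odot>\<^bsub>E\<^esub> (f \<odot>\<^bsub>E\<^esub> x)"
        using b e x0(1) ep[of b] by (simp add: smult_assoc1[symmetric])
      also have "\<dots> = \<zero>\<^bsub>E\<^esub>" using e(1) f c by (simp add: smult_assoc1[symmetric])
      finally show False using fx by simp
    qed
    then obtain s p where s: "s \<in> carrier A" "p \<in> P" "\<one> = s \<otimes> b \<oplus> p"
      using R.maximalideal_witness[OF P b(1)] by blast
    \<comment> \<open>Both summands of the generator lie in the second coordinate of
      \<open>J\<close>: the first because \<open>(0, f x) \<in> J\<close>, the second because
      \<open>J\<close> contains \<open>(e, 0)\<close>.\<close>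
    have x0eq: "x0 = s \<odot>\<^bsub>E\<^esub> (f \<odot>\<^bsub>E\<^esub> x) \<oplus>\<^bsub>E\<^esub> e \<odot>\<^bsub>E\<^esub> (p \<odot>\<^bsub>E\<^esub> x0)"
    proof -
      have "x0 = (s \<otimes> b \<oplus> p) \<odot>\<^bsub>E\<^esub> x0" unfolding s(3)[symmetric] using x0(1) by simp
      also have "\<dots> = (s \<otimes> b) \<odot>\<^bsub>E\<^esub> x0 \<oplus>\<^bsub>E\<^esub> p \<odot>\<^bsub>E\<^esub> x0"
        using s b Pc x0(1) by (simp add: smult_l_distr)
      also have "(s \<otimes> b) \<odot>\<^bsub>E\<^esub> x0 = s \<odot>\<^bsub>E\<^esub> (f \<odot>\<^bsub>E\<^esub> x)" using b s x0(1) by (simp add: smult_assoc1)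
      also have "p \<odot>\<^bsub>E\<^esub> x0 = e \<odot>\<^bsub>E\<^esub> (p \<odot>\<^bsub>E\<^esub> x0)"
        using ep[OF s(2)] e(1) Pc[OF s(2)] x0(1) by (simp add: smult_assoc1[symmetric])
      finally show ?thesis .
    qed
    have "(s, \<zero>\<^bsub>E\<^esub>) \<otimes>\<^bsub>A \<propto> E\<^esub> (\<zero>, f \<odot>\<^bsub>E\<^esub> x) \<in> J"
      using s fxJ by (intro ideal.I_l_closed[OF J(1)]) auto
    then have "(\<zero>, s \<odot>\<^bsub>E\<^esub> (f \<odot>\<^bsub>E\<^esub> x)) \<in> J" using s f c by simp
    from T.ideal_add[OF J(1) this JeE[of "p \<odot>\<^bsub>E\<^esub> x0"]] have x0J: "(\<zero>, x0) \<in> J"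
      using x0eq s Pc x0(1) by simp
    have "(\<zero>, y) \<in> J" if y: "y \<in> carrier E" for y
    proof -
      obtain d where d: "d \<in> carrier A" "y = d \<odot>\<^bsub>E\<^esub> x0" using y x0(2) by blast
      have "(d, \<zero>\<^bsub>E\<^esub>) \<otimes>\<^bsub>A \<propto> E\<^esub> (\<zero>, x0) \<in> J"
        using d x0J by (intro ideal.I_l_closed[OF J(1)]) auto
      then show ?thesis using d x0(1) by simp
    qed
    then have "J = full P" using Jlow mid(1) by blast
    then show ?thesis using prime_product_prime[OF pF] by simp
  qed
qed

text \<open>At each \<open>P\<close> in \<open>S\<close> the ideal splits into a part containing
  \<open>(e, 0)\<close>, already known to be a product of primes, and a part containing
  \<open>(1 - e, 0)\<close>. The accumulated product \<open>c\<close> of the idempotents lies in the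
  product of \<open>S\<close>, and \<open>base\<close> treats what remains, where \<open>c\<close>
  is congruent to 1.\<close>

lemma ZPI_reduce:
  assumes ZPI: "general_ZPI_ring A"
    and x0: "x0 \<in> carrier E" "carrier E = {a \<odot>\<^bsub>E\<^esub> x0 | a. a \<in> carrier A}"
    and S: "\<And>P. P \<in> set S \<Longrightarrow> maximalideal P A \<and> idempotent_ideal P A"
    and base: "\<And>J c. \<lbrakk>ideal J (A \<propto> E); c \<in> ideal_list_prod A S; c \<in> carrier A;
      (\<one> \<ominus> c, \<zero>\<^bsub>E\<^esub>) \<in> J\<rbrakk> \<Longrightarrow> prime_product J"
    and J: "ideal J (A \<propto> E)"
  shows "prime_product J"
  using S base J
proof (induct S arbitrary: J)
  case Nil
  have "(\<one> \<ominus> \<one>, \<zero>\<^bsub>E\<^esub>) \<in> J" using T.ideal_zero[OF Nil(3)] by (simp add: a_minus_def R.r_neg)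
  then show ?case using Nil(2)[OF Nil(3), of \<one>] by simp
next
  case (Cons P S)
  have mP: "maximalideal P A" "P \<cdot> P = P" using Cons(2) by (auto simp: idempotent_ideal_def)
  obtain e where e: "e \<in> carrier A" "e \<otimes> e = e" "P = PIdl\<^bsub>A\<^esub> e"
    using R.general_ZPI_idempotent_maximal_generator[OF ZPI mP] by blast
  have eP: "e \<in> P" using e R.cgenideal_self by blast
  define f where "f = \<one> \<ominus> e"
  note f = R.one_minus_idempotent[OF e(1,2), folded f_def]
  show ?case
  proof (rule Cons(1))
    show "maximalideal Q A \<and> idempotent_ideal Q A" if "Q \<in> set S" for Q using that Cons(2) by simp
    show "ideal J (A \<propto> E)" by (rule Cons(4))
    fix K c
    assume K: "ideal K (A \<propto> E)" and c: "c \<in> ideal_list_prod A S" "c \<in> carrier A"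
      and cK: "(\<one> \<ominus> c, \<zero>\<^bsub>E\<^esub>) \<in> K"
    let ?e = "(e, \<zero>\<^bsub>E\<^esub>)" and ?f = "(f, \<zero>\<^bsub>E\<^esub>)"
    have ec: "?e \<in> carrier (A \<propto> E)" "?f \<in> carrier (A \<propto> E)" using e f by auto
    have ie: "ideal (PIdl\<^bsub>A \<propto> E\<^esub> ?e) (A \<propto> E)" "ideal (PIdl\<^bsub>A \<propto> E\<^esub> ?f) (A \<propto> E)"
      using ec by (auto intro: T.cgenideal_ideal)
    have KeKf: "ideal (K <+>\<^bsub>A \<propto> E\<^esub> PIdl\<^bsub>A \<propto> E\<^esub> ?e) (A \<propto> E)"
      "ideal (K <+>\<^bsub>A \<propto> E\<^esub> PIdl\<^bsub>A \<propto> E\<^esub> ?f) (A \<propto> E)"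
      using K ie by (auto intro: T.add_ideals)
    have eK: "?e \<in> K <+>\<^bsub>A \<propto> E\<^esub> PIdl\<^bsub>A \<propto> E\<^esub> ?e"
      using T.set_add_ideal_upper(2)[OF K ie(1)] T.cgenideal_self[OF ec(1)] by blast
    have fK: "?f \<in> K <+>\<^bsub>A \<propto> E\<^esub> PIdl\<^bsub>A \<propto> E\<^esub> ?f"
      using T.set_add_ideal_upper(2)[OF K ie(2)] T.cgenideal_self[OF ec(2)] by blast
    have "prime_product (K <+>\<^bsub>A \<propto> E\<^esub> PIdl\<^bsub>A \<propto> E\<^esub> ?f)"
    proof (rule Cons(3)[OF KeKf(2)])
      show "e \<otimes> c \<in> ideal_list_prod A (P # S)" using eP c by (simp add: ideal_prod.prod)
      show "e \<otimes> c \<in> carrier A" using e c by simp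
      have "?e \<otimes>\<^bsub>A \<propto> E\<^esub> (\<one> \<ominus> c, \<zero>\<^bsub>E\<^esub>) \<in> K" by (rule ideal.I_l_closed[OF K cK ec(1)])
      then have "(e \<otimes> (\<one> \<ominus> c), \<zero>\<^bsub>E\<^esub>) \<in> K" using e c by simp
      then have 1: "(e \<otimes> (\<one> \<ominus> c), \<zero>\<^bsub>E\<^esub>) \<in> K <+>\<^bsub>A \<propto> E\<^esub> PIdl\<^bsub>A \<propto> E\<^esub> ?f"
        using T.set_add_ideal_upper(1)[OF K ie(2)] by blast
      \<comment> \<open>Shows that modulo the enlarged ideal the accumulated idempotent may be
        multiplied by \<open>e\<close>.\<close>
      have "f \<oplus> e \<otimes> (\<one> \<ominus> c) = \<one> \<ominus> e \<otimes> c" unfolding f_def using e(1) c(2) by algebra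
      then show "(\<one> \<ominus> e \<otimes> c, \<zero>\<^bsub>E\<^esub>) \<in> K <+>\<^bsub>A \<propto> E\<^esub> PIdl\<^bsub>A \<propto> E\<^esub> ?f"
        using T.ideal_add[OF KeKf(2) fK 1] by simp
    qed
    moreover have "prime_product (K <+>\<^bsub>A \<propto> E\<^esub> PIdl\<^bsub>A \<propto> E\<^esub> ?e)"
      by (rule prime_product_over_idempotent[OF mP(1) e x0 KeKf(1) eK])
    moreover have "K = (K <+>\<^bsub>A \<propto> E\<^esub> PIdl\<^bsub>A \<propto> E\<^esub> ?e) \<cdot>\<^bsub>A \<propto> E\<^esub> (K <+>\<^bsub>A \<propto> E\<^esub> PIdl\<^bsub>A \<propto> E\<^esub> ?f)"
      by (rule T.ideal_split_idempotent[OF K ec]) (use e f in auto)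
    ultimately show "prime_product K" using prime_product_prod by metis
  qed
qed

text \<open>In the remaining ideals \<open>c\<close> kills \<open>E\<close>, so \<open>1 - c\<close>
  acts as the identity and multiplies \<open>E\<close> onto itself. Hence \<open>J\<close> contains
  \<open>Z\<close>, and so does the lifted product of the prime factors of its projection, each of
  which contains \<open>1 - c\<close>. Two ideals containing \<open>Z\<close> with equal projections
  coincide.\<close>

theorem ZPI_if:
  assumes ZPI: "general_ZPI_ring A" and cyc: "cyclic_module A E"
    and S: "\<And>P. P \<in> set S \<Longrightarrow> maximalideal P A \<and> idempotent_ideal P A"
    and ann: "annihilator A E = ideal_list_prod A S"
  shows "general_ZPI_ring (A \<propto> E)"
proof -
  obtain x0 where x0: "x0 \<in> carrier E" "carrier E = {a \<odot>\<^bsub>E\<^esub> x0 | a. a \<in> carrier A}"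
    using cyc unfolding cyclic_module_def by blast
  have base: "prime_product J"
    if J: "ideal J (A \<propto> E)" and c: "c \<in> ideal_list_prod A S" "c \<in> carrier A"
      and cJ: "(\<one> \<ominus> c, \<zero>\<^bsub>E\<^esub>) \<in> J" for J c
  proof -
    have cx: "(\<one> \<ominus> c) \<odot>\<^bsub>E\<^esub> x = x" if "x \<in> carrier E" for x
    proof -
      have "c \<odot>\<^bsub>E\<^esub> x = \<zero>\<^bsub>E\<^esub>" using c that unfolding ann[symmetric] annihilator_def by blast
      then show ?thesis using c that by (simp add: a_minus_def smult_l_distr smult_l_minus)
    qed
    have Z: "Z \<subseteq> J"
    proof
      fix p assume "p \<in> Z"
      then obtain x where x: "x \<in> carrier E" "p = (\<zero>, x)" by auto
      have "(\<zero>, x) \<otimes>\<^bsub>A \<propto> E\<^esub> (\<one> \<ominus> c, \<zero>\<^bsub>E\<^esub>) \<in> J" using x by (intro ideal.I_l_closed[OF J cJ]) simp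
      then show "p \<in> J" using x c cx by simp
    qed
    have iK: "ideal (fst ` J) A"
      using surj_ring_hom.img_ideal[OF fst_hom J] .
    have JK: "J = full (fst ` J)" by (rule full_fst[OF J Z])
    show ?thesis
    proof (cases "fst ` J = carrier A")
      case True
      then have "J = carrier (A \<propto> E)" using JK by simp
      then show ?thesis using prime_product_carrier by simp
    next
      case False
      then have "proper_ideal (fst ` J) A" using iK by (simp add: proper_ideal_def)
      then obtain Ps where Ps: "\<And>P. P \<in> set Ps \<Longrightarrow> primeideal P A" "\<And>P. P \<in> set Ps \<Longrightarrow> ideal P A"
        "fst ` J = ideal_list_prod A Ps" using R.general_ZPI_ringE[OF ZPI] by metis
      have PE: "IE P = carrier E" if P: "P \<in> set Ps" for P
      proof
        show "IE P \<subseteq> carrier E" by (rule IE_carrier[OF R.ideal_subset[OF Ps(2)[OF P]]])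
        have "\<one> \<ominus> c \<in> fst ` J" using cJ by force
        then have "\<one> \<ominus> c \<in> P" using R.ideal_list_prod_subset[OF Ps(2) P] Ps(3) by blast
        then show "carrier E \<subseteq> IE P" using cx ideal_smult.smult[of "\<one> \<ominus> c" P _ E] by fastforce
      qed
      let ?L = "ideal_list_prod (A \<propto> E) (map full Ps)"
      have iL: "ideal ?L (A \<propto> E)" using Ps(2) by (auto intro!: T.ideal_list_prod_ideal full_ideal)
      have "Z \<subseteq> Z \<cdot>\<^bsub>A \<propto> E\<^esub> ?L" using Z_subset_Z_prod_list[of Ps] Ps(2) PE by blast
      also have "\<dots> \<subseteq> ?L" using T.ideal_prod_inter[OF Z_ideal iL] by blast
      finally have "?L = full (fst ` ?L)" by (rule full_fst[OF iL])
      also have "\<dots> = J" using fst_list_prod[OF Ps(2)] Ps(3) JK by simp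
      finally show ?thesis
        using primeideal_full[OF Ps(1)] unfolding prime_product_def
        by (intro exI[of _ "map full Ps"]) auto
    qed
  qed
  show ?thesis
    unfolding general_ZPI_ring_def
  proof (intro allI impI)
    fix I assume I: "proper_ideal I (A \<propto> E)"
    then have "prime_product I"
      using ZPI_reduce[OF ZPI x0 S base] by (simp add: proper_ideal_def)
    then obtain Ps where Ps: "\<forall>P \<in> set Ps. primeideal P (A \<propto> E)" "I = ideal_list_prod (A \<propto> E) Ps"
      unfolding prime_product_def by blast
    moreover have "Ps \<noteq> []" using I Ps(2) by (auto simp: proper_ideal_def ideal_list_prod_def)
    ultimately show "\<exists>Ps. Ps \<noteq> [] \<and> (\<forall>P \<in> set Ps. primeideal P (A \<propto> E)) \<and>
      I = ideal_list_prod (A \<propto> E) Ps" by blast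
  qed
qed

section \<open>Local trivial extensions\<close>

lemma Units_trivial_extension: "Units (A \<propto> E) = full (Units A)"
proof (intro subset_antisym subsetI)
  interpret h: surj_ring_hom "A \<propto> E" A fst by (rule fst_hom)
  show "p \<in> full (Units A)" if "p \<in> Units (A \<propto> E)" for p
    using h.Units_img[OF that] T.Units_closed[OF that] by (cases p) auto
  fix p assume "p \<in> full (Units A)"
  then obtain u x where u: "u \<in> Units A" "x \<in> carrier E" "p = (u, x)" by auto
  let ?v = "inv u"
  \<comment> \<open>The second coordinate of the inverse solves \<open>u y + v x = 0\<close>, where
    \<open>v\<close> is the inverse of \<open>u\<close>.\<close>
  have "p \<otimes>\<^bsub>A \<propto> E\<^esub> (?v, \<ominus>\<^bsub>E\<^esub> (?v \<odot>\<^bsub>E\<^esub> (?v \<odot>\<^bsub>E\<^esub> x))) = \<one>\<^bsub>A \<propto> E\<^esub>"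
    using u R.Units_closed[OF u(1)]
    by (simp add: smult_r_minus M.l_neg smult_assoc1[symmetric] R.m_assoc[symmetric])
  then show "p \<in> Units (A \<propto> E)"
    using T.Units_factor[of p "(?v, \<ominus>\<^bsub>E\<^esub> (?v \<odot>\<^bsub>E\<^esub> (?v \<odot>\<^bsub>E\<^esub> x)))"] u
      R.Units_closed[OF u(1)] T.Units_one_closed by simp
qed

lemma nonunits_trivial_extension: "nonunits (A \<propto> E) = full (nonunits A)"
  unfolding Units_trivial_extension by auto

lemma local_trivial_extension:
  "ideal (nonunits (A \<propto> E)) (A \<propto> E) \<longleftrightarrow> ideal (nonunits A) A"
  using surj_ring_hom.img_ideal[OF fst_hom] full_ideal fst_full
  unfolding nonunits_trivial_extension by metis

lemma zero_module_hom:
  assumes "carrier E = {\<zero>\<^bsub>E\<^esub>}"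
  shows "surj_ring_hom A (A \<propto> E) (\<lambda>a. (a, \<zero>\<^bsub>E\<^esub>))"
proof -
  have "(\<lambda>a. (a, \<zero>\<^bsub>E\<^esub>)) ` carrier A = carrier (A \<propto> E)" using assms by auto
  moreover have "(\<lambda>a. (a, \<zero>\<^bsub>E\<^esub>)) \<in> ring_hom A (A \<propto> E)" by (auto simp: ring_hom_def)
  ultimately show ?thesis
    by (intro surj_ring_hom.intro surj_ring_hom_axioms.intro ring_hom_cring.intro
        ring_hom_cring_axioms.intro T.is_cring R.is_cring)
qed

text \<open>This makes ME = E incompatible with nilpotence of the maximal ideal of the extension as
  soon as \<open>E\<close> is nonzero.\<close>

lemma full_subset_power:
  assumes M: "ideal M A" and ME: "IE M = carrier E"
  shows "Z \<subseteq> ideal_pow (A \<propto> E) (full M) n"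
proof (induct n)
  case 0
  show ?case by auto
next
  case (Suc n)
  have "Z \<subseteq> Z \<cdot>\<^bsub>A \<propto> E\<^esub> full M" by (rule Z_subset_Z_prod_full[OF M ME])
  also have "\<dots> \<subseteq> ideal_pow (A \<propto> E) (full M) n \<cdot>\<^bsub>A \<propto> E\<^esub> full M"
    using Suc by (rule T.ideal_prod_mono) simp
  finally show ?case by simp
qed

text \<open>Dividedness of \<open>(M \<cdot> M) \<times> IE M\<close> is tested on three ideals.
  Comparison with \<open>Z\<close> kills \<open>M \<cdot> M\<close>, the alternative being ME = E.
  The principal ideals of \<open>(a, 0)\<close> and \<open>(0, x)\<close> are not contained in it,
  so they contain it, which yields the two formulas for ME.\<close>

theorem local_nonzero_imp:
  assumes M: "M = nonunits A" "ideal M A" and OAF: "OAF_ring (A \<propto> E)"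
    and nz: "carrier E \<noteq> {\<zero>\<^bsub>E\<^esub>}"
  shows "M \<cdot> M = {\<zero>}"
    and "a \<in> M - {\<zero>} \<Longrightarrow> IE M = {a \<odot>\<^bsub>E\<^esub> x | x. x \<in> carrier E}"
    and "x \<in> carrier E - IE M \<Longrightarrow> IE M = {m \<odot>\<^bsub>E\<^esub> x | m. m \<in> M}"
proof -
  note Mc = ideal.Icarr[OF M(2)]
  have NM: "nonunits (A \<propto> E) = full M" using nonunits_trivial_extension M(1) by simp
  have N: "ideal (full M) (A \<propto> E)" using full_ideal[OF M(2)] .
  obtain x0 where x0: "x0 \<in> carrier E" "x0 \<noteq> \<zero>\<^bsub>E\<^esub>" using nz M.zero_closed by blast
  have "\<not> domain (A \<propto> E)"
  proof
    assume "domain (A \<propto> E)"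
    moreover have "(\<zero>, x0) \<otimes>\<^bsub>A \<propto> E\<^esub> (\<zero>, x0) = \<zero>\<^bsub>A \<propto> E\<^esub>" using x0 by simp
    ultimately show False using domain.integral[of "A \<propto> E" "(\<zero>, x0)" "(\<zero>, x0)"] x0 by simp
  qed
  then have nil: "nilpotent_ideal (full M) (A \<propto> E)" and div: "divided_ideal ((M \<cdot> M) \<times> IE M) (A \<propto> E)"
    using T.local_OAF_imp[of] N OAF NM full_square[OF M(2)] by auto
  have cmp: "(M \<cdot> M) \<times> IE M \<subseteq> J \<or> J \<subseteq> (M \<cdot> M) \<times> IE M" if "ideal J (A \<propto> E)" for J
    using div that unfolding divided_ideal_def by blast
  have MEc: "IE M \<subseteq> carrier E" using IE_carrier[OF R.ideal_subset[OF M(2)]] .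
  have ME0: "\<zero>\<^bsub>E\<^esub> \<in> IE M" by (rule IE_zero[OF M(2)])
  have iMM: "ideal (M \<cdot> M) A" using M(2) by (intro R.ideal_prod_is_ideal)
  have MM0: "\<zero> \<in> M \<cdot> M" by (rule R.ideal_zero[OF iMM])
  show MM: "M \<cdot> M = {\<zero>}"
  proof (rule ccontr)
    assume "M \<cdot> M \<noteq> {\<zero>}"
    then have "\<not> (M \<cdot> M) \<times> IE M \<subseteq> Z" using MM0 ME0 by blast
    then have "Z \<subseteq> (M \<cdot> M) \<times> IE M" using cmp[OF Z_ideal] by blast
    then have ME: "IE M = carrier E" using MEc by blast
    obtain n where "ideal_pow (A \<propto> E) (full M) n = {\<zero>\<^bsub>A \<propto> E\<^esub>}"
      using nil unfolding nilpotent_ideal_def by blast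
    then have "Z \<subseteq> {\<zero>\<^bsub>A \<propto> E\<^esub>}" using full_subset_power[OF M(2) ME, of n] by simp
    then show False using x0 by auto
  qed
  show "IE M = {a \<odot>\<^bsub>E\<^esub> x | x. x \<in> carrier E}" if a: "a \<in> M - {\<zero>}"
  proof
    have ac: "a \<in> carrier A" using a Mc by blast
    have "ideal (PIdl\<^bsub>A \<propto> E\<^esub> (a, \<zero>\<^bsub>E\<^esub>)) (A \<propto> E)" using ac by (intro T.cgenideal_ideal) simp
    moreover have "(a, \<zero>\<^bsub>E\<^esub>) \<in> PIdl\<^bsub>A \<propto> E\<^esub> (a, \<zero>\<^bsub>E\<^esub>)" using ac by (intro T.cgenideal_self) simp
    ultimately have sub: "(M \<cdot> M) \<times> IE M \<subseteq> PIdl\<^bsub>A \<propto> E\<^esub> (a, \<zero>\<^bsub>E\<^esub>)"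
      using cmp[of "PIdl\<^bsub>A \<propto> E\<^esub> (a, \<zero>\<^bsub>E\<^esub>)"] a MM by blast
    show "IE M \<subseteq> {a \<odot>\<^bsub>E\<^esub> x | x. x \<in> carrier E}"
    proof
      fix y assume "y \<in> IE M"
      then have "(\<zero>, y) \<in> PIdl\<^bsub>A \<propto> E\<^esub> (a, \<zero>\<^bsub>E\<^esub>)" using sub MM0 by blast
      then obtain r x where "r \<in> carrier A" "x \<in> carrier E"
        "(\<zero>, y) = (r, x) \<otimes>\<^bsub>A \<propto> E\<^esub> (a, \<zero>\<^bsub>E\<^esub>)" unfolding T.mem_cgenideal by auto
      then show "y \<in> {a \<odot>\<^bsub>E\<^esub> x | x. x \<in> carrier E}" using ac by auto
    qed
    show "{a \<odot>\<^bsub>E\<^esub> x | x. x \<in> carrier E} \<subseteq> IE M" using a by (auto intro: ideal_smult.smult)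
  qed
  show "IE M = {m \<odot>\<^bsub>E\<^esub> x | m. m \<in> M}" if x: "x \<in> carrier E - IE M"
  proof
    have "ideal (PIdl\<^bsub>A \<propto> E\<^esub> (\<zero>, x)) (A \<propto> E)" using x by (intro T.cgenideal_ideal) simp
    moreover have "(\<zero>, x) \<in> PIdl\<^bsub>A \<propto> E\<^esub> (\<zero>, x)" using x by (intro T.cgenideal_self) simp
    ultimately have sub: "(M \<cdot> M) \<times> IE M \<subseteq> PIdl\<^bsub>A \<propto> E\<^esub> (\<zero>, x)"
      using cmp[of "PIdl\<^bsub>A \<propto> E\<^esub> (\<zero>, x)"] x by blast
    show "IE M \<subseteq> {m \<odot>\<^bsub>E\<^esub> x | m. m \<in> M}"
    proof
      fix y assume y: "y \<in> IE M"
      then have "(\<zero>, y) \<in> PIdl\<^bsub>A \<propto> E\<^esub> (\<zero>, x)" using sub MM0 by blast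
      then obtain r z where r: "r \<in> carrier A" "z \<in> carrier E"
        "(\<zero>, y) = (r, z) \<otimes>\<^bsub>A \<propto> E\<^esub> (\<zero>, x)" unfolding T.mem_cgenideal by auto
      then have yr: "y = r \<odot>\<^bsub>E\<^esub> x" using x by simp
      \<comment> \<open>For a unit \<open>r\<close> the element \<open>x\<close> would be a multiple
        of \<open>y\<close> and lie in ME.\<close>
      have "r \<notin> Units A"
      proof
        assume u: "r \<in> Units A"
        then have "x = inv r \<odot>\<^bsub>E\<^esub> y" using yr x r(1) by (simp add: smult_assoc1[symmetric])
        then show False using IE_smult[OF M(2) _ y, of "inv r"] u x by simp
      qed
      then show "y \<in> {m \<odot>\<^bsub>E\<^esub> x | m. m \<in> M}" using yr r(1) M(1) by blast
    qed
    show "{m \<odot>\<^bsub>E\<^esub> x | m. m \<in> M} \<subseteq> IE M" using x by (auto intro: ideal_smult.smult)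
  qed
qed

text \<open>An ideal not inside \<open>{\<zero>} \<times> IE M\<close> contains some
  \<open>(b, y)\<close> outside it. If \<open>b\<close> is a unit the ideal is everything; otherwise
  multiplying by \<open>(0, z)\<close> or by \<open>(m, 0)\<close> produces all of ME by the two
  hypotheses. Nilpotence holds with exponent 3, since M kills ME.\<close>

theorem local_nonzero_if:
  assumes M: "M = nonunits A" "ideal M A" and MM: "M \<cdot> M = {\<zero>}"
    and a: "\<And>a. a \<in> M - {\<zero>} \<Longrightarrow> IE M = {a \<odot>\<^bsub>E\<^esub> x | x. x \<in> carrier E}"
    and x: "\<And>x. x \<in> carrier E - IE M \<Longrightarrow> IE M = {m \<odot>\<^bsub>E\<^esub> x | m. m \<in> M}"
  shows "OAF_ring (A \<propto> E)"
proof (rule T.local_OAF_if)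
  note Mc = ideal.Icarr[OF M(2)]
  have NM: "nonunits (A \<propto> E) = full M" using nonunits_trivial_extension M(1) by simp
  have N: "ideal (full M) (A \<propto> E)" using full_ideal[OF M(2)] .
  then show "ideal (nonunits (A \<propto> E)) (A \<propto> E)" using NM by simp
  have MEc: "IE M \<subseteq> carrier E" using IE_carrier[OF R.ideal_subset[OF M(2)]] .
  have NN: "full M \<cdot>\<^bsub>A \<propto> E\<^esub> full M = {\<zero>} \<times> IE M" using full_square[OF M(2)] MM by simp
  have iNN: "ideal ({\<zero>} \<times> IE M) (A \<propto> E)" using T.ideal_prod_is_ideal[OF N N] NN by simp
  show "divided_ideal (nonunits (A \<propto> E) \<cdot>\<^bsub>A \<propto> E\<^esub> nonunits (A \<propto> E)) (A \<propto> E)"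
    unfolding NM NN divided_ideal_def
  proof (intro conjI allI impI iNN)
    fix J assume J: "ideal J (A \<propto> E)"
    show "{\<zero>} \<times> IE M \<subseteq> J \<or> J \<subseteq> {\<zero>} \<times> IE M"
    proof (cases "J \<subseteq> {\<zero>} \<times> IE M")
      case False
      then obtain b y where bJ: "(b, y) \<in> J" "b \<noteq> \<zero> \<or> y \<notin> IE M" by auto
      have c: "b \<in> carrier A" "y \<in> carrier E" using ideal.Icarr[OF J bJ(1)] by auto
      consider "b \<in> Units A" | "b \<in> M - {\<zero>}" | "b = \<zero>" "y \<notin> IE M" using bJ c M(1) by blast
      then have "{\<zero>} \<times> IE M \<subseteq> J"
      proof cases
        case 1
        then have "(b, y) \<in> Units (A \<propto> E)" using Units_trivial_extension c by simp
        then have "J = carrier (A \<propto> E)" using T.unit_in_ideal[OF J bJ(1)] by blast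
        then show ?thesis using MEc by auto
      next
        case 2
        have "(\<zero>, b \<odot>\<^bsub>E\<^esub> z) \<in> J" if "z \<in> carrier E" for z
        proof -
          have "(\<zero>, z) \<otimes>\<^bsub>A \<propto> E\<^esub> (b, y) \<in> J" using that by (intro ideal.I_l_closed[OF J bJ(1)]) simp
          then show ?thesis using that c by simp
        qed
        then show ?thesis using a[OF 2] by auto
      next
        case 3
        have "(\<zero>, m \<odot>\<^bsub>E\<^esub> y) \<in> J" if "m \<in> M" for m
        proof -
          have "(m, \<zero>\<^bsub>E\<^esub>) \<otimes>\<^bsub>A \<propto> E\<^esub> (b, y) \<in> J"
            using Mc[OF that] by (intro ideal.I_l_closed[OF J bJ(1)]) simp
          then show ?thesis using Mc[OF that] c 3 by simp
        qed
        then show ?thesis using x[of y] c 3 by auto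
      qed
      then show ?thesis by blast
    qed blast
  qed
  have "m \<odot>\<^bsub>E\<^esub> w = \<zero>\<^bsub>E\<^esub>" if "w \<in> IE M" "m \<in> M" for w m
    using that(1)
  proof induct
    case (smult n w)
    have "m \<otimes> n = \<zero>" using ideal_prod.prod[OF that(2) smult(1), of A] MM by simp
    then show ?case using smult that(2) Mc by (simp add: smult_assoc1[symmetric])
  next
    case (sum w v)
    then have "w \<in> carrier E" "v \<in> carrier E" using MEc by auto
    then show ?case using sum(2,4) Mc[OF that(2)] by (simp add: smult_r_distr)
  qed
  then have "({\<zero>} \<times> IE M) \<cdot>\<^bsub>A \<propto> E\<^esub> full M \<subseteq> {\<zero>\<^bsub>A \<propto> E\<^esub>}"
    using Mc MEc by (intro T.ideal_prod_subsetI[OF T.zeroideal]) auto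
  moreover have "ideal_pow (A \<propto> E) (full M) (Suc 2) = ({\<zero>} \<times> IE M) \<cdot>\<^bsub>A \<propto> E\<^esub> full M"
    by (simp only: Group.nat_pow_Suc T.ideals_set_simps T.ideal_pow_2[OF N] NN)
  ultimately have "ideal_pow (A \<propto> E) (full M) (Suc 2) \<subseteq> {\<zero>\<^bsub>A \<propto> E\<^esub>}" by metis
  moreover have "\<zero>\<^bsub>A \<propto> E\<^esub> \<in> ideal_pow (A \<propto> E) (full M) (Suc 2)"
    by (rule T.ideal_zero[OF T.ideal_pow_ideal[OF N]])
  ultimately have "ideal_pow (A \<propto> E) (full M) (Suc 2) = {\<zero>\<^bsub>A \<propto> E\<^esub>}" by blast
  then show "nilpotent_ideal (nonunits (A \<propto> E)) (A \<propto> E) \<or> domain (A \<propto> E) \<and>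
      (\<Inter>n \<in> {1..}. ideal_pow (A \<propto> E) (nonunits (A \<propto> E)) n) = {\<zero>\<^bsub>A \<propto> E\<^esub>}"
    unfolding NM nilpotent_ideal_def using N by (metis le_add1 plus_1_eq_Suc)
qed

end

theorem theorem5p3:
  fixes A :: "('a, 'm) ring_scheme"
    and E :: "('a, 'b, 'n) module_scheme"
    and M :: "'a set"
    and R :: "('a \<times> 'b) ring"
  assumes A: "cring A" "\<one>\<^bsub>A\<^esub> \<noteq> \<zero>\<^bsub>A\<^esub>"
    and E: "module A E"
    and M: "M = jacobson_radical A"
    and R: "R = A \<propto> E"
  shows "(OAF_ring R \<longleftrightarrow>
      (general_ZPI_ring A \<and> cyclic_module A E \<and>
        (\<exists>Ps. (\<forall>P \<in> set Ps. maximalideal P A \<and> idempotent_ideal P A) \<and>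
          annihilator A E = ideal_list_prod A Ps)) \<or>
      (local_ring A \<and> divided_ideal (ideal_pow A M 2) A \<and> carrier E = {\<zero>\<^bsub>E\<^esub>} \<and>
        (nilpotent_ideal M A \<or> domain A \<and> (\<Inter>n \<in> {1..}. ideal_pow A M n) = {\<zero>\<^bsub>A\<^esub>})) \<or>
      (local_ring A \<and> ideal_pow A M 2 = {\<zero>\<^bsub>A\<^esub>} \<and>
        (\<forall>a \<in> M - {\<zero>\<^bsub>A\<^esub>}. ideal_smult M E = {a \<odot>\<^bsub>E\<^esub> x | x. x \<in> carrier E}) \<and>
        (\<forall>x \<in> carrier E - ideal_smult M E. ideal_smult M E = {m \<odot>\<^bsub>E\<^esub> x | m. m \<in> M})))
    \<and> (OAF_ring R \<longrightarrow> OAF_ring A)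
    \<and> ((\<forall>I. proper_ideal I R \<longrightarrow> OA_ideal I R) \<longleftrightarrow>
        local_ring A \<and> ideal_pow A M 2 = {\<zero>\<^bsub>A\<^esub>} \<and> ideal_smult M E = {\<zero>\<^bsub>E\<^esub>})"
proof -
  interpret idealization A E using E by (rule idealization.intro)
  let ?A = "general_ZPI_ring A \<and> cyclic_module A E \<and>
        (\<exists>Ps. (\<forall>P \<in> set Ps. maximalideal P A \<and> idempotent_ideal P A) \<and>
          annihilator A E = ideal_list_prod A Ps)"
  let ?B = "local_ring A \<and> divided_ideal (ideal_pow A M 2) A \<and> carrier E = {\<zero>\<^bsub>E\<^esub>} \<and>
        (nilpotent_ideal M A \<or> domain A \<and> (\<Inter>n \<in> {1..}. ideal_pow A M n) = {\<zero>\<^bsub>A\<^esub>})"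
  let ?C = "local_ring A \<and> ideal_pow A M 2 = {\<zero>\<^bsub>A\<^esub>} \<and>
        (\<forall>a \<in> M - {\<zero>\<^bsub>A\<^esub>}. ideal_smult M E = {a \<odot>\<^bsub>E\<^esub> x | x. x \<in> carrier E}) \<and>
        (\<forall>x \<in> carrier E - ideal_smult M E. ideal_smult M E = {m \<odot>\<^bsub>E\<^esub> x | m. m \<in> M})"
  have loc: "M = nonunits A" "ideal M A" "ideal_pow A M 2 = M \<cdot>\<^bsub>A\<^esub> M" if "local_ring A"
    using R.local_ring_nonunits[OF that] R.ideal_pow_2 M by simp_all
  have OAFA: "OAF_ring R \<longrightarrow> OAF_ring A"
    using surj_ring_hom.OAF_img[OF fst_hom] R by blast
  \<comment> \<open>The alternatives correspond to three situations: \<open>A\<close> not local,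
    \<open>A\<close> local with zero \<open>E\<close>, and \<open>A\<close> local with nonzero
    \<open>E\<close>.\<close>
  have imp: "?A \<or> ?B \<or> ?C" if OAF: "OAF_ring R"
  proof (cases "local_ring A")
    case False
    then have "\<not> ideal (nonunits (A \<propto> E)) (A \<propto> E)"
      using R.local_ring_iff local_trivial_extension by simp
    then have "general_ZPI_ring (A \<propto> E)" using T.OAF_nonlocal_imp_general_ZPI OAF R by simp
    then show ?thesis using ZPI_imp[OF _ A(2)] by blast
  next
    case True
    show ?thesis
    proof (cases "carrier E = {\<zero>\<^bsub>E\<^esub>}")
      case E0: True
      have "OAF_ring A" using OAFA OAF by blast
      note B = R.local_OAF_imp[OF R.local_ring_nonunits(1)[OF True] this]
      note B' = B[folded loc(1)[OF True], folded loc(3)[OF True]]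
      have ?B using True E0 B' by blast
      then show ?thesis by blast
    next
      case False
      have "OAF_ring (A \<propto> E)" using OAF R by simp
      from local_nonzero_imp[OF loc(1,2)[OF True] this False] have ?C
        using True loc(3)[OF True] by simp
      then show ?thesis by blast
    qed
  qed
  have ifA: "OAF_ring R" if a: ?A
  proof -
    obtain S where "\<And>P. P \<in> set S \<Longrightarrow> maximalideal P A \<and> idempotent_ideal P A"
      "annihilator A E = ideal_list_prod A S" using a by blast
    then have "general_ZPI_ring (A \<propto> E)" using ZPI_if[of S] a by blast
    then show ?thesis using T.general_ZPI_imp_OAF R by blast
  qed
  have ifB: "OAF_ring R" if B: ?B
  proof -
    have l: "local_ring A" using B by blast
    have "OAF_ring A"
    proof (rule R.local_OAF_if)
      show "ideal (nonunits A) A" by (rule R.local_ring_nonunits(1)[OF l])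
      show "divided_ideal (nonunits A \<cdot>\<^bsub>A\<^esub> nonunits A) A"
        using B loc(3)[OF l] unfolding loc(1)[OF l] by metis
      show "nilpotent_ideal (nonunits A) A \<or>
          domain A \<and> (\<Inter>n \<in> {1..}. ideal_pow A (nonunits A) n) = {\<zero>\<^bsub>A\<^esub>}"
        using B unfolding loc(1)[OF l] by blast
    qed
    \<comment> \<open>For zero \<open>E\<close> the embedding of \<open>A\<close> is onto, so
      factorizations are carried over from \<open>A\<close>.\<close>
    then show ?thesis using surj_ring_hom.OAF_img[OF zero_module_hom] B R by blast
  qed
  have ifC: "OAF_ring R" if C: ?C
  proof -
    have l: "local_ring A" using C by blast
    have "OAF_ring (A \<propto> E)"
    proof (rule local_nonzero_if[OF loc(1,2)[OF l]])
      show "M \<cdot>\<^bsub>A\<^esub> M = {\<zero>\<^bsub>A\<^esub>}" using C loc(3)[OF l] by metis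
    qed (use C in blast)+
    then show ?thesis using R by simp
  qed
  have iff: "OAF_ring R \<longleftrightarrow> ?A \<or> ?B \<or> ?C"
    by (intro iffI imp) (assumption, elim disjE ifA ifB ifC)
  have "\<one>\<^bsub>R\<^esub> \<noteq> \<zero>\<^bsub>R\<^esub>" using A(2) R by simp
  then have "(\<forall>I. proper_ideal I R \<longrightarrow> OA_ideal I R) \<longleftrightarrow>
      ideal (nonunits R) R \<and> nonunits R \<cdot>\<^bsub>R\<^esub> nonunits R = {\<zero>\<^bsub>R\<^esub>}"
    using T.all_OA_iff R by simp
  also have "\<dots> \<longleftrightarrow> local_ring A \<and> ideal_pow A M 2 = {\<zero>\<^bsub>A\<^esub>} \<and> ideal_smult M E = {\<zero>\<^bsub>E\<^esub>}"
  proof (cases "local_ring A")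
    case True
    note l = loc[OF True]
    have "nonunits R \<cdot>\<^bsub>R\<^esub> nonunits R = (M \<cdot>\<^bsub>A\<^esub> M) \<times> IE M"
      using full_square[OF l(2)] nonunits_trivial_extension l(1) R by simp
    moreover have "(M \<cdot>\<^bsub>A\<^esub> M) \<times> IE M = {\<zero>\<^bsub>R\<^esub>} \<longleftrightarrow> M \<cdot>\<^bsub>A\<^esub> M = {\<zero>\<^bsub>A\<^esub>} \<and> IE M = {\<zero>\<^bsub>E\<^esub>}"
      using R.ideal_zero[OF R.ideal_prod_is_ideal[OF l(2,2)]] IE_zero[OF l(2)] R by auto
    ultimately show ?thesis using True l local_trivial_extension R by simp
  next
    case False
    then show ?thesis using R.local_ring_iff local_trivial_extension R by simp
  qed
  finally show ?thesis by (intro conjI iff OAFA)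
qed

end
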